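(* For every problem instance satisfying the Piecewise Stabilizability assumption (with constants $C_W\ge 0$, $\epsilon>0$) and the Reference Policy Stationarity assumption (with constants $\delta>0$, $C_V>0$), the policy \texttt{SoftMW}, run with parameters $M,K,\delta$, guarantees $$\frac1T\,\mathbb E\left[\sum_{t=1}^T\lVert\mathbf Q_t\rVert_1\right]\le\frac{2(K+1)M^2+4C_W(KM^2+\epsilon KM)}{\epsilon}+o(1)\qquad(T\to\infty).$$ In particular, the system is stable under \texttt{SoftMW}.
   Context: Notation: $[K]=\{1,\dots,K\}$; $\Delta^{[K]}$ is the probability simplex over $[K]$; $\Delta^{[K],\beta}=\{\mathbf x\in\Delta^{[K]}:x_i\ge\beta\ \forall i\}$. Queueing model: $K$ job types (queues), time slots $t=1,2,\dots$. Distributions $\mathcal A_1,\mathcal A_2,\dots$ and $\mathcal S_1,\mathcal S_2,\dots$ on $[0,M]^K$ ($M>0$ a known constant) are fixed before the process starts; $\mathbf A_t\sim\mathcal A_t$ (arrivals) and $\mathbf S_t\sim\mathcal S_t$ (maximum services), all $\mathbf A_t,\mathbf S_t$ being independent; $\vec\lambda_t=\mathbb E[\mathbf A_t]$, $\vec\sigma_t=\mathbb E[\mathbf S_t]$. At the beginning of slot $t$ the scheduler, using only the past history (and its own randomization), chooses one queue $a_t\in[K]$; then $S_{t,a_t}$ is observed. Queue lengths: $\mathbf Q_0=\mathbf 0$, $Q_{t,i}=\max\{Q_{t-1,i}+A_{t,i}-S_{t,i}\mathbf 1[i=a_t],0\}$. The system is stable under a policy if $\frac1T\sum_{t=0}^{T-1}\sum_{i=1}^K\mathbb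 E[Q_{t,i}]=O(1)$. Piecewise Stabilizability: there exist $C_W\ge0$, $\epsilon>0$, $\vec\theta_1,\vec\theta_2,\dots\in\Delta^{[K]}$ and a partition of the positive integers into intervals $W_0,W_1,\dots$ such that $\sum_{i:\min W_i<T}(|W_i|-1)^2\le C_WT$ for all $T\ge1$, and for all $i\ge0$, $j\in[K]$: $\frac1{|W_i|}\sum_{t\in W_i}\theta_{t,j}\sigma_{t,j}\ge\epsilon+\frac1{|W_i|}\sum_{t\in W_i}\lambda_{t,j}$. Reference Policy Stationarity: for the same sequence $\{\vec\theta_t\}$ there exist $\delta>0$, $C_V>0$ with $\sum_{t=1}^{T-1}\lVert\vec\theta_{t+1}-\vec\theta_t\rVert_1\le C_VT^{\frac12-\delta}$ for all $T\ge1$. \texttt{EXP3.S+} (a bandit algorithm with $K$ actions and initial point $\mathbf x_1\in\Delta^{[K]}$): let $\Psi(\mathbf x)=\sum_i(x_i\ln x_i-x_i)$ and $D_\Psi(\mathbf y,\mathbf x)=\Psi(\mathbf y)-\Psi(\mathbf x)-\langle\nabla\Psi(\mathbf x),\mathbf y-\mathbf x\rangle$. At round $t$, given $\beta_t\in[0,1/K]$, $\eta_t>0$, $\mathbf e_t\in\Delta^{[K]}$, $\gamma_t\in[0,1/2]$: set $\mathbf p_t=(1-\gamma_t)\mathbf x_t+\gamma_t\mathbf e_t$; sample and output $a_t\sim\mathbf p_t$; receive feedback $g_{t,a_t}$; let $\tilde{\mathbf g}_t$ have $a_t$-th coordinate $g_{t,a_t}/p_{t,a_t}$ and zeros elsewhere;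 set $\mathbf x_{t+1}=\arg\min_{\mathbf x'\in\Delta^{[K],\beta_t}}\{\langle-\eta_t\tilde{\mathbf g}_t,\mathbf x'\rangle+D_\Psi(\mathbf x',\mathbf x_t)\}$. \texttt{SoftMW} (inputs $M,K,\delta$): run one \texttt{EXP3.S+} instance with $\mathbf x_1=\mathbf 1/K$. In slot $t=1,2,\dots$ use $\beta_t=t^{-3}/K$, $\eta_t=\Big(t^{-(\frac14-\frac\delta2)}M\sqrt{86M^2K^6t^{3/2}+\sum_{s=0}^{t-1}\lVert\mathbf Q_s\rVert_2^2}\Big)^{-1}$, $\mathbf e_t=\mathbf Q_{t-1}/\lVert\mathbf Q_{t-1}\rVert_1$ (arbitrary in $\Delta^{[K]}$ if $\mathbf Q_{t-1}=\mathbf 0$, in which case $\gamma_t=0$), $\gamma_t=M\eta_t\lVert\mathbf Q_{t-1}\rVert_1$; serve the queue $a_t$ output by \texttt{EXP3.S+}, and feed $g_{t,a_t}=Q_{t-1,a_t}S_{t,a_t}$ back to \texttt{EXP3.S+}.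
   Formalization: The formal theorem adds δ < 1: for large δ (e.g. δ = 10 with constant θ, K = 2, arrivals (0.8,0), services (1,1)) the learning rate is too small for SoftMW to leave uniform scheduling and the bound fails; for δ > 1/2 the assumption already forces θ constant. *)

theory Defs
  imports "HOL-Probability.Probability" "HOL-Library.Landau_Symbols"
begin

text \<open>
  The queues (job types) are the elements of a finite type \<open>'k\<close>, so the number of queues \<open>K\<close> is
  \<open>CARD('k)\<close>.  Time slots are the positive naturals; the value at index 0 of every sequence other
  than the queue lengths is irrelevant.
\<close>

definition l1norm :: "real ^ 'k::finite \<Rightarrow> real" where
  "l1norm v = (\<Sum>i\<in>UNIV. \<bar>v $ i\<bar>)"

definition prob_simplex :: "(real ^ 'k::finite) set" where
  "prob_simplex = {x. (\<forall>i. 0 \<le> x $ i) \<and> (\<Sum>i\<in>UNIV. x $ i) = 1}"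

definition trunc_simplex :: "real \<Rightarrow> (real ^ 'k::finite) set" where
  "trunc_simplex \<beta> = {x \<in> prob_simplex. \<forall>i. \<beta> \<le> x $ i}"


section \<open>Queueing model\<close>

text \<open>The coordinates of a single arrival or service vector may be dependent.\<close>

definition problem_instance ::
    "real \<Rightarrow> (nat \<Rightarrow> (real ^ 'k::finite) measure) \<Rightarrow> (nat \<Rightarrow> (real ^ 'k) measure) \<Rightarrow> bool" where
  "problem_instance M \<A> \<S> \<longleftrightarrow> M > 0 \<and>
     (\<forall>t\<ge>1. prob_space (\<A> t) \<and> sets (\<A> t) = sets borel \<and> (AE v in \<A> t. v \<in> cbox 0 (\<chi> i. M))) \<and>
     (\<forall>t\<ge>1. prob_space (\<S> t) \<and> sets (\<S> t) = sets borel \<and> (AE v in \<S> t. v \<in> cbox 0 (\<chi> i. M)))"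

definition mean :: "(real ^ 'k::finite) measure \<Rightarrow> real ^ 'k" where
  "mean D = (\<integral>v. v \<partial>D)"

definition arrivals_services ::
    "'w measure \<Rightarrow> (nat \<Rightarrow> (real ^ 'k::finite) measure) \<Rightarrow> (nat \<Rightarrow> (real ^ 'k) measure) \<Rightarrow>
     (nat \<Rightarrow> 'w \<Rightarrow> real ^ 'k) \<Rightarrow> (nat \<Rightarrow> 'w \<Rightarrow> real ^ 'k) \<Rightarrow> bool" where
  "arrivals_services P \<A> \<S> A S \<longleftrightarrow> prob_space P \<and>
     (\<forall>t\<ge>1. A t \<in> borel_measurable P \<and> distr P borel (A t) = \<A> t) \<and>
     (\<forall>t\<ge>1. S t \<in> borel_measurable P \<and> distr P borel (S t) = \<S> t) \<and>
     prob_space.indep_vars P (\<lambda>_. borel) (case_sum A S) ({1..} <+> {1..})"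

text \<open>Queue lengths along one sample path of arrivals, services and scheduling decisions.\<close>

primrec queue ::
    "(nat \<Rightarrow> real ^ 'k::finite) \<Rightarrow> (nat \<Rightarrow> real ^ 'k) \<Rightarrow> (nat \<Rightarrow> 'k) \<Rightarrow> nat \<Rightarrow> real ^ 'k" where
  "queue A S a 0 = 0"
| "queue A S a (Suc t) =
     (\<chi> i. max (queue A S a t $ i + A (Suc t) $ i - S (Suc t) $ i * of_bool (i = a (Suc t))) 0)"

definition queue_process ::
    "(nat \<Rightarrow> 'w \<Rightarrow> real ^ 'k::finite) \<Rightarrow> (nat \<Rightarrow> 'w \<Rightarrow> real ^ 'k) \<Rightarrow> (nat \<Rightarrow> 'w \<Rightarrow> 'k) \<Rightarrow>
     nat \<Rightarrow> 'w \<Rightarrow> real ^ 'k" where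
  "queue_process A S a t \<omega> = queue (\<lambda>s. A s \<omega>) (\<lambda>s. S s \<omega>) (\<lambda>s. a s \<omega>) t"

definition system_stable :: "'w measure \<Rightarrow> (nat \<Rightarrow> 'w \<Rightarrow> real ^ 'k::finite) \<Rightarrow> bool" where
  "system_stable P Q \<longleftrightarrow>
     (\<lambda>T. (1 / real T) * (\<Sum>t<T. \<Sum>i\<in>UNIV. \<integral>\<omega>. Q t \<omega> $ i \<partial>P)) \<in> O(\<lambda>_. 1)"


section \<open>Assumptions on the instance\<close>

definition interval_partition :: "(nat \<Rightarrow> nat set) \<Rightarrow> bool" where
  "interval_partition W \<longleftrightarrow>
     (\<forall>i. \<exists>l u. l \<le> u \<and> W i = {l..u}) \<and> disjoint_family W \<and> (\<Union>i. W i) = {1..}"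

definition piecewise_stabilizable ::
    "(nat \<Rightarrow> real ^ 'k::finite) \<Rightarrow> (nat \<Rightarrow> real ^ 'k) \<Rightarrow> (nat \<Rightarrow> real ^ 'k) \<Rightarrow> real \<Rightarrow> real \<Rightarrow> bool"
  where
  "piecewise_stabilizable \<Lambda> \<Sigma> \<theta> C\<^sub>W \<epsilon> \<longleftrightarrow> C\<^sub>W \<ge> 0 \<and> \<epsilon> > 0 \<and> (\<forall>t\<ge>1. \<theta> t \<in> prob_simplex) \<and>
     (\<exists>W. interval_partition W \<and>
        (\<forall>T\<ge>1. (\<Sum>i | Min (W i) < T. (real (card (W i)) - 1)\<^sup>2) \<le> C\<^sub>W * real T) \<and>
        (\<forall>i j. (1 / real (card (W i))) * (\<Sum>t\<in>W i. \<theta> t $ j * \<Sigma> t $ j) \<ge>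
               \<epsilon> + (1 / real (card (W i))) * (\<Sum>t\<in>W i. \<Lambda> t $ j)))"

definition reference_stationary :: "(nat \<Rightarrow> real ^ 'k::finite) \<Rightarrow> real \<Rightarrow> real \<Rightarrow> bool" where
  "reference_stationary \<theta> \<delta> C\<^sub>V \<longleftrightarrow> \<delta> > 0 \<and> C\<^sub>V > 0 \<and>
     (\<forall>T\<ge>1. (\<Sum>t=1..<T. l1norm (\<theta> (t + 1) - \<theta> t)) \<le> C\<^sub>V * real T powr (1/2 - \<delta>))"


section \<open>The bandit algorithm EXP3.S+\<close>

definition neg_entropy :: "real ^ 'k::finite \<Rightarrow> real" where
  "neg_entropy x = (\<Sum>i\<in>UNIV. x $ i * ln (x $ i) - x $ i)"

definition bregman :: "('a::real_normed_vector \<Rightarrow> real) \<Rightarrow> 'a \<Rightarrow> 'a \<Rightarrow> real" where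
  "bregman \<Psi> y x = \<Psi> y - \<Psi> x - frechet_derivative \<Psi> (at x) (y - x)"

definition exp3_mix :: "real \<Rightarrow> real ^ 'k::finite \<Rightarrow> real ^ 'k \<Rightarrow> real ^ 'k" where
  "exp3_mix \<gamma> x e = (1 - \<gamma>) *\<^sub>R x + \<gamma> *\<^sub>R e"

definition exp3_estimate :: "real ^ 'k::finite \<Rightarrow> 'k \<Rightarrow> real \<Rightarrow> real ^ 'k" where
  "exp3_estimate p a g = axis a (g / p $ a)"

text \<open>For \<open>0 \<le> \<beta> \<le> 1/K\<close> and \<open>x\<close> with positive coordinates the minimiser exists and is unique.\<close>

definition exp3_update :: "real \<Rightarrow> real \<Rightarrow> real ^ 'k::finite \<Rightarrow> real ^ 'k \<Rightarrow> real ^ 'k" where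
  "exp3_update \<beta> \<eta> x g =
     arg_min_on (\<lambda>x'. (- \<eta> *\<^sub>R g) \<bullet> x' + bregman neg_entropy x' x) (trunc_simplex \<beta>)"

text \<open>
  \<open>exp3_iterate x1 \<beta> \<eta> e \<gamma> a g t\<close> is the point \<open>x\<^sub>t\<close> (\<open>t \<ge> 1\<close>) when the actions drawn are \<open>a\<close> and the
  scalar feedback received in round \<open>s\<close> is \<open>g s\<close>.
\<close>

primrec exp3_iterate ::
    "real ^ 'k::finite \<Rightarrow> (nat \<Rightarrow> real) \<Rightarrow> (nat \<Rightarrow> real) \<Rightarrow> (nat \<Rightarrow> real ^ 'k) \<Rightarrow> (nat \<Rightarrow> real) \<Rightarrow>
     (nat \<Rightarrow> 'k) \<Rightarrow> (nat \<Rightarrow> real) \<Rightarrow> nat \<Rightarrow> real ^ 'k" where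
  "exp3_iterate x1 \<beta> \<eta> e \<gamma> a g 0 = x1"
| "exp3_iterate x1 \<beta> \<eta> e \<gamma> a g (Suc t) =
     (if t = 0 then x1
      else let x = exp3_iterate x1 \<beta> \<eta> e \<gamma> a g t
           in exp3_update (\<beta> t) (\<eta> t) x (exp3_estimate (exp3_mix (\<gamma> t) x (e t)) (a t) (g t)))"


section \<open>The policy SoftMW\<close>

text \<open>
  In these sample-path definitions \<open>Q\<close> is the sequence of queue lengths.  Pitfall: if \<open>\<theta>\<close> is constant,
  \<open>reference_stationary\<close> holds for every \<open>\<delta> > 0\<close>, but a large \<open>\<delta>\<close> makes the learning rate so small that
  the policy hardly moves away from uniform scheduling.
\<close>

definition softmw_eta :: "real \<Rightarrow> real \<Rightarrow> (nat \<Rightarrow> real ^ 'k::finite) \<Rightarrow> nat \<Rightarrow> real" where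
  "softmw_eta M \<delta> Q t =
     inverse (real t powr (- (1/4 - \<delta>/2)) * M *
       sqrt (86 * M\<^sup>2 * real CARD('k) ^ 6 * real t powr (3/2) + (\<Sum>s<t. (norm (Q s))\<^sup>2)))"

definition softmw_gamma :: "real \<Rightarrow> real \<Rightarrow> (nat \<Rightarrow> real ^ 'k::finite) \<Rightarrow> nat \<Rightarrow> real" where
  "softmw_gamma M \<delta> Q t = M * softmw_eta M \<delta> Q t * l1norm (Q (t - 1))"

definition softmw_point ::
    "real \<Rightarrow> real \<Rightarrow> (nat \<Rightarrow> real ^ 'k::finite) \<Rightarrow> (nat \<Rightarrow> real ^ 'k) \<Rightarrow> (nat \<Rightarrow> real ^ 'k) \<Rightarrow>
     (nat \<Rightarrow> 'k) \<Rightarrow> nat \<Rightarrow> real ^ 'k" where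
  "softmw_point M \<delta> Q S e a =
     exp3_iterate (\<chi> i. 1 / real CARD('k)) (\<lambda>t. real t powr (-3) / real CARD('k))
       (softmw_eta M \<delta> Q) e (softmw_gamma M \<delta> Q) a (\<lambda>t. Q (t - 1) $ a t * S t $ a t)"

definition softmw_prob ::
    "real \<Rightarrow> real \<Rightarrow> (nat \<Rightarrow> real ^ 'k::finite) \<Rightarrow> (nat \<Rightarrow> real ^ 'k) \<Rightarrow> (nat \<Rightarrow> real ^ 'k) \<Rightarrow>
     (nat \<Rightarrow> 'k) \<Rightarrow> nat \<Rightarrow> real ^ 'k" where
  "softmw_prob M \<delta> Q S e a t =
     exp3_mix (softmw_gamma M \<delta> Q t) (softmw_point M \<delta> Q S e a t) (e t)"

text \<open>
  The sigma-algebra generated by the scheduling decisions before slot \<open>t\<close> together with all arrivals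
  and services, including those of slots \<open>t\<close>, \<open>t + 1\<close>, \dots.
\<close>

definition info_before ::
    "'w measure \<Rightarrow> (nat \<Rightarrow> 'w \<Rightarrow> real ^ 'k::finite) \<Rightarrow> (nat \<Rightarrow> 'w \<Rightarrow> real ^ 'k) \<Rightarrow>
     (nat \<Rightarrow> 'w \<Rightarrow> 'k) \<Rightarrow> nat \<Rightarrow> 'w measure" where
  "info_before P A S a t = sigma (space P)
     ({A s -` B \<inter> space P | s B. 1 \<le> s \<and> B \<in> sets borel} \<union>
      {S s -` B \<inter> space P | s B. 1 \<le> s \<and> B \<in> sets borel} \<union>
      {a s -` {i} \<inter> space P | s i. 1 \<le> s \<and> s < t})"

text \<open>
  \<open>a\<close> is the sequence of queues served by SoftMW, and \<open>e\<close> its exploration directions, left open where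
  the queues are empty.  Sampling \<open>a\<^sub>t \<sim> p\<^sub>t\<close> with internal randomisation means that \<open>p\<^sub>t\<close>, a function
  of the past, is the law of \<open>a\<^sub>t\<close> even conditionally on \<open>info_before\<close>: given the past, the
  decision is independent of current and future arrivals and services.
\<close>

definition runs_softmw ::
    "'w measure \<Rightarrow> real \<Rightarrow> real \<Rightarrow> (nat \<Rightarrow> 'w \<Rightarrow> real ^ 'k::finite) \<Rightarrow> (nat \<Rightarrow> 'w \<Rightarrow> real ^ 'k) \<Rightarrow>
     (nat \<Rightarrow> 'w \<Rightarrow> real ^ 'k) \<Rightarrow> (nat \<Rightarrow> 'w \<Rightarrow> 'k) \<Rightarrow> bool" where
  "runs_softmw P M \<delta> A S e a \<longleftrightarrow>
     (let Q = queue_process A S a in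
      (\<forall>t\<ge>1. a t \<in> measurable P (count_space UNIV)) \<and>
      (\<forall>t\<ge>1. \<forall>\<omega>\<in>space P. e t \<omega> \<in> prob_simplex \<and>
         (Q (t - 1) \<omega> \<noteq> 0 \<longrightarrow> e t \<omega> = Q (t - 1) \<omega> /\<^sub>R l1norm (Q (t - 1) \<omega>))) \<and>
      (\<forall>t\<ge>1. \<forall>i. AE \<omega> in P.
         real_cond_exp P (info_before P A S a t) (indicator {\<omega> \<in> space P. a t \<omega> = i}) \<omega> =
         softmw_prob M \<delta> (\<lambda>s. Q s \<omega>) (\<lambda>s. S s \<omega>) (\<lambda>s. e s \<omega>) (\<lambda>s. a s \<omega>) t $ i))"

end

theory Submission
  imports Defs
begin

text \<open>
  The proof combines a quadratic Lyapunov function with a regret bound for the bandit algorithm.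
  Write \<open>g\<^sub>t\<^sub>,\<^sub>i = Q\<^sub>t\<^sub>-\<^sub>1\<^sub>,\<^sub>i S\<^sub>t\<^sub>,\<^sub>i\<close>.  In slot \<open>t\<close> the squared norm of the queue vector grows by at most
  \<open>2 (Q\<^sub>t\<^sub>-\<^sub>1 \<bullet> A\<^sub>t - g\<^sub>t\<^sub>,\<^sub>a\<^sub>t) + K M\<^sup>2\<close>, and \<open>g\<^sub>t\<^sub>,\<^sub>a\<^sub>t\<close> is precisely the reward that the bandit algorithm
  receives.  If the algorithm collects almost as much as the reference policy \<open>\<theta>\<close> would, then in
  expectation the sum of \<open>E Q\<^sub>t\<^sub>-\<^sub>1\<^sub>,\<^sub>i (\<theta>\<^sub>t\<^sub>,\<^sub>i \<sigma>\<^sub>t\<^sub>,\<^sub>i - \<lambda>\<^sub>t\<^sub>,\<^sub>i)\<close> over \<open>t \<le> T\<close> and \<open>i\<close> is at most \<open>K M\<^sup>2 T / 2\<close>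
  plus the regret (\<open>expected_drift\<close>).  Queue lengths move by at most \<open>M\<close> per slot, so on each interval
  of the partition they are nearly constant and the stabilizability condition turns the left-hand side
  into \<open>\<epsilon>\<close> times the total expected queue length, up to an error proportional to the squared length of
  the interval (\<open>drift_on_interval\<close>).

  The regret is that of entropic mirror descent with importance weighted estimates
  (\<open>mirror_step\<close>, \<open>estimate_regret_le\<close>).  With \<open>\<alpha> = 1/4 - \<delta>/2\<close> and \<open>v\<^sub>T\<close> the square root occurring in the
  learning rate, it is of order \<open>T\<^sup>|\<^sup>\<alpha>\<^sup>| v\<^sub>T\<close> times a logarithm, where \<open>|\<alpha>| < 1/4\<close>.  The rewards are
  as large as the queues, hence \<open>v\<^sub>T\<close> depends on the very quantity to be bounded; but a queue that is
  long now has been long for a while, so that \<open>v\<^sub>T\<close> is at most a constant times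
  \<open>T\<^sup>3\<^sup>/\<^sup>4 (1 + X\<^sub>T / T)\<close>, where \<open>X\<^sub>T\<close> is the total queue length up to \<open>T\<close> (\<open>v_le\<close>).  The regret is thus
  \<open>o(T) + o(1) X\<^sub>T\<close>, and the second part is absorbed by \<open>\<epsilon> X\<^sub>T\<close>.

  Two probabilistic facts connect paths and expectations.  Under the expectation, the indicator of a
  decision may be replaced by its conditional probability (\<open>integral_action\<close>), and the queues before
  slot \<open>t\<close> are independent of the arrivals and services in slot \<open>t\<close> (\<open>expectation_queue_mult\<close>).  The
  latter is obtained by splitting the space according to the finitely many possible sequences of
  earlier decisions.

  The argument gives a leading constant at most a quarter of the claimed one, so that the average
  queue length is eventually below the claimed constant.
\<close>

section \<open>Entropic mirror steps on the truncated simplex\<close>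

lemma entropy_tangent:
  fixes a b :: real
  assumes "a > 0" "b > 0"
  shows "(b - a) * ln a \<le> (b * ln b - b) - (a * ln a - a)"
proof -
  have "ln (a / b) \<le> a / b - 1" using assms by (intro ln_le_minus_one) auto
  then have "b * ln (a / b) \<le> b * (a / b - 1)" using assms by (intro mult_left_mono) auto
  then show ?thesis using assms by (simp add: ln_div algebra_simps)
qed

definition log_vec :: "real ^ 'k::finite \<Rightarrow> real ^ 'k" where
  "log_vec x = (\<chi> i. ln (x $ i))"

lemma neg_entropy_has_derivative:
  fixes x :: "real ^ 'k::finite"
  assumes "\<forall>i. x $ i > 0"
  shows "(neg_entropy has_derivative (\<lambda>h. log_vec x \<bullet> h)) (at x)"
proof -
  have nth: "((\<lambda>y. y $ i) has_derivative (\<lambda>h. h $ i)) (at x)" for i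
    by (rule bounded_linear.has_derivative[OF bounded_linear_vec_nth]) (rule has_derivative_ident)
  have "((\<lambda>y. \<Sum>i\<in>UNIV. y $ i * ln (y $ i) - y $ i) has_derivative
        (\<lambda>h. \<Sum>i\<in>UNIV. ln (x $ i) * h $ i)) (at x)"
  proof (rule has_derivative_sum)
    fix i :: 'k
    have "x $ i > 0" using assms by auto
    then show "((\<lambda>y. y $ i * ln (y $ i) - y $ i) has_derivative (\<lambda>h. ln (x $ i) * h $ i)) (at x)"
      by (auto intro!: derivative_eq_intros nth simp: field_simps)
  qed
  then show ?thesis by (simp add: neg_entropy_def[abs_def] log_vec_def inner_vec_def)
qed

lemma bregman_neg_entropy:
  assumes "\<forall>i. x $ i > 0"
  shows "bregman neg_entropy y x = neg_entropy y - neg_entropy x - log_vec x \<bullet> (y - x)"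
  using frechet_derivative_at[OF neg_entropy_has_derivative[OF assms]]
  by (simp add: bregman_def fun_eq_iff)

text \<open>
  The coordinatewise logarithm is the gradient of the negative entropy; a mirror step from \<open>x\<close> along \<open>g\<close>
  is the following map evaluated at \<open>\<eta> g + ln x\<close>.
\<close>
definition entropic_argmin :: "real \<Rightarrow> real ^ 'k::finite \<Rightarrow> real ^ 'k" where
  "entropic_argmin \<beta> z = arg_min_on (\<lambda>y. neg_entropy y - z \<bullet> y) (trunc_simplex \<beta>)"

text \<open>
  The Bregman divergence from \<open>x\<close> is the negative entropy minus its linearisation at \<open>x\<close>, so that, up to
  an additive constant, the objective depends on \<open>x\<close> only through its gradient there.
\<close>
lemma exp3_update_eq_entropic_argmin:
  assumes "\<forall>i. x $ i > 0"
  shows "exp3_update \<beta> \<eta> x g = entropic_argmin \<beta> (\<eta> *\<^sub>R g + log_vec x)"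
proof -
  let ?f = "\<lambda>y. (- \<eta> *\<^sub>R g) \<bullet> y + bregman neg_entropy y x"
  let ?h = "\<lambda>y. neg_entropy y - (\<eta> *\<^sub>R g + log_vec x) \<bullet> y"
  define c where "c = log_vec x \<bullet> x - neg_entropy x"
  have "?f y = ?h y + c" for y
    by (simp add: bregman_neg_entropy[OF assms] c_def algebra_simps)
  then have "is_arg_min ?f P = is_arg_min ?h P" for P
    by (auto simp: is_arg_min_def fun_eq_iff)
  then show ?thesis
    unfolding exp3_update_def entropic_argmin_def arg_min_on_def arg_min_def by metis
qed

lemma trunc_simplex_mono: "\<beta> \<le> \<beta>' \<Longrightarrow> trunc_simplex \<beta>' \<subseteq> trunc_simplex \<beta>"
  by (force simp: trunc_simplex_def intro: order_trans)

lemma uniform_in_trunc_simplex: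
  assumes "\<beta> \<le> 1 / real CARD('k)"
  shows "(\<chi> i. 1 / real CARD('k)) \<in> (trunc_simplex \<beta> :: (real ^ 'k::finite) set)"
  using assms by (auto simp: trunc_simplex_def prob_simplex_def)

lemma prob_simplex_le_1: "x \<in> prob_simplex \<Longrightarrow> x $ i \<le> 1"
  unfolding prob_simplex_def
  by (smt (verit) member_le_sum finite_class.finite_UNIV UNIV_I mem_Collect_eq)

lemma compact_trunc_simplex: "compact (trunc_simplex \<beta> :: (real ^ 'k::finite) set)"
proof -
  have eq: "(trunc_simplex \<beta> :: (real ^ 'k) set) =
     (\<Inter>i. {x. 0 \<le> x $ i}) \<inter> {x. (\<Sum>i\<in>UNIV. x $ i) = 1} \<inter> (\<Inter>i. {x. \<beta> \<le> x $ i})"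
    by (auto simp: trunc_simplex_def prob_simplex_def)
  have "closed (trunc_simplex \<beta> :: (real ^ 'k) set)"
    unfolding eq
    by (intro closed_Int closed_INT ballI closed_Collect_le closed_Collect_eq continuous_intros)
  moreover have "bounded (trunc_simplex \<beta> :: (real ^ 'k) set)"
  proof (rule boundedI)
    fix x :: "real ^ 'k" assume "x \<in> trunc_simplex \<beta>"
    then have x: "x \<in> prob_simplex" by (simp add: trunc_simplex_def)
    have "norm x \<le> (\<Sum>i\<in>UNIV. \<bar>x $ i\<bar>)" by (rule norm_le_l1_cart)
    also have "\<dots> = 1" using x by (simp add: prob_simplex_def)
    finally show "norm x \<le> 1" .
  qed
  ultimately show ?thesis by (simp add: compact_eq_bounded_closed)
qed

lemma trunc_simplex_pos: "x \<in> trunc_simplex \<beta> \<Longrightarrow> \<beta> > 0 \<Longrightarrow> x $ i > 0"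
  by (auto simp: trunc_simplex_def intro: less_le_trans)

lemma
  fixes z :: "real ^ 'k::finite"
  assumes "0 < \<beta>" "\<beta> \<le> 1 / real CARD('k)"
  shows entropic_argmin_in: "entropic_argmin \<beta> z \<in> trunc_simplex \<beta>"
    and entropic_argmin_le: "u \<in> trunc_simplex \<beta> \<Longrightarrow>
      neg_entropy (entropic_argmin \<beta> z) - z \<bullet> entropic_argmin \<beta> z \<le> neg_entropy u - z \<bullet> u"
proof -
  let ?f = "\<lambda>y. neg_entropy y - z \<bullet> y"
  have "continuous_on (trunc_simplex \<beta>) ?f"
    unfolding neg_entropy_def using assms(1)
    by (intro continuous_intros) (metis trunc_simplex_pos less_irrefl)
  then obtain y where "y \<in> trunc_simplex \<beta>" "\<forall>u\<in>trunc_simplex \<beta>. ?f y \<le> ?f u"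
    using continuous_attains_inf[OF compact_trunc_simplex] uniform_in_trunc_simplex[OF assms(2)]
    by blast
  then have "is_arg_min ?f (\<lambda>y. y \<in> trunc_simplex \<beta>) y"
    by (auto simp: is_arg_min_def not_less)
  then have "is_arg_min ?f (\<lambda>y. y \<in> trunc_simplex \<beta>) (entropic_argmin \<beta> z)"
    unfolding entropic_argmin_def arg_min_on_def arg_min_def by (rule someI)
  then show "entropic_argmin \<beta> z \<in> trunc_simplex \<beta>"
    "u \<in> trunc_simplex \<beta> \<Longrightarrow>
      neg_entropy (entropic_argmin \<beta> z) - z \<bullet> entropic_argmin \<beta> z \<le> neg_entropy u - z \<bullet> u"
    by (auto simp: is_arg_min_def not_less)
qed

lemma trunc_simplex_segment:
  assumes "x \<in> trunc_simplex \<beta>" "y \<in> trunc_simplex \<beta>" "0 \<le> s" "s \<le> 1"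
  shows "x + s *\<^sub>R (y - x) \<in> trunc_simplex \<beta>"
proof -
  have comp: "(x + s *\<^sub>R (y - x)) $ i = (1 - s) * x $ i + s * y $ i" for i
    by (simp add: algebra_simps)
  have "c \<le> (1 - s) * x $ i + s * y $ i" if "c \<le> x $ i" "c \<le> y $ i" for c i
    using convex_bound_le[of "- (x $ i)" "- c" "- (y $ i)" "1 - s" s] that assms(3,4) by simp
  moreover have "(\<Sum>i\<in>UNIV. (1 - s) * x $ i + s * y $ i) = 1"
    using assms by (simp add: sum.distrib sum_distrib_left[symmetric] trunc_simplex_def prob_simplex_def)
  ultimately show ?thesis
    using assms(1,2) unfolding trunc_simplex_def prob_simplex_def mem_Collect_eq comp by auto
qed

lemma neg_entropy_tangent:
  assumes "\<forall>i. x $ i > 0" "\<forall>i. y $ i > 0"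
  shows "log_vec x \<bullet> (y - x) \<le> neg_entropy y - neg_entropy x"
  unfolding neg_entropy_def sum_subtractf[symmetric] inner_vec_def log_vec_def
  using entropy_tangent assms by (intro sum_mono) (simp add: mult.commute)

text \<open>
  First-order optimality.  By convexity, moving from the minimiser a fraction \<open>s\<close> of the way towards \<open>u\<close>
  changes the objective by at most \<open>s\<close> times its slope at the new point; divide by \<open>s\<close> and let \<open>s\<close> tend
  to 0.
\<close>
lemma entropic_argmin_optimality:
  fixes z :: "real ^ 'k::finite"
  assumes \<beta>: "0 < \<beta>" "\<beta> \<le> 1 / real CARD('k)" and u: "u \<in> trunc_simplex \<beta>"
  shows "0 \<le> (log_vec (entropic_argmin \<beta> z) - z) \<bullet> (u - entropic_argmin \<beta> z)"
proof -
  define y where "y = entropic_argmin \<beta> z"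
  have y: "y \<in> trunc_simplex \<beta>" unfolding y_def by (rule entropic_argmin_in[OF \<beta>])
  let ?\<phi> = "\<lambda>s. (log_vec (y + s *\<^sub>R (u - y)) - z) \<bullet> (u - y)"
  have nn: "0 \<le> ?\<phi> s" if s: "0 < s" "s < 1" for s
  proof -
    let ?y = "y + s *\<^sub>R (u - y)"
    have ys: "?y \<in> trunc_simplex \<beta>" using trunc_simplex_segment[OF y u] s by simp
    have "0 \<le> neg_entropy ?y - z \<bullet> ?y - (neg_entropy y - z \<bullet> y)"
      using entropic_argmin_le[OF \<beta> ys, of z] by (simp add: y_def)
    moreover have "log_vec ?y \<bullet> (y - ?y) \<le> neg_entropy y - neg_entropy ?y"
      using ys y \<beta> trunc_simplex_pos by (intro neg_entropy_tangent) blast+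
    ultimately have "0 \<le> s * ?\<phi> s" by (simp add: algebra_simps)
    then show ?thesis using s by (simp add: zero_le_mult_iff)
  qed
  have "y $ i > 0" for i using trunc_simplex_pos[OF y \<beta>(1)] .
  then have "isCont (\<lambda>s. \<Sum>i\<in>UNIV. (ln ((y + s *\<^sub>R (u - y)) $ i) - z $ i) * (u - y) $ i) 0"
    by (intro continuous_intros) (simp_all add: less_imp_neq[symmetric])
  then have "isCont ?\<phi> 0"
    by (simp add: log_vec_def inner_vec_def)
  then have "(?\<phi> \<longlongrightarrow> ?\<phi> 0) (at_right 0)"
    by (simp add: isCont_def filterlim_at_split)
  moreover have "\<forall>\<^sub>F s in at_right 0. 0 \<le> ?\<phi> s"
    using nn by (auto simp: eventually_at_right_field intro!: exI[of _ 1])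
  ultimately have "0 \<le> ?\<phi> 0"
    by (rule tendsto_lowerbound) simp
  then show ?thesis by (simp add: y_def)
qed

lemma square_diff_le_ln:
  fixes a b :: real
  assumes "0 < a" "a \<le> 1" "0 < b" "b \<le> 1"
  shows "(a - b)\<^sup>2 \<le> (ln a - ln b) * (a - b)"
proof -
  have *: "(a - b)\<^sup>2 \<le> (ln a - ln b) * (a - b)" if "0 < b" "b \<le> a" "a \<le> 1" for a b :: real
  proof -
    have "ln (b / a) \<le> b / a - 1" using that by (intro ln_le_minus_one) auto
    then have "1 - b / a \<le> ln a - ln b" using that by (simp add: ln_div)
    moreover have "a - b \<le> 1 - b / a"
      using that mult_left_mono[of a 1 "a - b"] by (simp add: field_simps)
    ultimately have "(a - b) * (a - b) \<le> (ln a - ln b) * (a - b)"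
      using that by (intro mult_right_mono) auto
    then show ?thesis by (simp add: power2_eq_square)
  qed
  show ?thesis
  proof (cases "b \<le> a")
    case False
    then show ?thesis using *[of a b] assms by (simp add: power2_commute algebra_simps)
  qed (use * assms in auto)
qed

text \<open>
  Adding the optimality conditions of two minimisers \<open>y\<close> and \<open>y'\<close> gives
  \<open>(ln y - ln y') \<bullet> (y - y') \<le> (z - z') \<bullet> (y - y')\<close>, and the logarithm expands distances on the unit
  interval.  Continuity makes the points chosen by the algorithm measurable functions of the past.
\<close>
lemma entropic_argmin_lipschitz:
  fixes z z' :: "real ^ 'k::finite"
  assumes \<beta>: "0 < \<beta>" "\<beta> \<le> 1 / real CARD('k)"
  shows "norm (entropic_argmin \<beta> z - entropic_argmin \<beta> z') \<le> norm (z - z')"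
proof -
  define y y' where "y = entropic_argmin \<beta> z" and "y' = entropic_argmin \<beta> z'"
  have y: "y \<in> trunc_simplex \<beta>" "y' \<in> trunc_simplex \<beta>"
    unfolding y_def y'_def by (rule entropic_argmin_in[OF \<beta>])+
  have o: "0 \<le> (log_vec y - z) \<bullet> (y' - y)" "0 \<le> (log_vec y' - z') \<bullet> (y - y')"
    using entropic_argmin_optimality[OF \<beta>] y by (auto simp: y_def y'_def)
  have "(norm (y - y'))\<^sup>2 = (\<Sum>i\<in>UNIV. (y $ i - y' $ i)\<^sup>2)"
    unfolding power2_norm_eq_inner inner_vec_def by (simp add: power2_eq_square)
  also have "\<dots> \<le> (\<Sum>i\<in>UNIV. (ln (y $ i) - ln (y' $ i)) * (y $ i - y' $ i))"
    using y trunc_simplex_pos[OF _ \<beta>(1)] prob_simplex_le_1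
    by (intro sum_mono square_diff_le_ln) (auto simp: trunc_simplex_def)
  also have "\<dots> = (log_vec y - log_vec y') \<bullet> (y - y')"
    by (simp add: inner_vec_def log_vec_def)
  also have "\<dots> \<le> (z - z') \<bullet> (y - y')"
    using o by (simp add: inner_diff_left inner_diff_right)
  also have "\<dots> \<le> norm (z - z') * norm (y - y')" by (rule norm_cauchy_schwarz)
  finally show ?thesis
    unfolding y_def[symmetric] y'_def[symmetric] power2_eq_square
    by (cases "norm (y - y') = 0") (auto simp: mult_le_cancel_right)
qed

lemma borel_measurable_entropic_argmin:
  fixes \<beta> :: real
  assumes "0 < \<beta>" "\<beta> \<le> 1 / real CARD('k::finite)"
  shows "(entropic_argmin \<beta> :: real ^ 'k \<Rightarrow> real ^ 'k) \<in> borel_measurable borel"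
proof -
  have "1-lipschitz_on UNIV (entropic_argmin \<beta> :: real ^ 'k \<Rightarrow> real ^ 'k)"
    by (rule lipschitz_onI) (simp_all add: dist_norm entropic_argmin_lipschitz[OF assms])
  then show ?thesis
    by (intro borel_measurable_continuous_onI lipschitz_on_continuous_on)
qed

definition kl :: "real ^ 'k::finite \<Rightarrow> real ^ 'k \<Rightarrow> real" where
  "kl u x = (\<Sum>i\<in>UNIV. u $ i * (ln (u $ i) - ln (x $ i)))"

text \<open>
  The optimality condition at the new point \<open>y\<close> leaves the term \<open>w \<bullet> (y - x) - KL(y, x)\<close>.  By the
  duality between entropy and exponential it is at most the sum of \<open>x\<^sub>i (exp w\<^sub>i - 1 - w\<^sub>i)\<close>.  The weights
  \<open>x\<^sub>i\<close> in the quadratic term matter: for an importance weighted estimate they cancel one of the two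
  factors \<open>1 / p\<^sub>i\<close> in its second moment.
\<close>
lemma mirror_step:
  fixes x w u :: "real ^ 'k::finite"
  assumes \<beta>: "0 < \<beta>" "\<beta> \<le> 1 / real CARD('k)"
    and x: "x \<in> prob_simplex" "\<forall>i. x $ i > 0"
    and w: "\<forall>i. 0 \<le> w $ i" "\<forall>i. w $ i \<le> 1"
    and u: "u \<in> trunc_simplex \<beta>"
  shows "w \<bullet> (u - x) \<le> kl u x - kl u (entropic_argmin \<beta> (w + log_vec x))
     + (\<Sum>i\<in>UNIV. x $ i * (w $ i)\<^sup>2)"
proof -
  define y where "y = entropic_argmin \<beta> (w + log_vec x)"
  have y: "y \<in> trunc_simplex \<beta>" unfolding y_def by (rule entropic_argmin_in[OF \<beta>])
  have ypos: "y $ i > 0" for i using trunc_simplex_pos[OF y \<beta>(1)] .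
  have sums: "(\<Sum>i\<in>UNIV. x $ i) = 1" "(\<Sum>i\<in>UNIV. y $ i) = 1"
    using x(1) y by (auto simp: trunc_simplex_def prob_simplex_def)
  have "0 \<le> (log_vec y - (w + log_vec x)) \<bullet> (u - y)"
    unfolding y_def by (rule entropic_argmin_optimality[OF \<beta> u])
  also have "\<dots> = kl u x - kl u y - kl y x - w \<bullet> (u - y)"
    by (simp add: inner_vec_def log_vec_def kl_def sum_subtractf[symmetric] sum.distrib[symmetric]
        algebra_simps)
  finally have 1: "w \<bullet> (u - y) \<le> kl u x - kl u y - kl y x" by simp
  have "y $ i * w $ i - x $ i * w $ i - y $ i * (ln (y $ i) - ln (x $ i)) + (y $ i - x $ i)
      \<le> x $ i * (w $ i)\<^sup>2" for i
  proof -
    let ?r = "x $ i * exp (w $ i)"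
    have "(y $ i - ?r) * ln ?r \<le> (y $ i * ln (y $ i) - y $ i) - (?r * ln ?r - ?r)"
      using x ypos by (intro entropy_tangent) auto
    moreover have "ln ?r = ln (x $ i) + w $ i" using x(2) by (simp add: ln_mult less_imp_neq[symmetric])
    ultimately have "y $ i * w $ i - y $ i * (ln (y $ i) - ln (x $ i)) + y $ i \<le> ?r"
      by (simp add: algebra_simps)
    also have "\<dots> \<le> x $ i * (1 + w $ i + (w $ i)\<^sup>2)"
      using w x(2) exp_bound by (intro mult_left_mono) (auto simp: less_imp_le)
    finally show ?thesis by (simp add: algebra_simps)
  qed
  then have "(\<Sum>i\<in>UNIV. y $ i * w $ i - x $ i * w $ i - y $ i * (ln (y $ i) - ln (x $ i)) + (y $ i - x $ i))
      \<le> (\<Sum>i\<in>UNIV. x $ i * (w $ i)\<^sup>2)" by (intro sum_mono)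
  moreover have "(\<Sum>i\<in>UNIV. y $ i * w $ i - x $ i * w $ i - y $ i * (ln (y $ i) - ln (x $ i)) + (y $ i - x $ i))
      = w \<bullet> (y - x) - kl y x"
    using sums by (simp add: inner_vec_def kl_def sum_subtractf sum.distrib algebra_simps)
  ultimately show ?thesis
    using 1 unfolding y_def[symmetric] by (simp add: inner_diff_right)
qed

lemma kl_nonneg:
  assumes "u \<in> prob_simplex" "x \<in> prob_simplex" "\<forall>i. u $ i > 0" "\<forall>i. x $ i > 0"
  shows "0 \<le> kl u x"
proof -
  have "u $ i - x $ i \<le> u $ i * (ln (u $ i) - ln (x $ i))" for i
    using entropy_tangent[of "x $ i" "u $ i"] assms(3,4) by (simp add: algebra_simps)
  then have "(\<Sum>i\<in>UNIV. u $ i - x $ i) \<le> kl u x" unfolding kl_def by (intro sum_mono)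
  then show ?thesis using assms(1,2) by (simp add: sum_subtractf prob_simplex_def)
qed

lemma kl_le:
  assumes "u \<in> trunc_simplex b" "x \<in> trunc_simplex b" "0 < b"
  shows "kl u x \<le> ln (1 / b)"
proof -
  have "kl u x \<le> (\<Sum>i\<in>UNIV. u $ i * ln (1 / b))"
    unfolding kl_def
  proof (intro sum_mono mult_left_mono)
    fix i
    have "ln (u $ i) \<le> 0" "ln b \<le> ln (x $ i)"
      using assms trunc_simplex_pos[OF assms(1,3)] trunc_simplex_pos[OF assms(2,3)] prob_simplex_le_1
      by (auto simp: trunc_simplex_def)
    then show "ln (u $ i) - ln (x $ i) \<le> ln (1 / b)" using assms(3) by (simp add: ln_div)
    show "0 \<le> u $ i" using trunc_simplex_pos[OF assms(1,3)] by (simp add: less_imp_le)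
  qed
  also have "\<dots> = ln (1 / b)"
    using assms(1) by (simp add: sum_distrib_right[symmetric] trunc_simplex_def prob_simplex_def)
  finally show ?thesis .
qed

text \<open>
  The price of replacing the comparator \<open>u'\<close> by \<open>u\<close>: truncation keeps all logarithms bounded.
\<close>
lemma kl_diff_le:
  assumes "u \<in> trunc_simplex b" "u' \<in> trunc_simplex b" "x \<in> trunc_simplex b" "0 < b"
  shows "kl u x - kl u' x \<le> 2 * ln (1 / b) * l1norm (u - u')"
proof -
  have ln_abs: "\<bar>ln (y $ i)\<bar> \<le> ln (1 / b)" if "y \<in> trunc_simplex b" for y i
  proof -
    have "ln (y $ i) \<le> 0" "ln b \<le> ln (y $ i)"
      using that assms(4) trunc_simplex_pos[OF that assms(4)] prob_simplex_le_1
      by (auto simp: trunc_simplex_def)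
    then show ?thesis using assms(4) by (simp add: ln_div)
  qed
  have sums: "(\<Sum>i\<in>UNIV. u $ i) = 1" "(\<Sum>i\<in>UNIV. u' $ i) = 1"
    using assms by (auto simp: trunc_simplex_def prob_simplex_def)
  have "kl u x - kl u' x = (\<Sum>i\<in>UNIV. (u $ i * ln (u $ i) - u $ i) - (u' $ i * ln (u' $ i) - u' $ i)
      - (u $ i - u' $ i) * ln (x $ i))"
    using sums by (simp add: kl_def sum_subtractf sum.distrib algebra_simps)
  also have "\<dots> \<le> (\<Sum>i\<in>UNIV. 2 * ln (1 / b) * \<bar>u $ i - u' $ i\<bar>)"
  proof (rule sum_mono)
    fix i
    have "(u' $ i - u $ i) * ln (u $ i) \<le> (u' $ i * ln (u' $ i) - u' $ i) - (u $ i * ln (u $ i) - u $ i)"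
      using assms trunc_simplex_pos by (intro entropy_tangent) blast+
    then have "(u $ i * ln (u $ i) - u $ i) - (u' $ i * ln (u' $ i) - u' $ i)
      - (u $ i - u' $ i) * ln (x $ i) \<le> (u $ i - u' $ i) * (ln (u $ i) - ln (x $ i))"
      by (simp add: algebra_simps)
    also have "\<dots> \<le> \<bar>u $ i - u' $ i\<bar> * \<bar>ln (u $ i) - ln (x $ i)\<bar>"
      by (simp add: abs_mult[symmetric])
    also have "\<dots> \<le> \<bar>u $ i - u' $ i\<bar> * (2 * ln (1 / b))"
      using ln_abs[OF assms(1), of i] ln_abs[OF assms(3), of i] by (intro mult_left_mono) auto
    finally show "(u $ i * ln (u $ i) - u $ i) - (u' $ i * ln (u' $ i) - u' $ i)
      - (u $ i - u' $ i) * ln (x $ i) \<le> 2 * ln (1 / b) * \<bar>u $ i - u' $ i\<bar>" by (simp add: mult_ac)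
  qed
  also have "\<dots> = 2 * ln (1 / b) * l1norm (u - u')"
    by (simp add: l1norm_def sum_distrib_left)
  finally show ?thesis .
qed

section \<open>Queue trajectories\<close>
declare queue.simps(2) [simp del]

locale sample_path =
  fixes M K :: real and A S :: "nat \<Rightarrow> real ^ 'k::finite" and a :: "nat \<Rightarrow> 'k"
  assumes M_pos: "0 < M" and K_def: "K = real CARD('k)"
    and A_nonneg: "t \<ge> 1 \<Longrightarrow> 0 \<le> A t $ i" and A_le: "t \<ge> 1 \<Longrightarrow> A t $ i \<le> M"
    and S_nonneg: "t \<ge> 1 \<Longrightarrow> 0 \<le> S t $ i" and S_le: "t \<ge> 1 \<Longrightarrow> S t $ i \<le> M"
begin

abbreviation "Q \<equiv> queue A S a"

lemma K_ge_1: "1 \<le> K"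
  by (simp add: K_def Suc_leI)

lemma queue_nonneg: "0 \<le> Q t $ i"
  by (cases t) (auto simp: queue.simps)

lemma queue_Suc_le: "Q (Suc t) $ i \<le> Q t $ i + M"
  using A_le[of "Suc t" i] S_nonneg[of "Suc t" i] queue_nonneg[of t i] M_pos
  by (auto simp: queue.simps)

lemma queue_Suc_ge: "Q t $ i - M \<le> Q (Suc t) $ i"
  using A_nonneg[of "Suc t" i] S_le[of "Suc t" i] M_pos
  by (auto simp: queue.simps)

lemma queue_le: "Q t $ i \<le> M * real t"
proof (induction t)
  case (Suc t)
  then show ?case using queue_Suc_le[of t i] by (simp add: algebra_simps)
qed simp

lemma l1norm_queue: "l1norm (Q t) = (\<Sum>i\<in>UNIV. Q t $ i)"
  by (simp add: l1norm_def queue_nonneg)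

lemma l1norm_queue_nonneg: "0 \<le> l1norm (Q t)"
  by (simp add: l1norm_def sum_nonneg)

lemma l1norm_queue_Suc_le: "l1norm (Q (Suc t)) \<le> l1norm (Q t) + K * M"
proof -
  have "(\<Sum>i\<in>UNIV. Q (Suc t) $ i) \<le> (\<Sum>i\<in>UNIV. Q t $ i + M)"
    by (intro sum_mono queue_Suc_le)
  then show ?thesis by (simp add: l1norm_queue sum.distrib K_def)
qed

lemma l1norm_square_le: "(l1norm (x :: real ^ 'k))\<^sup>2 \<le> K * (norm x)\<^sup>2"
proof -
  have "(\<Sum>i\<in>UNIV. \<bar>x $ i\<bar> * 1)\<^sup>2 \<le> (\<Sum>i\<in>(UNIV::'k set). \<bar>x $ i\<bar>\<^sup>2) * (\<Sum>i\<in>(UNIV::'k set). 1\<^sup>2)"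
    by (rule Cauchy_Schwarz_ineq_sum)
  also have "(\<Sum>i\<in>(UNIV::'k set). \<bar>x $ i\<bar>\<^sup>2) = (norm x)\<^sup>2"
    unfolding power2_norm_eq_inner inner_vec_def by (simp add: power2_eq_square)
  finally show ?thesis by (simp add: l1norm_def K_def mult.commute)
qed

text \<open>
  A total length \<open>q\<close> takes at least \<open>q / (K M)\<close> slots to build up, and during its growth the squares
  sum to at least the order of \<open>q\<^sup>3\<close>.  In the induction, \<open>b\<^sup>3 - a\<^sup>3 \<le> 3 b\<^sup>2 (b - a)\<close> compares one step.
\<close>
lemma cube_l1norm_queue_le: "(l1norm (Q n)) ^ 3 \<le> 3 * K\<^sup>2 * M * (\<Sum>s\<le>n. (norm (Q s))\<^sup>2)"
proof (induction n)
  case 0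
  then show ?case by (simp add: l1norm_def)
next
  case (Suc n)
  let ?a = "l1norm (Q n)" and ?b = "l1norm (Q (Suc n))"
  have ab: "0 \<le> ?a" "0 \<le> ?b" "?b \<le> ?a + K * M"
    using l1norm_queue_nonneg l1norm_queue_Suc_le by blast+
  have "?b ^ 3 - ?a ^ 3 \<le> 3 * ?b\<^sup>2 * (K * M)"
  proof (cases "?a \<le> ?b")
    case True
    have "?b ^ 3 - ?a ^ 3 = (?b - ?a) * (?b\<^sup>2 + ?b * ?a + ?a\<^sup>2)"
      by (simp add: power2_eq_square power3_eq_cube algebra_simps)
    also have "\<dots> \<le> (K * M) * (?b\<^sup>2 + ?b * ?b + ?b\<^sup>2)"
      using ab True M_pos K_ge_1
      by (intro mult_mono add_mono power_mono mult_left_mono) auto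
    finally show ?thesis by (simp add: power2_eq_square algebra_simps)
  next
    case False
    then have "?b ^ 3 \<le> ?a ^ 3" using ab by (intro power_mono) auto
    moreover have "0 \<le> 3 * ?b\<^sup>2 * (K * M)" using M_pos K_ge_1 by simp
    ultimately show ?thesis by linarith
  qed
  also have "\<dots> \<le> 3 * (K * (norm (Q (Suc n)))\<^sup>2) * (K * M)"
    using M_pos K_ge_1 l1norm_square_le by (intro mult_right_mono mult_left_mono) auto
  finally show ?case using Suc by (simp add: algebra_simps power2_eq_square)
qed

text \<open>
  The same reason one power lower: the lengths themselves sum to at least the order of \<open>q\<^sup>2\<close>.
\<close>
lemma square_l1norm_queue_le: "(l1norm (Q n))\<^sup>2 \<le> 2 * K * M * (\<Sum>s\<le>n. l1norm (Q s))"
proof (induction n)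
  case 0
  then show ?case by (simp add: l1norm_def)
next
  case (Suc n)
  let ?a = "l1norm (Q n)" and ?b = "l1norm (Q (Suc n))"
  have ab: "0 \<le> ?a" "0 \<le> ?b" "?b \<le> ?a + K * M"
    using l1norm_queue_nonneg l1norm_queue_Suc_le by blast+
  have "?b\<^sup>2 - ?a\<^sup>2 \<le> 2 * ?b * (K * M)"
  proof (cases "?a \<le> ?b")
    case True
    have "?b\<^sup>2 - ?a\<^sup>2 = (?b - ?a) * (?b + ?a)"
      by (simp add: power2_eq_square algebra_simps)
    also have "\<dots> \<le> (K * M) * (?b + ?b)"
      using ab True M_pos K_ge_1 by (intro mult_mono add_mono) auto
    finally show ?thesis by (simp add: algebra_simps)
  next
    case False
    then have "?b\<^sup>2 \<le> ?a\<^sup>2" using ab by (intro power_mono) auto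
    moreover have "0 \<le> 2 * ?b * (K * M)" using M_pos K_ge_1 ab by simp
    ultimately show ?thesis by linarith
  qed
  then show ?case using Suc by (simp add: algebra_simps)
qed

text \<open>
  The Lyapunov drift: cutting off at 0 only decreases the square, and the increment before the cut is
  bounded by \<open>M\<close> in every coordinate.
\<close>
lemma norm_square_queue_Suc_le:
  "(norm (Q (Suc t)))\<^sup>2 \<le> (norm (Q t))\<^sup>2
     + 2 * (Q t \<bullet> A (Suc t) - Q t $ a (Suc t) * S (Suc t) $ a (Suc t)) + K * M\<^sup>2"
proof -
  define d where "d i = A (Suc t) $ i - S (Suc t) $ i * of_bool (i = a (Suc t))" for i
  have sq: "(norm x)\<^sup>2 = (\<Sum>i\<in>UNIV. (x $ i)\<^sup>2)" for x :: "real ^ 'k"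
    unfolding power2_norm_eq_inner inner_vec_def by (simp add: power2_eq_square)
  have "(norm (Q (Suc t)))\<^sup>2 = (\<Sum>i\<in>UNIV. (max (Q t $ i + d i) 0)\<^sup>2)"
    by (simp add: sq d_def algebra_simps queue.simps)
  also have "\<dots> \<le> (\<Sum>i\<in>UNIV. (Q t $ i)\<^sup>2 + 2 * (Q t $ i * d i) + M\<^sup>2)"
  proof (rule sum_mono)
    fix i
    have "\<bar>d i\<bar> \<le> \<bar>M\<bar>"
      using A_nonneg[of "Suc t" i] A_le[of "Suc t" i] S_nonneg[of "Suc t" i] S_le[of "Suc t" i] M_pos
      by (auto simp: d_def)
    then have "(d i)\<^sup>2 \<le> M\<^sup>2" by (simp add: abs_le_square_iff)
    moreover have "(max (Q t $ i + d i) 0)\<^sup>2 \<le> (Q t $ i + d i)\<^sup>2" by (auto simp: max_def)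
    ultimately show "(max (Q t $ i + d i) 0)\<^sup>2 \<le> (Q t $ i)\<^sup>2 + 2 * (Q t $ i * d i) + M\<^sup>2"
      by (simp add: power2_sum)
  qed
  also have "\<dots> = (norm (Q t))\<^sup>2 + 2 * (\<Sum>i\<in>UNIV. Q t $ i * d i) + K * M\<^sup>2"
    by (simp add: sq sum.distrib sum_distrib_left K_def)
  also have "(\<Sum>i\<in>UNIV. Q t $ i * d i) = Q t \<bullet> A (Suc t) - Q t $ a (Suc t) * S (Suc t) $ a (Suc t)"
  proof -
    have "Q t $ i * d i = Q t $ i * A (Suc t) $ i
        - (if i = a (Suc t) then Q t $ i * S (Suc t) $ i else 0)" for i
      by (simp add: d_def algebra_simps)
    then show ?thesis by (simp add: inner_vec_def sum_subtractf)
  qed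
  finally show ?thesis .
qed

lemma served_work_le:
  "(\<Sum>t=1..T. Q (t - 1) $ a t * S t $ a t) \<le> (\<Sum>t=1..T. Q (t - 1) \<bullet> A t) + K * M\<^sup>2 / 2 * real T"
proof -
  have "(norm (Q T))\<^sup>2 \<le> (\<Sum>t=1..T. 2 * (Q (t - 1) \<bullet> A t - Q (t - 1) $ a t * S t $ a t) + K * M\<^sup>2)"
  proof (induction T)
    case (Suc T)
    then show ?case using norm_square_queue_Suc_le[of T] by (simp)
  qed simp
  moreover have "0 \<le> (norm (Q T))\<^sup>2" by simp
  ultimately have "0 \<le> (\<Sum>t=1..T. 2 * (Q (t - 1) \<bullet> A t - Q (t - 1) $ a t * S t $ a t) + K * M\<^sup>2)"
    by linarith
  then show ?thesis
    by (simp add: sum.distrib sum_subtractf sum_distrib_left[symmetric] algebra_simps)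
qed

end

section \<open>Learning rate and exploration\<close>
locale softmw_path = sample_path M K A S a
  for M K :: real and A S :: "nat \<Rightarrow> real ^ 'k::finite" and a :: "nat \<Rightarrow> 'k" +
  fixes \<delta> :: real
  assumes \<delta>_pos: "0 < \<delta>" and \<delta>_less: "\<delta> < 1"
begin

definition \<alpha> :: real where "\<alpha> = 1/4 - \<delta>/2"

text \<open>
  The root in the learning rate, so that \<open>1 / \<eta>\<^sub>t = M t\<^sup>-\<^sup>\<alpha> v\<^sub>t\<close>.
\<close>
definition v :: "nat \<Rightarrow> real" where
  "v t = sqrt (86 * M\<^sup>2 * K ^ 6 * real t powr (3/2) + (\<Sum>s<t. (norm (Q s))\<^sup>2))"

abbreviation "\<eta> \<equiv> softmw_eta M \<delta> Q"
abbreviation "\<gamma> \<equiv> softmw_gamma M \<delta> Q"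

lemma v_square: "(v t)\<^sup>2 = 86 * M\<^sup>2 * K ^ 6 * real t powr (3/2) + (\<Sum>s<t. (norm (Q s))\<^sup>2)"
  unfolding v_def by (intro real_sqrt_pow2 add_nonneg_nonneg sum_nonneg mult_nonneg_nonneg) auto

lemma v_nonneg: "0 \<le> v t"
  unfolding v_def by (intro real_sqrt_ge_zero add_nonneg_nonneg sum_nonneg mult_nonneg_nonneg) auto

lemma v_ge:
  assumes "t \<ge> 1"
  shows "M \<le> v t"
proof -
  have "M\<^sup>2 * (1 * 1) \<le> M\<^sup>2 * (K ^ 6 * real t powr (3/2))"
  proof (rule mult_left_mono)
    have "1 \<le> K ^ 6" "1 \<le> real t powr (3/2)"
      using K_ge_1 assms by (auto intro: ge_one_powr_ge_zero)
    then show "1 * 1 \<le> K ^ 6 * real t powr (3/2)" by (intro mult_mono) auto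
  qed simp
  also have "\<dots> \<le> 86 * M\<^sup>2 * K ^ 6 * real t powr (3/2)" by simp
  also have "\<dots> \<le> (v t)\<^sup>2" unfolding v_square by (simp add: sum_nonneg)
  finally show ?thesis using v_nonneg[of t] by (auto intro: power2_le_imp_le)
qed

lemma v_pos: "t \<ge> 1 \<Longrightarrow> 0 < v t"
  using v_ge[of t] M_pos by linarith

lemma v_mono: "s \<le> t \<Longrightarrow> v s \<le> v t"
  unfolding v_def using M_pos K_ge_1
  by (intro real_sqrt_le_mono add_mono mult_left_mono powr_mono2 sum_mono2 mult_nonneg_nonneg) auto

lemma eta_eq: "\<eta> t = inverse (real t powr (- \<alpha>) * M * v t)"
  unfolding softmw_eta_def v_def \<alpha>_def K_def[symmetric] by simp

lemma eta_eq': "t \<ge> 1 \<Longrightarrow> \<eta> t = real t powr \<alpha> / (M * v t)"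
  unfolding eta_eq by (simp add: powr_minus divide_inverse)

lemma eta_pos: "t \<ge> 1 \<Longrightarrow> 0 < \<eta> t"
  using M_pos v_pos[of t] by (auto simp: eta_eq' intro!: divide_pos_pos mult_pos_pos)

lemma powr_le_bound:
  assumes "t \<ge> 1" "t \<le> T"
  shows "real t powr \<alpha> \<le> real T powr \<bar>\<alpha>\<bar>" "real t powr (- \<alpha>) \<le> real T powr \<bar>\<alpha>\<bar>"
proof -
  have "real t powr c \<le> real T powr \<bar>\<alpha>\<bar>" if "c \<le> \<bar>\<alpha>\<bar>" for c
  proof -
    have "real t powr c \<le> real t powr \<bar>\<alpha>\<bar>" using assms that by (intro powr_mono) auto
    also have "\<dots> \<le> real T powr \<bar>\<alpha>\<bar>" using assms by (intro powr_mono2) auto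
    finally show ?thesis .
  qed
  then show "real t powr \<alpha> \<le> real T powr \<bar>\<alpha>\<bar>" "real t powr (- \<alpha>) \<le> real T powr \<bar>\<alpha>\<bar>" by auto
qed

lemma gamma_nonneg: "t \<ge> 1 \<Longrightarrow> 0 \<le> \<gamma> t"
  unfolding softmw_gamma_def using M_pos eta_pos[of t] l1norm_queue_nonneg[of "t - 1"]
  by (intro mult_nonneg_nonneg) auto

text \<open>
  The exploration weight is small either because the queue is short compared to \<open>sqrt t\<close>, or because a
  long queue has made the sum of squares in the learning rate large.  In terms of \<open>y = q / (K\<^sup>2 M sqrt t)\<close>
  both cases are covered by \<open>4 y\<^sup>2 \<le> 86 + y\<^sup>3 / 3\<close>.
\<close>
lemma gamma_le_half:
  assumes t: "t \<ge> 1"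
  shows "\<gamma> t \<le> 1 / 2"
proof -
  define r q c where "r = sqrt (real t)" and "q = l1norm (Q (t - 1))" and "c = K\<^sup>2 * M * r"
  define y where "y = q / c"
  have r: "r > 0" "r\<^sup>2 = real t" using t by (auto simp: r_def)
  have c: "c > 0" using r M_pos K_ge_1 by (simp add: c_def)
  have q: "q = y * c" using c by (simp add: y_def)
  have y: "0 \<le> y" using c l1norm_queue_nonneg by (simp add: y_def q_def)
  have r3: "real t powr (3/2) = r ^ 3"
    using t by (simp add: r_def powr_half_sqrt[symmetric] powr_power)
  have "(real t powr \<alpha>)\<^sup>2 = real t powr (2 * \<alpha>)"
    using t by (simp add: powr_power mult.commute)
  also have "\<dots> \<le> real t powr (1/2)"
    using t \<delta>_pos by (intro powr_mono) (auto simp: \<alpha>_def)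
  also have "\<dots> = r" by (simp add: r_def powr_half_sqrt)
  finally have powr: "(real t powr \<alpha>)\<^sup>2 \<le> r" .
  have cube: "q ^ 3 \<le> 3 * K\<^sup>2 * M * (\<Sum>s<t. (norm (Q s))\<^sup>2)"
    using cube_l1norm_queue_le[of "t - 1"] t by (cases t) (auto simp: q_def lessThan_Suc_atMost)
  \<comment> \<open>The difference of the two sides is smallest at \<open>y = 8\<close>, where it is \<open>86 - 256/3\<close>: this is
      where the constant 86 of the learning rate comes from.\<close>
  have poly: "4 * y\<^sup>2 \<le> 86 + y ^ 3 / 3"
  proof -
    have "0 \<le> (y - 8)\<^sup>2 * (y + 4)" using y by simp
    then show ?thesis by (simp add: power2_eq_square power3_eq_cube algebra_simps)
  qed
  have "(2 * (real t powr \<alpha> * q))\<^sup>2 \<le> 4 * (r * q\<^sup>2)"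
    using powr by (simp add: power_mult_distrib mult_right_mono)
  also have "\<dots> = (4 * y\<^sup>2) * (r * c\<^sup>2)" by (simp add: q power_mult_distrib)
  also have "\<dots> \<le> (86 + y ^ 3 / 3) * (r * c\<^sup>2)" using poly r by (intro mult_right_mono) auto
  also have "\<dots> = 86 * M\<^sup>2 * K ^ 4 * r ^ 3 + q ^ 3 / (3 * K\<^sup>2 * M)"
    using M_pos K_ge_1 by (simp add: q c_def field_simps power2_eq_square power3_eq_cube eval_nat_numeral)
  also have "\<dots> \<le> 86 * M\<^sup>2 * K ^ 6 * r ^ 3 + (\<Sum>s<t. (norm (Q s))\<^sup>2)"
  proof (rule add_mono)
    have "K ^ 4 \<le> K ^ 6" using K_ge_1 by (intro power_increasing) auto
    then show "86 * M\<^sup>2 * K ^ 4 * r ^ 3 \<le> 86 * M\<^sup>2 * K ^ 6 * r ^ 3"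
      using r by (intro mult_right_mono mult_left_mono) auto
    show "q ^ 3 / (3 * K\<^sup>2 * M) \<le> (\<Sum>s<t. (norm (Q s))\<^sup>2)"
      using cube M_pos K_ge_1 by (simp add: field_simps)
  qed
  also have "\<dots> = (v t)\<^sup>2" by (simp add: v_square r3)
  finally have "2 * (real t powr \<alpha> * q) \<le> v t" using v_nonneg by (rule power2_le_imp_le)
  then show ?thesis
    using M_pos v_pos[OF t] by (simp add: softmw_gamma_def eta_eq'[OF t] q_def field_simps)
qed

text \<open>
  An increment of \<open>v\<^sup>2\<close> divided by \<open>v\<close> is at most twice the increment of \<open>v\<close>, and these telescope.
\<close>
lemma sum_eta_norm_square_le:
  "(\<Sum>t=1..T. M * \<eta> t * (norm (Q (t - 1)))\<^sup>2) \<le> 2 * real T powr \<bar>\<alpha>\<bar> * v T"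
proof -
  have "M * \<eta> t * (norm (Q (t - 1)))\<^sup>2 \<le> 2 * real T powr \<bar>\<alpha>\<bar> * (v t - v (t - 1))"
    if t: "t \<in> {1..T}" for t
  proof -
    have t1: "t \<ge> 1" "t \<le> T" using t by auto
    have "real (t - 1) powr (3/2) \<le> real t powr (3/2)" by (intro powr_mono2) auto
    then have "86 * M\<^sup>2 * K ^ 6 * real (t - 1) powr (3/2) \<le> 86 * M\<^sup>2 * K ^ 6 * real t powr (3/2)"
      by (intro mult_left_mono) auto
    then have "(norm (Q (t - 1)))\<^sup>2 \<le> (v t)\<^sup>2 - (v (t - 1))\<^sup>2"
      using t1 by (cases t) (auto simp: v_square)
    also have "\<dots> = (v t - v (t - 1)) * (v t + v (t - 1))"
      by (simp add: power2_eq_square algebra_simps)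
    also have "\<dots> \<le> (v t - v (t - 1)) * (2 * v t)"
      using v_mono[of "t - 1" t] by (intro mult_left_mono) auto
    finally have "(norm (Q (t - 1)))\<^sup>2 / v t \<le> 2 * (v t - v (t - 1))"
      using v_pos[OF t1(1)] by (simp add: field_simps)
    then have "real t powr \<alpha> * ((norm (Q (t - 1)))\<^sup>2 / v t) \<le> real T powr \<bar>\<alpha>\<bar> * (2 * (v t - v (t - 1)))"
      using powr_le_bound[OF t1] v_nonneg by (intro mult_mono) auto
    then show ?thesis using M_pos by (simp add: eta_eq'[OF t1(1)] algebra_simps)
  qed
  then have "(\<Sum>t=1..T. M * \<eta> t * (norm (Q (t - 1)))\<^sup>2)
     \<le> (\<Sum>t=1..T. 2 * real T powr \<bar>\<alpha>\<bar> * (v t - v (t - 1)))" by (rule sum_mono)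
  also have "\<dots> = 2 * real T powr \<bar>\<alpha>\<bar> * (v T - v 0)"
    using sum_telescope''[of 0 T v] by (simp add: sum_distrib_left[symmetric])
  also have "\<dots> \<le> 2 * real T powr \<bar>\<alpha>\<bar> * v T" using v_nonneg[of 0] by (intro mult_left_mono) auto
  finally show ?thesis .
qed

text \<open>
  The learning rate is controlled by the total queue length \<open>X\<close>: every queue is at most of order
  \<open>sqrt X\<close>, so the squares sum to at most the order of \<open>X\<^sup>3\<^sup>/\<^sup>2\<close>.  A bound linear in \<open>X / T\<close> is what survives
  taking expectations.
\<close>
lemma v_le:
  assumes T: "T \<ge> 1"
  shows "v T \<le> sqrt (86 * M\<^sup>2 * K ^ 6 + sqrt (2 * K * M)) * real T powr (3/4)
     * (1 + (\<Sum>s<T. l1norm (Q s)) / real T)"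
proof -
  define X y where "X = (\<Sum>s<T. l1norm (Q s))" and "y = X / real T"
  have X: "0 \<le> X" "X = y * real T" "0 \<le> y"
    using T by (auto simp: X_def y_def intro!: sum_nonneg divide_nonneg_nonneg l1norm_queue_nonneg)
  have KM: "0 \<le> 2 * K * M" using M_pos K_ge_1 by simp
  have "(\<Sum>s<T. (norm (Q s))\<^sup>2) \<le> (\<Sum>s<T. sqrt (2 * K * M * X) * l1norm (Q s))"
  proof (rule sum_mono)
    fix s assume s: "s \<in> {..<T}"
    have "(l1norm (Q s))\<^sup>2 \<le> 2 * K * M * (\<Sum>r\<le>s. l1norm (Q r))" by (rule square_l1norm_queue_le)
    also have "\<dots> \<le> 2 * K * M * X"
      unfolding X_def using s KM
      by (intro mult_left_mono sum_mono2 l1norm_queue_nonneg) auto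
    finally have "l1norm (Q s) \<le> sqrt (2 * K * M * X)" by (rule real_le_rsqrt)
    moreover have "norm (Q s) \<le> l1norm (Q s)"
      unfolding l1norm_def by (rule norm_le_l1_cart)
    ultimately show "(norm (Q s))\<^sup>2 \<le> sqrt (2 * K * M * X) * l1norm (Q s)"
      unfolding power2_eq_square using KM X
      by (intro mult_mono) (auto intro!: mult_nonneg_nonneg[of "2 * K * M" X])
  qed
  also have "\<dots> = sqrt (2 * K * M * X) * X" by (simp add: X_def sum_distrib_left)
  also have "\<dots> = sqrt (2 * K * M) * (real T powr (3/2) * (sqrt y * y))"
  proof -
    have "real T powr (3/2) = real T powr (1/2 + 1)" by simp
    also have "\<dots> = sqrt (real T) * real T" using T by (subst powr_add) (simp add: powr_half_sqrt)
    finally show ?thesis by (simp add: X(2) real_sqrt_mult mult_ac)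
  qed
  also have "\<dots> \<le> sqrt (2 * K * M) * (real T powr (3/2) * (1 + y)\<^sup>2)"
  proof -
    have "sqrt y \<le> 1 + y" using X by (intro real_le_lsqrt) (auto simp: power2_eq_square algebra_simps)
    then have "sqrt y * y \<le> (1 + y) * (1 + y)" using X by (intro mult_mono) auto
    then show ?thesis using KM by (intro mult_left_mono) (auto simp: power2_eq_square)
  qed
  finally have 1: "(\<Sum>s<T. (norm (Q s))\<^sup>2) \<le> sqrt (2 * K * M) * (real T powr (3/2) * (1 + y)\<^sup>2)" .
  have "1 \<le> (1 + y)\<^sup>2" using X by simp
  then have "86 * M\<^sup>2 * K ^ 6 * real T powr (3/2) * 1 \<le> 86 * M\<^sup>2 * K ^ 6 * real T powr (3/2) * (1 + y)\<^sup>2"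
    by (intro mult_left_mono) auto
  then have "(v T)\<^sup>2 \<le> (86 * M\<^sup>2 * K ^ 6 + sqrt (2 * K * M)) * (real T powr (3/2) * (1 + y)\<^sup>2)"
    using 1 unfolding v_square by (simp add: algebra_simps)
  also have "real T powr (3/2) = (real T powr (3/4))\<^sup>2"
    using T by (simp add: powr_power)
  finally have "(v T)\<^sup>2 \<le> (sqrt (86 * M\<^sup>2 * K ^ 6 + sqrt (2 * K * M)) * real T powr (3/4) * (1 + y))\<^sup>2"
    using KM by (simp add: power_mult_distrib mult.assoc)
  then show ?thesis
    unfolding y_def X_def[symmetric]
    by (rule power2_le_imp_le) (use X KM in \<open>auto intro!: mult_nonneg_nonneg add_nonneg_nonneg\<close>)
qed

end

section \<open>Regret against the reference policy\<close>

text \<open>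
  The weight \<open>t\<^sup>-\<^sup>\<alpha>\<close> is that of the inverse learning rate.  Were it replaced by its maximum over \<open>t \<le> T\<close>,
  the bound would be \<open>T\<^sup>2\<^sup>\<alpha>\<close> for positive \<open>\<alpha>\<close>, which is too large when \<open>\<delta>\<close> is small.
\<close>
lemma weighted_variation_le:
  fixes D :: "nat \<Rightarrow> real"
  assumes D: "\<And>t. 0 \<le> D t" and C: "0 \<le> C" and \<alpha>: "\<bar>\<alpha>\<bar> \<le> 1"
    and var: "\<And>T. T \<ge> 1 \<Longrightarrow> (\<Sum>t=1..<T. D t) \<le> C * real T powr (2 * \<alpha>)"
    and T: "T \<ge> 1"
  shows "(\<Sum>t=1..<T. real t powr (- \<alpha>) * D t) \<le> 3 * C * real T powr \<bar>\<alpha>\<bar>"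
proof (cases "0 \<le> \<alpha>")
  case True
  \<comment> \<open>Summation by parts, as an induction in which the remainders telescope.\<close>
  have "(\<Sum>t=1..<T. real t powr (- \<alpha>) * D t)
     \<le> real T powr (- \<alpha>) * (\<Sum>t=1..<T. D t) + 2 * C * real T powr \<alpha>"
    using T
  proof (induction T rule: dec_induct)
    case (step n)
    let ?P = "\<Sum>t=1..<Suc n. D t"
    define x y where "x = real n powr \<alpha>" and "y = real (Suc n) powr \<alpha>"
    have n: "1 \<le> real n" using step by simp
    have xy: "0 < x" "x \<le> y" "1 \<le> x" using n True
      by (auto simp: x_def y_def intro!: powr_mono2 ge_one_powr_ge_zero)
    have "y \<le> (2 * real n) powr \<alpha>" unfolding y_def using n True by (intro powr_mono2) auto
    also have "\<dots> = 2 powr \<alpha> * x" using n by (simp add: powr_mult x_def)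
    also have "\<dots> \<le> 2 powr 1 * x" using xy \<alpha> True by (intro mult_right_mono powr_mono) auto
    finally have y2: "y \<le> 2 * x" by simp
    have "?P \<le> C * y\<^sup>2"
      using var[of "Suc n"] by (simp add: y_def powr_power)
    moreover have pm: "real n powr (- \<alpha>) = 1 / x" "real (Suc n) powr (- \<alpha>) = 1 / y"
      by (simp_all add: x_def y_def powr_minus divide_inverse)
    have d: "0 \<le> 1 / x - 1 / y" using xy by (simp add: frac_le)
    ultimately have "(1 / x - 1 / y) * ?P \<le> (1 / x - 1 / y) * (C * y\<^sup>2)"
      by (intro mult_left_mono)
    also have "\<dots> = C * ((y - x) * (y / x))" using xy by (simp add: field_simps power2_eq_square)
    also have "\<dots> \<le> C * ((y - x) * 2)"
      using xy y2 C by (intro mult_left_mono) (auto simp: divide_le_eq)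
    finally have "1 / x * ?P + 2 * C * x \<le> 1 / y * ?P + 2 * C * y" by (simp add: algebra_simps)
    moreover have "(\<Sum>t=1..<Suc n. real t powr (- \<alpha>) * D t) \<le> 1 / x * ?P + 2 * C * x"
      using step pm unfolding x_def[symmetric] by (simp add: algebra_simps)
    ultimately show ?case unfolding pm y_def[symmetric] by linarith
  qed (use C in simp)
  also have "\<dots> \<le> real T powr (- \<alpha>) * (C * real T powr (2 * \<alpha>)) + 2 * C * real T powr \<alpha>"
    using var[OF T] by (intro add_mono mult_left_mono order_refl) auto
  also have "\<dots> = 3 * C * real T powr \<bar>\<alpha>\<bar>"
    using True T by (simp add: powr_add[symmetric])
  finally show ?thesis .
next
  case False
  have "(\<Sum>t=1..<T. real t powr (- \<alpha>) * D t) \<le> (\<Sum>t=1..<T. real T powr (- \<alpha>) * D t)"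
    using D False by (intro sum_mono mult_right_mono powr_mono2) auto
  also have "\<dots> = real T powr (- \<alpha>) * (\<Sum>t=1..<T. D t)" by (simp add: sum_distrib_left)
  also have "\<dots> \<le> real T powr (- \<alpha>) * (C * real T powr (2 * \<alpha>))"
    using var[OF T] by (intro mult_left_mono) auto
  also have "\<dots> = C * real T powr \<alpha>" using T by (simp add: powr_add[symmetric])
  also have "\<dots> \<le> C * real T powr \<bar>\<alpha>\<bar>" using C T by (intro mult_left_mono powr_mono) auto
  also have "\<dots> \<le> 3 * C * real T powr \<bar>\<alpha>\<bar>" using C by (intro mult_right_mono) auto
  finally show ?thesis .
qed

lemma exp3_iterate_mix_cong:
  assumes "\<And>s x. 1 \<le> s \<Longrightarrow> exp3_mix (\<gamma> s) x (e s) = exp3_mix (\<gamma> s) x (e' s)"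
  shows "exp3_iterate x1 \<beta> \<eta> e \<gamma> a g t = exp3_iterate x1 \<beta> \<eta> e' \<gamma> a g t"
  using assms by (induction t) (auto simp: Let_def)

text \<open>
  For empty queues this is \<open>0\<close>, because \<open>inverse 0 = 0\<close>.  The exploration weight vanishes then, so the
  direction left open by the policy can be replaced by this function of the queues.
\<close>
definition queue_direction :: "(nat \<Rightarrow> real ^ 'k::finite) \<Rightarrow> nat \<Rightarrow> real ^ 'k" where
  "queue_direction Q t = Q (t - 1) /\<^sub>R l1norm (Q (t - 1))"

text \<open>
  The admixture of the uniform distribution moves \<open>\<theta> t\<close> into the truncated simplex over which the mirror
  step of slot \<open>t\<close> minimises.
\<close>
definition comparator :: "(nat \<Rightarrow> real ^ 'k::finite) \<Rightarrow> nat \<Rightarrow> real ^ 'k" where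
  "comparator \<theta> t =
     (1 - real t powr (-3)) *\<^sub>R \<theta> t + real t powr (-3) *\<^sub>R (\<chi> i. 1 / real CARD('k))"

text \<open>
  The work \<open>g\<close> that serving queue \<open>i\<close> would do, plus the importance weighted advantage of the comparator,
  minus the second-order term of mirror descent.  At the queue actually served, its sum over time is
  bounded above on every path (\<open>payoff_action_le\<close>); averaged over the distribution of the decision, it
  is bounded below by the work of the reference policy (\<open>mean_payoff_ge\<close>).  The two sums have the same
  expectation, which is how the work of the reference policy gets bounded.
\<close>
definition softmw_payoff ::
    "real \<Rightarrow> real \<Rightarrow> (nat \<Rightarrow> real ^ 'k::finite) \<Rightarrow> (nat \<Rightarrow> real ^ 'k) \<Rightarrow> (nat \<Rightarrow> real ^ 'k) \<Rightarrow>
     (nat \<Rightarrow> 'k) \<Rightarrow> nat \<Rightarrow> 'k \<Rightarrow> real" where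
  "softmw_payoff M \<delta> \<theta> Q S a t i =
     (let g = Q (t - 1) $ i * S t $ i;
          x = softmw_point M \<delta> Q S (queue_direction Q) a t $ i;
          p = softmw_prob M \<delta> Q S (queue_direction Q) a t $ i
      in g + g * (comparator \<theta> t $ i - x) / p - softmw_eta M \<delta> Q t * x * g\<^sup>2 / p\<^sup>2)"

definition softmw_beta :: "'k::finite itself \<Rightarrow> nat \<Rightarrow> real" where
  "softmw_beta _ t = real t powr (-3) / real CARD('k)"

lemma softmw_beta_pos: "t \<ge> 1 \<Longrightarrow> 0 < softmw_beta TYPE('k::finite) t"
  by (simp add: softmw_beta_def)

lemma softmw_beta_antimono:
  assumes "1 \<le> s" "s \<le> t"
  shows "softmw_beta TYPE('k::finite) t \<le> softmw_beta TYPE('k) s"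
proof -
  have "real t powr (-3) \<le> real s powr (-3)" using assms by (intro powr_mono2') auto
  then show ?thesis unfolding softmw_beta_def by (intro divide_right_mono) auto
qed

lemma softmw_beta_le: "t \<ge> 1 \<Longrightarrow> softmw_beta TYPE('k::finite) t \<le> 1 / real CARD('k)"
  using softmw_beta_antimono[of 1 t, where 'k='k] by (simp add: softmw_beta_def)

lemma softmw_point_1: "softmw_point M \<delta> Q S e a 1 = (\<chi> i. 1 / real CARD('k))"
  for Q :: "nat \<Rightarrow> real ^ 'k::finite"
  by (simp add: softmw_point_def)

lemma softmw_point_update:
  fixes Q :: "nat \<Rightarrow> real ^ 'k::finite"
  assumes "t \<ge> 1"
  shows "softmw_point M \<delta> Q S e a (Suc t) =
    exp3_update (softmw_beta TYPE('k) t) (softmw_eta M \<delta> Q t) (softmw_point M \<delta> Q S e a t)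
      (exp3_estimate (softmw_prob M \<delta> Q S e a t) (a t) (Q (t - 1) $ a t * S t $ a t))"
  using assms by (simp add: softmw_point_def softmw_prob_def softmw_beta_def Let_def)

lemma softmw_point_in_trunc_simplex:
  fixes Q :: "nat \<Rightarrow> real ^ 'k::finite"
  assumes "t \<ge> 1"
  shows "softmw_point M \<delta> Q S e a t \<in> trunc_simplex (softmw_beta TYPE('k) t)"
  using assms
proof (induction t rule: dec_induct)
  case base
  show ?case unfolding softmw_point_1 by (intro uniform_in_trunc_simplex softmw_beta_le) simp
next
  case (step t)
  have "softmw_point M \<delta> Q S e a (Suc t) \<in> trunc_simplex (softmw_beta TYPE('k) t)"
    using step trunc_simplex_pos[OF step(3) softmw_beta_pos[OF step(1)]]
    by (auto simp: softmw_point_update exp3_update_eq_entropic_argmin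
        intro!: entropic_argmin_in softmw_beta_pos softmw_beta_le)
  then show ?case
    using trunc_simplex_mono softmw_beta_antimono[of t "Suc t"] step(1) by fastforce
qed

lemma softmw_point_Suc:
  fixes Q :: "nat \<Rightarrow> real ^ 'k::finite"
  assumes "t \<ge> 1"
  shows "softmw_point M \<delta> Q S e a (Suc t) =
    entropic_argmin (softmw_beta TYPE('k) t)
      (softmw_eta M \<delta> Q t *\<^sub>R
         exp3_estimate (softmw_prob M \<delta> Q S e a t) (a t) (Q (t - 1) $ a t * S t $ a t)
       + log_vec (softmw_point M \<delta> Q S e a t))"
  unfolding softmw_point_update[OF assms]
  using trunc_simplex_pos[OF softmw_point_in_trunc_simplex[OF assms] softmw_beta_pos[OF assms]]
  by (intro exp3_update_eq_entropic_argmin allI)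

context softmw_path begin

definition \<beta> :: "nat \<Rightarrow> real" where "\<beta> t = real t powr (-3) / K"

abbreviation "e\<^sub>Q \<equiv> queue_direction Q"

lemmas e\<^sub>Q_def = queue_direction_def

definition x :: "nat \<Rightarrow> real ^ 'k" where "x = softmw_point M \<delta> Q S e\<^sub>Q a"

definition p :: "nat \<Rightarrow> real ^ 'k" where "p = softmw_prob M \<delta> Q S e\<^sub>Q a"

definition g :: "nat \<Rightarrow> real ^ 'k" where "g t = (\<chi> i. Q (t - 1) $ i * S t $ i)"

lemma softmw_prob_eq_p:
  assumes e: "\<And>s. 1 \<le> s \<Longrightarrow> Q (s - 1) \<noteq> 0 \<Longrightarrow> e s = Q (s - 1) /\<^sub>R l1norm (Q (s - 1))"
    and t: "1 \<le> t"
  shows "softmw_prob M \<delta> Q S e a t = p t"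
proof -
  have mix: "exp3_mix (\<gamma> s) y (e s) = exp3_mix (\<gamma> s) y (e\<^sub>Q s)" if "1 \<le> s" for s y
  proof (cases "Q (s - 1) = 0")
    case True
    then have "\<gamma> s = 0" by (simp add: softmw_gamma_def l1norm_def)
    then show ?thesis by (simp add: exp3_mix_def)
  next
    case False
    then show ?thesis using e[OF that False] by (simp add: e\<^sub>Q_def)
  qed
  then have "softmw_point M \<delta> Q S e a t = softmw_point M \<delta> Q S e\<^sub>Q a t"
    unfolding softmw_point_def by (rule exp3_iterate_mix_cong)
  then show ?thesis unfolding p_def softmw_prob_def using mix[OF t] by simp
qed

lemma softmw_beta_eq: "softmw_beta TYPE('k) t = \<beta> t"
  by (simp add: softmw_beta_def \<beta>_def K_def[symmetric])

lemma beta_pos: "t \<ge> 1 \<Longrightarrow> 0 < \<beta> t"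
  using softmw_beta_pos softmw_beta_eq by metis

lemma beta_antimono: "1 \<le> s \<Longrightarrow> s \<le> t \<Longrightarrow> \<beta> t \<le> \<beta> s"
  using softmw_beta_antimono softmw_beta_eq by metis

lemma beta_le: "t \<ge> 1 \<Longrightarrow> \<beta> t \<le> 1 / real CARD('k)"
  using softmw_beta_le softmw_beta_eq by metis

lemma p_eq: "p t = (1 - \<gamma> t) *\<^sub>R x t + \<gamma> t *\<^sub>R e\<^sub>Q t"
  by (simp add: p_def x_def softmw_prob_def exp3_mix_def)

definition estimate :: "nat \<Rightarrow> real ^ 'k" where
  "estimate t = exp3_estimate (p t) (a t) (g t $ a t)"

lemma x_in_trunc_simplex: "t \<ge> 1 \<Longrightarrow> x t \<in> trunc_simplex (\<beta> t)"
  using softmw_point_in_trunc_simplex softmw_beta_eq unfolding x_def by metis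

lemma x_pos: "t \<ge> 1 \<Longrightarrow> 0 < x t $ i"
  using x_in_trunc_simplex trunc_simplex_pos beta_pos by blast

lemma x_ge_beta: "t \<ge> 1 \<Longrightarrow> \<beta> t \<le> x t $ i"
  using x_in_trunc_simplex by (auto simp: trunc_simplex_def)

lemma x_prob: "t \<ge> 1 \<Longrightarrow> x t \<in> prob_simplex"
  using x_in_trunc_simplex by (auto simp: trunc_simplex_def)

lemma x_Suc:
  assumes "t \<ge> 1"
  shows "x (Suc t) = entropic_argmin (\<beta> t) (\<eta> t *\<^sub>R estimate t + log_vec (x t))"
  using softmw_point_Suc[OF assms, where 'k='k] unfolding x_def estimate_def p_def g_def softmw_beta_eq by simp

lemma g_nonneg: "t \<ge> 1 \<Longrightarrow> 0 \<le> g t $ i"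
  by (simp add: g_def queue_nonneg S_nonneg)

lemma g_le: "t \<ge> 1 \<Longrightarrow> g t $ i \<le> M * Q (t - 1) $ i"
  using mult_left_mono[OF S_le queue_nonneg, of t "t - 1" i i] by (simp add: g_def mult.commute)

lemma e\<^sub>Q_nonneg: "0 \<le> e\<^sub>Q t $ i"
  by (simp add: e\<^sub>Q_def queue_nonneg l1norm_queue_nonneg)

lemma p_ge_half_x: "t \<ge> 1 \<Longrightarrow> x t $ i / 2 \<le> p t $ i"
proof -
  assume t: "t \<ge> 1"
  have "1 / 2 * x t $ i \<le> (1 - \<gamma> t) * x t $ i"
    using gamma_le_half[OF t] x_pos[OF t, of i] by (intro mult_right_mono) auto
  moreover have "0 \<le> \<gamma> t * e\<^sub>Q t $ i"
    using gamma_nonneg[OF t] e\<^sub>Q_nonneg by simp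
  ultimately show ?thesis by (simp add: p_eq)
qed

lemma p_pos: "t \<ge> 1 \<Longrightarrow> 0 < p t $ i"
  using p_ge_half_x[of t i] x_pos[of t i] by linarith

text \<open>
  This lower bound is what exploring in the direction of the queue lengths achieves: it keeps the
  importance weighted estimates below \<open>1 / \<eta>\<close> without any bound on the queues.
\<close>
lemma p_ge_queue: "t \<ge> 1 \<Longrightarrow> M * \<eta> t * Q (t - 1) $ i \<le> p t $ i"
proof -
  assume t: "t \<ge> 1"
  have "M * \<eta> t * Q (t - 1) $ i = \<gamma> t * e\<^sub>Q t $ i"
  proof (cases "l1norm (Q (t - 1)) = 0")
    case True
    then have "Q (t - 1) $ i = 0"
      unfolding l1norm_def by (subst (asm) sum_nonneg_eq_0_iff) auto
    then show ?thesis by (simp add: e\<^sub>Q_def)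
  next
    case False
    then show ?thesis by (simp add: e\<^sub>Q_def softmw_gamma_def)
  qed
  moreover have "0 \<le> (1 - \<gamma> t) * x t $ i"
    using gamma_le_half[OF t] x_pos[OF t, of i] by simp
  ultimately show ?thesis by (simp add: p_eq)
qed

lemma estimate_nth: "estimate t $ i = (if i = a t then g t $ i / p t $ i else 0)"
  by (auto simp: estimate_def exp3_estimate_def axis_def)

lemma estimate_bounds:
  assumes t: "t \<ge> 1"
  shows "0 \<le> (\<eta> t *\<^sub>R estimate t) $ i" "(\<eta> t *\<^sub>R estimate t) $ i \<le> 1"
proof -
  show "0 \<le> (\<eta> t *\<^sub>R estimate t) $ i"
    using less_imp_le[OF eta_pos[OF t]] g_nonneg[OF t] p_pos[OF t]
    by (auto simp: estimate_nth intro!: divide_nonneg_pos mult_nonneg_nonneg)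
  have "\<eta> t * g t $ i \<le> \<eta> t * (M * Q (t - 1) $ i)"
    using g_le[OF t] eta_pos[OF t] by (intro mult_left_mono) auto
  also have "\<dots> \<le> p t $ i" using p_ge_queue[OF t, of i] by (simp add: mult_ac)
  finally show "(\<eta> t *\<^sub>R estimate t) $ i \<le> 1"
    using p_pos[OF t, of i] by (auto simp: estimate_nth divide_le_eq)
qed

lemma estimate_step:
  assumes t: "t \<ge> 1" and u: "u \<in> trunc_simplex (\<beta> t)"
  shows "estimate t \<bullet> (u - x t) - \<eta> t * (\<Sum>i\<in>UNIV. x t $ i * (estimate t $ i)\<^sup>2)
    \<le> (kl u (x t) - kl u (x (Suc t))) / \<eta> t"
proof -
  have "(\<eta> t *\<^sub>R estimate t) \<bullet> (u - x t) \<le> kl u (x t) - kl u (x (Suc t))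
     + (\<Sum>i\<in>UNIV. x t $ i * ((\<eta> t *\<^sub>R estimate t) $ i)\<^sup>2)"
    unfolding x_Suc[OF t]
    using estimate_bounds[OF t] x_prob[OF t] x_pos[OF t] u
    by (intro mirror_step beta_pos[OF t] beta_le[OF t]) auto
  also have "(\<Sum>i\<in>UNIV. x t $ i * ((\<eta> t *\<^sub>R estimate t) $ i)\<^sup>2)
     = \<eta> t * (\<eta> t * (\<Sum>i\<in>UNIV. x t $ i * (estimate t $ i)\<^sup>2))"
    by (simp add: sum_distrib_left power_mult_distrib power2_eq_square mult_ac)
  finally have "\<eta> t * (estimate t \<bullet> (u - x t) - \<eta> t * (\<Sum>i\<in>UNIV. x t $ i * (estimate t $ i)\<^sup>2))
    \<le> kl u (x t) - kl u (x (Suc t))"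
    by (simp add: algebra_simps)
  then show ?thesis using eta_pos[OF t] by (simp add: field_simps)
qed

end

locale regret_path = softmw_path M K A S a \<delta>
  for M K :: real and A S :: "nat \<Rightarrow> real ^ 'k::finite" and a :: "nat \<Rightarrow> 'k" and \<delta> :: real +
  fixes \<theta> :: "nat \<Rightarrow> real ^ 'k" and C\<^sub>V :: real
  assumes \<theta>_prob: "t \<ge> 1 \<Longrightarrow> \<theta> t \<in> prob_simplex" and C\<^sub>V_pos: "0 < C\<^sub>V"
    and \<theta>_variation: "T \<ge> 1 \<Longrightarrow>
      (\<Sum>t=1..<T. l1norm (\<theta> (t + 1) - \<theta> t)) \<le> C\<^sub>V * real T powr (1/2 - \<delta>)"
begin

definition b :: "nat \<Rightarrow> real" where "b t = real t powr (-3)"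

abbreviation "u \<equiv> comparator \<theta>"

lemma u_def: "u t = (1 - b t) *\<^sub>R \<theta> t + b t *\<^sub>R (\<chi> i. 1 / K)"
  by (simp add: comparator_def b_def K_def)

definition inv_eta :: "nat \<Rightarrow> real" where "inv_eta t = M * real t powr (- \<alpha>) * v t"

definition L :: "nat \<Rightarrow> real" where "L T = ln (1 / \<beta> T)"

lemma b_bounds: "0 \<le> b t" "t \<ge> 1 \<Longrightarrow> b t \<le> 1"
  using powr_mono2'[of "-3" 1 "real t"] by (auto simp: b_def)

lemma b_antimono: "1 \<le> s \<Longrightarrow> s \<le> t \<Longrightarrow> b t \<le> b s"
  unfolding b_def by (intro powr_mono2') auto

lemma uniform_prob: "(\<chi> i. 1 / K) \<in> (prob_simplex :: (real ^ 'k) set)"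
  using uniform_in_trunc_simplex[of 0, where 'k='k] by (simp add: trunc_simplex_def K_def)

lemma u_in_trunc_simplex:
  assumes t: "t \<ge> 1"
  shows "u t \<in> trunc_simplex (\<beta> t)"
proof -
  have nth: "u t $ i = (1 - b t) * \<theta> t $ i + b t * (1 / K)" for i by (simp add: u_def)
  have th: "0 \<le> \<theta> t $ i" "(\<Sum>i\<in>UNIV. \<theta> t $ i) = 1" for i
    using \<theta>_prob[OF t] by (auto simp: prob_simplex_def)
  have "\<beta> t \<le> u t $ i" for i
    using b_bounds[of t] t th by (simp add: nth \<beta>_def b_def)
  moreover have "0 \<le> u t $ i" for i
    using b_bounds[of t] t th K_ge_1 by (simp add: nth)
  moreover have "(\<Sum>i\<in>UNIV. u t $ i) = 1"
    using th K_ge_1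
    by (simp add: nth sum.distrib sum_distrib_left[symmetric] sum_divide_distrib[symmetric] K_def[symmetric])
  ultimately show ?thesis by (simp add: trunc_simplex_def prob_simplex_def)
qed

lemma l1norm_triangle: "l1norm (y + z) \<le> l1norm y + l1norm (z :: real ^ 'k)"
  unfolding l1norm_def sum.distrib[symmetric] by (intro sum_mono) simp

lemma l1norm_scaleR: "l1norm (c *\<^sub>R z) = \<bar>c\<bar> * l1norm (z :: real ^ 'k)"
  by (simp add: l1norm_def abs_mult sum_distrib_left)

lemma l1norm_nonneg: "0 \<le> l1norm (z :: real ^ 'k)"
  by (simp add: l1norm_def sum_nonneg)

lemma l1norm_diff_prob_simplex:
  assumes "y \<in> prob_simplex" "z \<in> prob_simplex"
  shows "l1norm (y - z :: real ^ 'k) \<le> 2"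
proof -
  have "l1norm (y - z) \<le> (\<Sum>i\<in>UNIV. y $ i + z $ i)"
    unfolding l1norm_def
  proof (rule sum_mono)
    fix i
    have "0 \<le> y $ i" "0 \<le> z $ i" using assms by (auto simp: prob_simplex_def)
    then show "\<bar>(y - z) $ i\<bar> \<le> y $ i + z $ i" by simp
  qed
  then show ?thesis using assms by (simp add: sum.distrib prob_simplex_def)
qed

lemma l1norm_u_diff:
  assumes t: "t \<ge> 1"
  shows "l1norm (u (Suc t) - u t) \<le> l1norm (\<theta> (Suc t) - \<theta> t) + 2 * (b t - b (Suc t))"
proof -
  have eq: "u (Suc t) - u t = (1 - b (Suc t)) *\<^sub>R (\<theta> (Suc t) - \<theta> t)
     + (b t - b (Suc t)) *\<^sub>R (\<theta> t - (\<chi> i. 1 / K))"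
    by (simp add: u_def algebra_simps)
  have "l1norm (u (Suc t) - u t) \<le> \<bar>1 - b (Suc t)\<bar> * l1norm (\<theta> (Suc t) - \<theta> t)
     + \<bar>b t - b (Suc t)\<bar> * l1norm (\<theta> t - (\<chi> i. 1 / K))"
    unfolding eq by (rule order_trans[OF l1norm_triangle]) (simp add: l1norm_scaleR)
  also have "\<dots> \<le> 1 * l1norm (\<theta> (Suc t) - \<theta> t) + (b t - b (Suc t)) * 2"
    using b_bounds[of "Suc t"] b_antimono[of t "Suc t"] t l1norm_nonneg
      l1norm_diff_prob_simplex[OF \<theta>_prob[OF t] uniform_prob]
    by (intro add_mono mult_mono) auto
  finally show ?thesis by simp
qed

lemma inv_eta_nonneg: "0 \<le> inv_eta t"
  unfolding inv_eta_def using M_pos v_nonneg by simp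

lemma inv_eta_eq: "1 / \<eta> t = inv_eta t"
  unfolding eta_eq inv_eta_def by (simp add: divide_inverse)

lemma inv_eta_le:
  assumes "1 \<le> t" "t \<le> T"
  shows "inv_eta t \<le> M * (real T powr \<bar>\<alpha>\<bar> * v T)"
proof -
  have "real t powr (- \<alpha>) * v t \<le> real T powr \<bar>\<alpha>\<bar> * v T"
    using powr_le_bound[OF assms] v_mono[OF assms(2)] v_nonneg by (intro mult_mono) auto
  then show ?thesis unfolding inv_eta_def using M_pos by (simp add: mult.assoc)
qed

text \<open>
  The inverse learning rate \<open>M t\<^sup>-\<^sup>\<alpha> v\<^sub>t\<close> need not be monotone: for \<open>\<alpha> > 0\<close> its first factor decreases while
  \<open>v\<close> increases.  Decreasing steps are harmless since divergences are nonnegative, so only the positive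
  parts of the increments have to be summed.
\<close>
lemma inv_eta_increments_le:
  assumes T: "T \<ge> 1"
  shows "(\<Sum>t=1..<T. max 0 (inv_eta (Suc t) - inv_eta t)) \<le> M * (real T powr \<bar>\<alpha>\<bar> * v T)"
proof (cases "0 \<le> \<alpha>")
  case True
  have "max 0 (inv_eta (Suc t) - inv_eta t) \<le> M * (v (Suc t) - v t)" if "t \<in> {1..<T}" for t
  proof -
    have t: "1 \<le> real t" using that by simp
    let ?c = "real t powr (- \<alpha>)" and ?d = "real (Suc t) powr (- \<alpha>)"
    have "?d \<le> ?c" using True t by (intro powr_mono2') auto
    then have "?d * v (Suc t) - ?c * v t \<le> ?d * v (Suc t) - ?d * v t"
      using v_nonneg[of t] mult_right_mono by auto
    also have "\<dots> = ?d * (v (Suc t) - v t)" by (simp add: algebra_simps)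
    also have "\<dots> \<le> 1 * (v (Suc t) - v t)"
      using v_mono[of t "Suc t"] True t powr_mono[of "- \<alpha>" 0 "real (Suc t)"]
      by (intro mult_right_mono) auto
    finally have "M * (?d * v (Suc t) - ?c * v t) \<le> M * (1 * (v (Suc t) - v t))"
      using M_pos by (intro mult_left_mono) auto
    moreover have "0 \<le> M * (v (Suc t) - v t)" using M_pos v_mono[of t "Suc t"] by simp
    ultimately show ?thesis by (simp add: inv_eta_def algebra_simps)
  qed
  then have "(\<Sum>t=1..<T. max 0 (inv_eta (Suc t) - inv_eta t)) \<le> (\<Sum>t=1..<T. M * (v (Suc t) - v t))"
    by (rule sum_mono)
  also have "\<dots> = M * (v T - v 1)"
    using T by (simp add: sum_distrib_left[symmetric] sum_Suc_diff')
  also have "\<dots> \<le> M * (1 * v T)" using M_pos v_nonneg[of 1] by simp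
  also have "\<dots> \<le> M * (real T powr \<bar>\<alpha>\<bar> * v T)"
    using M_pos v_nonneg T by (intro mult_left_mono mult_right_mono) (auto intro: ge_one_powr_ge_zero)
  finally show ?thesis .
next
  case False
  have "inv_eta t \<le> inv_eta (Suc t)" for t
    unfolding inv_eta_def using False M_pos v_mono[of t "Suc t"] v_nonneg
    by (intro mult_mono mult_left_mono powr_mono2) auto
  then have "(\<Sum>t=1..<T. max 0 (inv_eta (Suc t) - inv_eta t)) = inv_eta T - inv_eta 1"
    using T by (simp add: sum_Suc_diff')
  also have "\<dots> \<le> inv_eta T" using inv_eta_nonneg by simp
  also have "\<dots> \<le> M * (real T powr \<bar>\<alpha>\<bar> * v T)" using inv_eta_le[of T T] T by simp
  finally show ?thesis .
qed

lemma sum_by_parts_potential: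
  fixes c d f :: "nat \<Rightarrow> real"
  assumes "T \<ge> 1"
  shows "(\<Sum>t=1..T. f t * (c t - d t)) + f T * d T
     = f 1 * c 1 + (\<Sum>t=1..<T. f t * (c (Suc t) - d t) + (f (Suc t) - f t) * c (Suc t))"
  using assms by (induction T rule: dec_induct) (auto simp: algebra_simps)

lemma L_nonneg: "T \<ge> 1 \<Longrightarrow> 0 \<le> L T"
  using beta_pos[of T] prob_simplex_le_1[OF x_prob] x_ge_beta[of T] unfolding L_def
  by (intro ln_ge_zero) (force simp: le_divide_eq intro: order_trans)

text \<open>
  Summing the mirror steps by parts leaves three contributions, each weighted by a logarithm: the
  initial divergence, the movement of the comparator, and the increase of the inverse learning rate.
\<close>
lemma estimate_regret_le:
  assumes T: "T \<ge> 1"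
  shows "(\<Sum>t=1..T. estimate t \<bullet> (u t - x t) - \<eta> t * (\<Sum>i\<in>UNIV. x t $ i * (estimate t $ i)\<^sup>2))
    \<le> (6 + 6 * C\<^sub>V) * M * L T * (real T powr \<bar>\<alpha>\<bar> * v T)"
proof -
  let ?V = "real T powr \<bar>\<alpha>\<bar> * v T"
  define c d where "c t = kl (u t) (x t)" and "d t = kl (u t) (x (Suc t))" for t
  have V: "0 \<le> ?V" using v_nonneg by simp
  have uT: "u t \<in> trunc_simplex (\<beta> T)" and xT: "x t \<in> trunc_simplex (\<beta> T)" if "1 \<le> t" "t \<le> T" for t
    using that u_in_trunc_simplex x_in_trunc_simplex trunc_simplex_mono beta_antimono by blast+
  have c_le: "c t \<le> L T" if "1 \<le> t" "t \<le> T" for t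
    unfolding c_def L_def using uT[OF that] xT[OF that] beta_pos[OF T] by (rule kl_le)
  have c_nonneg: "0 \<le> c t" if "1 \<le> t" "t \<le> T" for t
    unfolding c_def using uT[OF that] xT[OF that] trunc_simplex_pos[OF _ beta_pos[OF T]]
    by (intro kl_nonneg) (auto simp: trunc_simplex_def)
  have d_nonneg: "0 \<le> d t" if "1 \<le> t" for t
    unfolding d_def using u_in_trunc_simplex[OF that] x_in_trunc_simplex[of "Suc t"] that
      trunc_simplex_pos[OF _ beta_pos[OF that]] trunc_simplex_pos[OF _ beta_pos[of "Suc t"]]
    by (intro kl_nonneg) (auto simp: trunc_simplex_def)
  have LT: "0 \<le> L T" by (rule L_nonneg[OF T])
  have "(\<Sum>t=1..T. estimate t \<bullet> (u t - x t) - \<eta> t * (\<Sum>i\<in>UNIV. x t $ i * (estimate t $ i)\<^sup>2))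
      \<le> (\<Sum>t=1..T. inv_eta t * (c t - d t))"
    using estimate_step u_in_trunc_simplex
    by (intro sum_mono) (auto simp: inv_eta_eq[symmetric] c_def d_def)
  also have "\<dots> \<le> inv_eta 1 * c 1
      + (\<Sum>t=1..<T. inv_eta t * (c (Suc t) - d t) + (inv_eta (Suc t) - inv_eta t) * c (Suc t))"
    using sum_by_parts_potential[OF T, of inv_eta c d] d_nonneg[OF T] inv_eta_nonneg[of T]
      mult_nonneg_nonneg[of "inv_eta T" "d T"] by linarith
  also have "\<dots> \<le> M * ?V * L T
      + (\<Sum>t=1..<T. 2 * L T * (inv_eta t * l1norm (u (Suc t) - u t))
          + L T * max 0 (inv_eta (Suc t) - inv_eta t))"
  proof (intro add_mono sum_mono)
    show "inv_eta 1 * c 1 \<le> M * ?V * L T"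
      using c_le[of 1] c_nonneg[of 1] T inv_eta_le[of 1 T] inv_eta_nonneg M_pos V
      by (intro mult_mono) auto
  next
    fix t assume t: "t \<in> {1..<T}"
    have "c (Suc t) - d t \<le> 2 * L T * l1norm (u (Suc t) - u t)"
      unfolding c_def d_def L_def using t beta_pos[OF T] by (intro kl_diff_le uT xT) auto
    then have "inv_eta t * (c (Suc t) - d t) \<le> inv_eta t * (2 * L T * l1norm (u (Suc t) - u t))"
      using inv_eta_nonneg by (rule mult_left_mono)
    then show "inv_eta t * (c (Suc t) - d t) \<le> 2 * L T * (inv_eta t * l1norm (u (Suc t) - u t))"
      by (simp add: mult_ac)
    have "(inv_eta (Suc t) - inv_eta t) * c (Suc t) \<le> max 0 (inv_eta (Suc t) - inv_eta t) * c (Suc t)"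
      using t c_nonneg[of "Suc t"] by (intro mult_right_mono) auto
    also have "\<dots> \<le> max 0 (inv_eta (Suc t) - inv_eta t) * L T"
      using t c_le[of "Suc t"] by (intro mult_left_mono) auto
    finally show "(inv_eta (Suc t) - inv_eta t) * c (Suc t) \<le> L T * max 0 (inv_eta (Suc t) - inv_eta t)"
      by (simp add: mult.commute)
  qed
  also have "\<dots> = L T * (M * ?V) + 2 * L T * (\<Sum>t=1..<T. inv_eta t * l1norm (u (Suc t) - u t))
      + L T * (\<Sum>t=1..<T. max 0 (inv_eta (Suc t) - inv_eta t))"
    by (simp add: sum.distrib sum_distrib_left mult_ac)
  also have "\<dots> \<le> L T * (M * ?V) + 2 * L T * ((3 * C\<^sub>V + 2) * (M * ?V)) + L T * (M * ?V)"
  proof (intro add_mono mult_left_mono order_refl)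
    show "(\<Sum>t=1..<T. max 0 (inv_eta (Suc t) - inv_eta t)) \<le> M * ?V"
      by (rule inv_eta_increments_le[OF T])
    have "(\<Sum>t=1..<T. inv_eta t * l1norm (u (Suc t) - u t))
       \<le> (\<Sum>t=1..<T. M * v T * (real t powr (- \<alpha>) * l1norm (\<theta> (t + 1) - \<theta> t))
            + 2 * (M * ?V) * (b t - b (Suc t)))"
    proof (rule sum_mono)
      fix t assume t: "t \<in> {1..<T}"
      then have t': "1 \<le> t" "t \<le> T" by auto
      have "inv_eta t * l1norm (u (Suc t) - u t)
         \<le> inv_eta t * (l1norm (\<theta> (Suc t) - \<theta> t) + 2 * (b t - b (Suc t)))"
        using l1norm_u_diff[OF t'(1)] inv_eta_nonneg by (rule mult_left_mono)
      also have "\<dots> = inv_eta t * l1norm (\<theta> (Suc t) - \<theta> t) + inv_eta t * (2 * (b t - b (Suc t)))"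
        by (simp add: algebra_simps)
      also have "\<dots> \<le> (M * real t powr (- \<alpha>) * v T) * l1norm (\<theta> (Suc t) - \<theta> t)
           + (M * ?V) * (2 * (b t - b (Suc t)))"
      proof (intro add_mono mult_right_mono)
        show "inv_eta t \<le> M * real t powr (- \<alpha>) * v T"
          unfolding inv_eta_def using M_pos v_mono[OF t'(2)] by (intro mult_left_mono) auto
        show "inv_eta t \<le> M * ?V" by (rule inv_eta_le[OF t'])
      qed (use l1norm_nonneg b_antimono[of t "Suc t"] t' in auto)
      finally show "inv_eta t * l1norm (u (Suc t) - u t)
         \<le> M * v T * (real t powr (- \<alpha>) * l1norm (\<theta> (t + 1) - \<theta> t)) + 2 * (M * ?V) * (b t - b (Suc t))"
        by (simp add: algebra_simps)
    qed
    also have "\<dots> = M * v T * (\<Sum>t=1..<T. real t powr (- \<alpha>) * l1norm (\<theta> (t + 1) - \<theta> t))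
       + 2 * (M * ?V) * (\<Sum>t=1..<T. b t - b (Suc t))"
      by (simp add: sum.distrib sum_distrib_left)
    also have "\<dots> \<le> M * v T * (3 * C\<^sub>V * real T powr \<bar>\<alpha>\<bar>) + 2 * (M * ?V) * 1"
    proof (intro add_mono mult_left_mono)
      show "(\<Sum>t=1..<T. real t powr (- \<alpha>) * l1norm (\<theta> (t + 1) - \<theta> t)) \<le> 3 * C\<^sub>V * real T powr \<bar>\<alpha>\<bar>"
        using \<theta>_variation C\<^sub>V_pos \<delta>_pos \<delta>_less
        by (intro weighted_variation_le l1norm_nonneg T) (auto simp: \<alpha>_def)
      have "(\<Sum>t=1..<T. b t - b (Suc t)) = b 1 - b T"
        using sum_Suc_diff'[OF T, of b] sum_negf[of "\<lambda>t. b (Suc t) - b t" "{1..<T}"] by simp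
      then show "(\<Sum>t=1..<T. b t - b (Suc t)) \<le> 1" using b_bounds[of 1] b_bounds[of T] by simp
    qed (use M_pos v_nonneg in auto)
    also have "\<dots> = (3 * C\<^sub>V + 2) * (M * ?V)" by (simp add: algebra_simps)
    finally show "(\<Sum>t=1..<T. inv_eta t * l1norm (u (Suc t) - u t)) \<le> (3 * C\<^sub>V + 2) * (M * ?V)" .
  qed (use LT M_pos in auto)
  also have "\<dots> = (6 + 6 * C\<^sub>V) * M * L T * ?V" by (simp add: algebra_simps)
  finally show ?thesis .
qed

abbreviation "payoff \<equiv> softmw_payoff M \<delta> \<theta> Q S a"

lemma payoff_def:
  "payoff t i = g t $ i + g t $ i * (u t $ i - x t $ i) / p t $ i
     - \<eta> t * x t $ i * (g t $ i)\<^sup>2 / (p t $ i)\<^sup>2"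
  by (simp add: softmw_payoff_def g_def x_def p_def Let_def)

lemma g_le_time:
  assumes t: "t \<ge> 1"
  shows "g t $ i \<le> M\<^sup>2 * real t"
proof -
  have "M * Q (t - 1) $ i \<le> M * (M * real (t - 1))" using M_pos queue_le by (intro mult_left_mono) auto
  also have "\<dots> \<le> M * (M * real t)" using M_pos by (intro mult_left_mono) auto
  finally show ?thesis using g_le[OF t, of i] by (simp add: power2_eq_square mult_ac)
qed

lemma x_over_p_le: "t \<ge> 1 \<Longrightarrow> x t $ i / p t $ i \<le> 2"
  using p_ge_half_x[of t i] p_pos[of t i] by (simp add: divide_le_eq)

text \<open>
  A bound uniform over all paths, for the integrability of the payoffs.
\<close>
lemma abs_payoff_le:
  assumes t: "t \<ge> 1"
  shows "\<bar>payoff t i\<bar> \<le> M\<^sup>2 * real t * (3 + 2 / \<beta> t)"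
proof -
  note pos = g_nonneg[OF t, of i] p_pos[OF t, of i] x_pos[OF t, of i] eta_pos[OF t] beta_pos[OF t]
  have "x t $ i \<le> 1" "u t $ i \<le> 1" "0 \<le> u t $ i"
    using prob_simplex_le_1[OF x_prob[OF t]] u_in_trunc_simplex[OF t] prob_simplex_le_1
    by (auto simp: trunc_simplex_def prob_simplex_def)
  then have "\<bar>u t $ i - x t $ i\<bar> \<le> 1" using pos by auto
  moreover have "\<beta> t \<le> 2 * p t $ i" using x_ge_beta[OF t, of i] p_ge_half_x[OF t, of i] by linarith
  then have "1 / p t $ i \<le> 2 / \<beta> t" using pos by (simp add: field_simps)
  ultimately have "\<bar>u t $ i - x t $ i\<bar> * (1 / p t $ i) \<le> 1 * (2 / \<beta> t)"
    using pos by (intro mult_mono) auto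
  then have 1: "\<bar>g t $ i * (u t $ i - x t $ i) / p t $ i\<bar> \<le> g t $ i * (2 / \<beta> t)"
    using pos mult_left_mono[of "\<bar>u t $ i - x t $ i\<bar> * (1 / p t $ i)" "1 * (2 / \<beta> t)" "g t $ i"]
    by (simp add: abs_mult)
  have "\<eta> t * g t $ i \<le> \<eta> t * (M * Q (t - 1) $ i)"
    using g_le[OF t] pos by (intro mult_left_mono) auto
  then have "\<eta> t * g t $ i \<le> p t $ i" using p_ge_queue[OF t, of i] by (simp add: mult_ac)
  then have "\<eta> t * g t $ i / p t $ i \<le> 1" using pos by (simp add: divide_le_eq)
  then have "(\<eta> t * g t $ i / p t $ i) * (x t $ i / p t $ i) \<le> 1 * 2"
    using x_over_p_le[OF t] pos by (intro mult_mono) auto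
  then have "g t $ i * ((\<eta> t * g t $ i / p t $ i) * (x t $ i / p t $ i)) \<le> g t $ i * 2"
    using pos by (intro mult_left_mono) auto
  moreover have "\<eta> t * x t $ i * (g t $ i)\<^sup>2 / (p t $ i)\<^sup>2
     = g t $ i * ((\<eta> t * g t $ i / p t $ i) * (x t $ i / p t $ i))"
    by (simp add: power2_eq_square)
  moreover have "0 \<le> \<eta> t * x t $ i * (g t $ i)\<^sup>2 / (p t $ i)\<^sup>2" using pos by simp
  ultimately have 2: "\<bar>\<eta> t * x t $ i * (g t $ i)\<^sup>2 / (p t $ i)\<^sup>2\<bar> \<le> g t $ i * 2" by simp
  have "\<bar>payoff t i\<bar> \<le> g t $ i + g t $ i * (2 / \<beta> t) + g t $ i * 2"
    using 1 2 pos(1) unfolding payoff_def by linarith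
  also have "\<dots> = g t $ i * (3 + 2 / \<beta> t)" by (simp add: algebra_simps)
  also have "\<dots> \<le> M\<^sup>2 * real t * (3 + 2 / \<beta> t)"
    using g_le_time[OF t, of i] pos by (intro mult_right_mono) auto
  finally show ?thesis .
qed

lemma payoff_action_le:
  assumes T: "T \<ge> 1"
  shows "(\<Sum>t=1..T. payoff t (a t)) \<le> (\<Sum>t=1..T. Q (t - 1) \<bullet> A t) + K * M\<^sup>2 / 2 * real T
    + (6 + 6 * C\<^sub>V) * M * L T * (real T powr \<bar>\<alpha>\<bar> * v T)"
proof -
  have "payoff t (a t) = Q (t - 1) $ a t * S t $ a t
     + (estimate t \<bullet> (u t - x t) - \<eta> t * (\<Sum>i\<in>UNIV. x t $ i * (estimate t $ i)\<^sup>2))" for t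
  proof -
    have "estimate t \<bullet> (u t - x t)
      = (\<Sum>i\<in>UNIV. if i = a t then g t $ i / p t $ i * (u t $ i - x t $ i) else 0)"
      unfolding inner_vec_def by (intro sum.cong) (auto simp: estimate_nth)
    moreover have "(\<Sum>i\<in>UNIV. x t $ i * (estimate t $ i)\<^sup>2)
      = (\<Sum>i\<in>UNIV. if i = a t then x t $ i * (g t $ i / p t $ i)\<^sup>2 else 0)"
      by (intro sum.cong) (auto simp: estimate_nth)
    ultimately show ?thesis by (simp add: payoff_def g_def power_divide)
  qed
  then have "(\<Sum>t=1..T. payoff t (a t)) = (\<Sum>t=1..T. Q (t - 1) $ a t * S t $ a t)
    + (\<Sum>t=1..T. estimate t \<bullet> (u t - x t) - \<eta> t * (\<Sum>i\<in>UNIV. x t $ i * (estimate t $ i)\<^sup>2))"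
    by (simp add: sum.distrib)
  then show ?thesis using served_work_le[of T] estimate_regret_le[OF T] by linarith
qed

text \<open>
  Averaging over \<open>p\<close> cancels the importance weights.  What remains besides the reference work is the bias
  of the truncated comparator (the term \<open>M\<^sup>2 / t\<^sup>2\<close>), the work lost by exploration, and the second moment
  of the estimate; the last two are both of the order of \<open>\<eta>\<close> times the squared queue lengths.
\<close>
lemma mean_payoff_ge:
  assumes t: "t \<ge> 1"
  shows "(\<Sum>i\<in>UNIV. \<theta> t $ i * g t $ i) - M\<^sup>2 / (real t)\<^sup>2 - (K + 2) * M * (M * \<eta> t * (norm (Q (t - 1)))\<^sup>2)
    \<le> (\<Sum>i\<in>UNIV. p t $ i * payoff t i)"
proof -
  let ?q = "l1norm (Q (t - 1))"
  have th: "0 \<le> \<theta> t $ i" "(\<Sum>i\<in>UNIV. \<theta> t $ i) = 1" for i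
    using \<theta>_prob[OF t] by (auto simp: prob_simplex_def)
  have xs: "(\<Sum>i\<in>UNIV. x t $ i) = 1" using x_prob[OF t] by (simp add: prob_simplex_def)
  have g_q: "g t $ i \<le> M * ?q" for i
  proof -
    have "Q (t - 1) $ i \<le> ?q" unfolding l1norm_queue
      by (rule member_le_sum) (auto simp: queue_nonneg)
    then have "M * Q (t - 1) $ i \<le> M * ?q" using M_pos by simp
    then show ?thesis using g_le[OF t, of i] by linarith
  qed
  note g_t = g_le_time[OF t]
  have "p t $ i * payoff t i = \<theta> t $ i * g t $ i + (u t $ i - \<theta> t $ i) * g t $ i
     + (p t $ i - x t $ i) * g t $ i - \<eta> t * (x t $ i / p t $ i) * (g t $ i)\<^sup>2" for i
    using p_pos[OF t, of i] by (simp add: payoff_def field_simps power2_eq_square)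
  moreover have "- (b t * (M\<^sup>2 * real t)) * \<theta> t $ i \<le> (u t $ i - \<theta> t $ i) * g t $ i" for i
  proof -
    have "b t * \<theta> t $ i * g t $ i \<le> b t * \<theta> t $ i * (M\<^sup>2 * real t)"
      using g_t th b_bounds by (intro mult_left_mono) auto
    moreover have "0 \<le> b t / K * g t $ i"
      using b_bounds K_ge_1 g_nonneg[OF t] by simp
    ultimately show ?thesis by (simp add: u_def algebra_simps)
  qed
  moreover have "- (\<gamma> t * (M * ?q)) * x t $ i \<le> (p t $ i - x t $ i) * g t $ i" for i
  proof -
    have "\<gamma> t * x t $ i * g t $ i \<le> \<gamma> t * x t $ i * (M * ?q)"
      using g_q gamma_nonneg[OF t] x_pos[OF t, of i] by (intro mult_left_mono) auto
    moreover have "0 \<le> \<gamma> t * e\<^sub>Q t $ i * g t $ i"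
      using gamma_nonneg[OF t] e\<^sub>Q_nonneg g_nonneg[OF t] by simp
    ultimately show ?thesis by (simp add: p_eq algebra_simps)
  qed
  moreover have "- (2 * M * (M * \<eta> t)) * (Q (t - 1) $ i)\<^sup>2 \<le> - (\<eta> t * (x t $ i / p t $ i) * (g t $ i)\<^sup>2)" for i
  proof -
    have "x t $ i / p t $ i \<le> 2" by (rule x_over_p_le[OF t])
    moreover have "(g t $ i)\<^sup>2 \<le> (M * Q (t - 1) $ i)\<^sup>2"
      using g_le[OF t] g_nonneg[OF t] by (intro power_mono) auto
    ultimately have "\<eta> t * (x t $ i / p t $ i) * (g t $ i)\<^sup>2 \<le> \<eta> t * 2 * (M * Q (t - 1) $ i)\<^sup>2"
      using eta_pos[OF t] x_pos[OF t, of i] p_pos[OF t, of i] by (intro mult_mono) auto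
    then show ?thesis by (simp add: power2_eq_square mult_ac)
  qed
  ultimately have "\<theta> t $ i * g t $ i + (- (b t * (M\<^sup>2 * real t)) * \<theta> t $ i)
     + (- (\<gamma> t * (M * ?q)) * x t $ i) + (- (2 * M * (M * \<eta> t)) * (Q (t - 1) $ i)\<^sup>2)
     \<le> p t $ i * payoff t i" for i
    by (smt (verit))
  then have "(\<Sum>i\<in>UNIV. \<theta> t $ i * g t $ i + (- (b t * (M\<^sup>2 * real t)) * \<theta> t $ i)
     + (- (\<gamma> t * (M * ?q)) * x t $ i) + (- (2 * M * (M * \<eta> t)) * (Q (t - 1) $ i)\<^sup>2))
     \<le> (\<Sum>i\<in>UNIV. p t $ i * payoff t i)" by (rule sum_mono)
  moreover have "(\<Sum>i\<in>UNIV. \<theta> t $ i * g t $ i + (- (b t * (M\<^sup>2 * real t)) * \<theta> t $ i)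
     + (- (\<gamma> t * (M * ?q)) * x t $ i) + (- (2 * M * (M * \<eta> t)) * (Q (t - 1) $ i)\<^sup>2))
    = (\<Sum>i\<in>UNIV. \<theta> t $ i * g t $ i) - b t * (M\<^sup>2 * real t) - \<gamma> t * (M * ?q)
       - 2 * M * (M * \<eta> t) * (norm (Q (t - 1)))\<^sup>2"
  proof -
    have "(norm (Q (t - 1)))\<^sup>2 = (\<Sum>i\<in>UNIV. (Q (t - 1) $ i)\<^sup>2)"
      unfolding power2_norm_eq_inner inner_vec_def by (simp add: power2_eq_square)
    then show ?thesis
      unfolding sum.distrib sum_distrib_left[symmetric] th xs by simp
  qed
  moreover have "b t * (M\<^sup>2 * real t) = M\<^sup>2 / (real t)\<^sup>2"
  proof -
    have "b t = 1 / (real t) ^ 3"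
      using t by (simp add: b_def powr_minus divide_inverse)
    then show ?thesis using t by (simp add: field_simps power2_eq_square power3_eq_cube)
  qed
  moreover have "\<gamma> t * (M * ?q) \<le> K * M * (M * \<eta> t * (norm (Q (t - 1)))\<^sup>2)"
  proof -
    have "\<gamma> t * (M * ?q) = M * (M * \<eta> t) * ?q\<^sup>2" by (simp add: softmw_gamma_def power2_eq_square)
    also have "\<dots> \<le> M * (M * \<eta> t) * (K * (norm (Q (t - 1)))\<^sup>2)"
      using M_pos eta_pos[OF t] l1norm_square_le by (intro mult_left_mono) auto
    finally show ?thesis by (simp add: mult_ac)
  qed
  ultimately show ?thesis by (simp add: algebra_simps)
qed

lemma sum_inverse_squares_le: "(\<Sum>t=1..T. 1 / (real t)\<^sup>2) \<le> 2"
proof -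
  have "(\<Sum>t=1..T. 1 / (real t)\<^sup>2) \<le> 2 - 1 / real T" if "T \<ge> 1" for T
    using that
  proof (induction T rule: dec_induct)
    case (step n)
    have "1 / (real (Suc n))\<^sup>2 \<le> 1 / (real n * real (Suc n))"
      using step by (intro divide_left_mono) (auto simp: power2_eq_square)
    also have "\<dots> = 1 / real n - 1 / real (Suc n)" using step by (simp add: field_simps)
    finally show ?case using step by simp
  qed simp
  then have "(\<Sum>t=1..T. 1 / (real t)\<^sup>2) \<le> 2 - 1 / real T" if "T \<ge> 1" using that .
  moreover have "0 \<le> 1 / real T" by simp
  ultimately show ?thesis by (cases "T \<ge> 1") (linarith, simp)
qed

lemma sum_mean_payoff_ge:
  "(\<Sum>t=1..T. \<Sum>i\<in>UNIV. \<theta> t $ i * g t $ i) - 2 * M\<^sup>2 - 2 * (K + 2) * M * (real T powr \<bar>\<alpha>\<bar> * v T)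
    \<le> (\<Sum>t=1..T. \<Sum>i\<in>UNIV. p t $ i * payoff t i)"
proof -
  have "(\<Sum>t=1..T. (\<Sum>i\<in>UNIV. \<theta> t $ i * g t $ i) - M\<^sup>2 * (1 / (real t)\<^sup>2)
      - (K + 2) * M * (M * \<eta> t * (norm (Q (t - 1)))\<^sup>2))
    \<le> (\<Sum>t=1..T. \<Sum>i\<in>UNIV. p t $ i * payoff t i)"
    using mean_payoff_ge by (intro sum_mono) simp
  moreover have "(\<Sum>t=1..T. (\<Sum>i\<in>UNIV. \<theta> t $ i * g t $ i) - M\<^sup>2 * (1 / (real t)\<^sup>2)
      - (K + 2) * M * (M * \<eta> t * (norm (Q (t - 1)))\<^sup>2))
    = (\<Sum>t=1..T. \<Sum>i\<in>UNIV. \<theta> t $ i * g t $ i) - M\<^sup>2 * (\<Sum>t=1..T. 1 / (real t)\<^sup>2)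
      - (K + 2) * M * (\<Sum>t=1..T. M * \<eta> t * (norm (Q (t - 1)))\<^sup>2)"
    by (simp only: sum_subtractf sum_distrib_left)
  moreover have "M\<^sup>2 * (\<Sum>t=1..T. 1 / (real t)\<^sup>2) \<le> M\<^sup>2 * 2"
    by (intro mult_left_mono sum_inverse_squares_le) simp
  moreover have "(K + 2) * M * (\<Sum>t=1..T. M * \<eta> t * (norm (Q (t - 1)))\<^sup>2)
     \<le> (K + 2) * M * (2 * real T powr \<bar>\<alpha>\<bar> * v T)"
    using K_ge_1 M_pos by (intro mult_left_mono sum_eta_norm_square_le) auto
  ultimately have "(\<Sum>t=1..T. \<Sum>i\<in>UNIV. \<theta> t $ i * g t $ i) - M\<^sup>2 * 2
      - (K + 2) * M * (2 * real T powr \<bar>\<alpha>\<bar> * v T)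
    \<le> (\<Sum>t=1..T. \<Sum>i\<in>UNIV. p t $ i * payoff t i)" by linarith
  then show ?thesis by (simp only: mult_ac)
qed

end

section \<open>The policy as a stochastic process\<close>
lemma borel_measurable_vecI:
  fixes f :: "'w \<Rightarrow> real ^ 'k::finite"
  assumes "\<And>i. (\<lambda>\<omega>. f \<omega> $ i) \<in> borel_measurable N"
  shows "f \<in> borel_measurable N"
  unfolding borel_measurable_euclidean_space[of f]
  using assms by (auto simp: Basis_vec_def inner_axis)

lemma borel_measurable_nth:
  fixes f :: "'w \<Rightarrow> real ^ 'k::finite"
  assumes "f \<in> borel_measurable N"
  shows "(\<lambda>\<omega>. f \<omega> $ i) \<in> borel_measurable N"
  using assms by (rule measurable_compose)
    (intro borel_measurable_continuous_onI continuous_on_component continuous_on_id)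

lemma borel_measurable_action_nth:
  fixes f :: "'w \<Rightarrow> real ^ 'k::finite"
  assumes "f \<in> borel_measurable N" "b \<in> measurable N (count_space UNIV)"
  shows "(\<lambda>\<omega>. f \<omega> $ b \<omega>) \<in> borel_measurable N"
  using measurable_compose_countable[where f = "\<lambda>i \<omega>. f \<omega> $ i" and g = b, OF borel_measurable_nth[OF assms(1)] assms(2)] .

lemma borel_measurable_of_bool_action:
  assumes "b \<in> measurable N (count_space UNIV)"
  shows "(\<lambda>\<omega>. of_bool (i = b \<omega>) :: real) \<in> borel_measurable N"
  using measurable_compose[OF assms, of "\<lambda>j. of_bool (i = j)" borel] by simp

lemma borel_measurable_l1norm:
  assumes "f \<in> borel_measurable N"
  shows "(\<lambda>\<omega>. l1norm (f \<omega> :: real ^ 'k::finite)) \<in> borel_measurable N"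
  unfolding l1norm_def
  by (intro borel_measurable_sum borel_measurable_abs borel_measurable_nth assms)

text \<open>
  The decisions \<open>a\<close> are a parameter, so that besides the actual decisions also a fixed sequence of
  decisions can be inserted.
\<close>
definition point_process where
  "point_process M \<delta> A S a t \<omega> = softmw_point M \<delta> (\<lambda>s. queue_process A S a s \<omega>) (\<lambda>s. S s \<omega>)
     (queue_direction (\<lambda>s. queue_process A S a s \<omega>)) (\<lambda>s. a s \<omega>) t"

definition prob_process where
  "prob_process M \<delta> A S a t \<omega> = softmw_prob M \<delta> (\<lambda>s. queue_process A S a s \<omega>) (\<lambda>s. S s \<omega>)
     (queue_direction (\<lambda>s. queue_process A S a s \<omega>)) (\<lambda>s. a s \<omega>) t"

definition eta_process where
  "eta_process M \<delta> A S a t \<omega> = softmw_eta M \<delta> (\<lambda>s. queue_process A S a s \<omega>) t"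

definition gamma_process where
  "gamma_process M \<delta> A S a t \<omega> = softmw_gamma M \<delta> (\<lambda>s. queue_process A S a s \<omega>) t"

lemma queue_process_0: "queue_process A S a 0 \<omega> = 0"
  by (simp add: queue_process_def)

lemma queue_process_Suc:
  "queue_process A S a (Suc t) \<omega> =
    (\<chi> i. max (queue_process A S a t \<omega> $ i + A (Suc t) \<omega> $ i
       - S (Suc t) \<omega> $ i * of_bool (i = a (Suc t) \<omega>)) 0)"
  by (simp add: queue_process_def queue.simps)

lemma prob_process_eq:
  "prob_process M \<delta> A S a t \<omega> = (1 - gamma_process M \<delta> A S a t \<omega>) *\<^sub>R point_process M \<delta> A S a t \<omega>
     + gamma_process M \<delta> A S a t \<omega> *\<^sub>R queue_direction (\<lambda>s. queue_process A S a s \<omega>) t"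
  by (simp add: prob_process_def softmw_prob_def exp3_mix_def gamma_process_def point_process_def)

lemma point_process_Suc:
  fixes A :: "nat \<Rightarrow> 'w \<Rightarrow> real ^ 'k::finite"
  assumes "t \<ge> 1"
  shows "point_process M \<delta> A S a (Suc t) \<omega> = entropic_argmin (softmw_beta TYPE('k) t)
    (eta_process M \<delta> A S a t \<omega> *\<^sub>R axis (a t \<omega>)
        (queue_process A S a (t - 1) \<omega> $ a t \<omega> * S t \<omega> $ a t \<omega> / prob_process M \<delta> A S a t \<omega> $ a t \<omega>)
     + log_vec (point_process M \<delta> A S a t \<omega>))"
  unfolding point_process_def softmw_point_Suc[OF assms] exp3_estimate_def prob_process_def eta_process_def ..

lemma point_process_cong:
  assumes a: "\<And>s. 1 \<le> s \<Longrightarrow> s < t \<Longrightarrow> a s \<omega> = a' s \<omega>" and "t \<ge> 1"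
  shows "queue_process A S a (t - 1) \<omega> = queue_process A S a' (t - 1) \<omega>"
    and "point_process M \<delta> A S a t \<omega> = point_process M \<delta> A S a' t \<omega>"
    and "prob_process M \<delta> A S a t \<omega> = prob_process M \<delta> A S a' t \<omega>"
proof -
  have Q: "queue_process A S a s \<omega> = queue_process A S a' s \<omega>" if "s < t" for s
    using that by (induction s) (auto simp: queue_process_0 queue_process_Suc a)
  have eta: "eta_process M \<delta> A S a s \<omega> = eta_process M \<delta> A S a' s \<omega>"
      and gam: "gamma_process M \<delta> A S a s \<omega> = gamma_process M \<delta> A S a' s \<omega>"
      and dir: "queue_direction (\<lambda>s. queue_process A S a s \<omega>) s
        = queue_direction (\<lambda>s. queue_process A S a' s \<omega>) s"
    if "1 \<le> s" "s \<le> t" for s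
    using that Q by (auto simp: eta_process_def gamma_process_def softmw_gamma_def softmw_eta_def
        queue_direction_def intro!: sum.cong)
  have pt: "point_process M \<delta> A S a s \<omega> = point_process M \<delta> A S a' s \<omega>" if "1 \<le> s" "s \<le> t" for s
    using that
  proof (induction s rule: dec_induct)
    case base
    show ?case by (simp add: point_process_def softmw_point_1[simplified])
  next
    case (step s)
    then have IH: "point_process M \<delta> A S a s \<omega> = point_process M \<delta> A S a' s \<omega>" by simp
    have "prob_process M \<delta> A S a s \<omega> = prob_process M \<delta> A S a' s \<omega>"
      unfolding prob_process_eq using step IH gam[of s] dir[of s] by simp
    then show ?case
      unfolding point_process_Suc[OF step(1)] using IH step eta[of s] Q[of "s - 1"] a[of s] by simp
  qed
  show "queue_process A S a (t - 1) \<omega> = queue_process A S a' (t - 1) \<omega>" using Q assms(2) by simp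
  show "point_process M \<delta> A S a t \<omega> = point_process M \<delta> A S a' t \<omega>" using pt assms(2) by simp
  then show "prob_process M \<delta> A S a t \<omega> = prob_process M \<delta> A S a' t \<omega>"
    unfolding prob_process_eq using gam[of t] dir[of t] assms(2) by simp
qed

text \<open>
  Measurability is needed with respect to two sigma-algebras: with the actual decisions for the
  information before a slot, and with fixed decisions for the sigma-algebra of earlier arrivals and
  services alone.  Hence \<open>N\<close> is arbitrary.
\<close>
context
  fixes N :: "'w measure" and A S :: "nat \<Rightarrow> 'w \<Rightarrow> real ^ 'k::finite" and a :: "nat \<Rightarrow> 'w \<Rightarrow> 'k" and n :: nat
  assumes A: "\<And>s. 1 \<le> s \<Longrightarrow> s < n \<Longrightarrow> A s \<in> borel_measurable N"
    and S: "\<And>s. 1 \<le> s \<Longrightarrow> s < n \<Longrightarrow> S s \<in> borel_measurable N"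
    and a: "\<And>s. 1 \<le> s \<Longrightarrow> s < n \<Longrightarrow> a s \<in> measurable N (count_space UNIV)"
begin

lemma borel_measurable_queue_process: "t < n \<Longrightarrow> queue_process A S a t \<in> borel_measurable N"
proof (induction t)
  case 0
  then show ?case by (simp add: queue_process_0[abs_def])
next
  case (Suc t)
  have "(\<lambda>\<omega>. queue_process A S a (Suc t) \<omega> $ i) \<in> borel_measurable N" for i
  proof -
    have [measurable]: "(\<lambda>\<omega>. queue_process A S a t \<omega> $ i) \<in> borel_measurable N"
        "(\<lambda>\<omega>. A (Suc t) \<omega> $ i) \<in> borel_measurable N"
        "(\<lambda>\<omega>. S (Suc t) \<omega> $ i) \<in> borel_measurable N"
        "(\<lambda>\<omega>. of_bool (i = a (Suc t) \<omega>) :: real) \<in> borel_measurable N"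
      using Suc A[of "Suc t"] S[of "Suc t"] a[of "Suc t"]
      by (auto intro: borel_measurable_nth borel_measurable_of_bool_action)
    show ?thesis unfolding queue_process_Suc vec_lambda_beta by measurable
  qed
  then show ?case by (rule borel_measurable_vecI)
qed

lemma borel_measurable_eta_process:
  "1 \<le> t \<Longrightarrow> t \<le> n \<Longrightarrow> eta_process M \<delta> A S a t \<in> borel_measurable N"
proof -
  assume t: "1 \<le> t" "t \<le> n"
  have [measurable]: "(\<lambda>\<omega>. \<Sum>s<t. (norm (queue_process A S a s \<omega>))\<^sup>2) \<in> borel_measurable N"
  proof (rule borel_measurable_sum)
    fix s assume "s \<in> {..<t}"
    then have [measurable]: "queue_process A S a s \<in> borel_measurable N"
      using t by (intro borel_measurable_queue_process) auto
    show "(\<lambda>\<omega>. (norm (queue_process A S a s \<omega>))\<^sup>2) \<in> borel_measurable N" by measurable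
  qed
  show ?thesis unfolding eta_process_def[abs_def] softmw_eta_def by measurable
qed

lemma borel_measurable_gamma_process:
  "1 \<le> t \<Longrightarrow> t \<le> n \<Longrightarrow> gamma_process M \<delta> A S a t \<in> borel_measurable N"
proof -
  assume t: "1 \<le> t" "t \<le> n"
  have [measurable]: "(\<lambda>\<omega>. l1norm (queue_process A S a (t - 1) \<omega>)) \<in> borel_measurable N"
    using t by (intro borel_measurable_l1norm borel_measurable_queue_process) auto
  have [measurable]: "eta_process M \<delta> A S a t \<in> borel_measurable N"
    using t by (rule borel_measurable_eta_process)
  show ?thesis
    unfolding gamma_process_def[abs_def] softmw_gamma_def eta_process_def[symmetric] by measurable
qed

lemma borel_measurable_prob_process_from_point:
  assumes "1 \<le> t" "t \<le> n" "point_process M \<delta> A S a t \<in> borel_measurable N"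
  shows "prob_process M \<delta> A S a t \<in> borel_measurable N"
proof -
  have "prob_process M \<delta> A S a t =
     (\<lambda>\<omega>. (1 - gamma_process M \<delta> A S a t \<omega>) *\<^sub>R point_process M \<delta> A S a t \<omega>
       + gamma_process M \<delta> A S a t \<omega> *\<^sub>R
          (inverse (l1norm (queue_process A S a (t - 1) \<omega>)) *\<^sub>R queue_process A S a (t - 1) \<omega>))"
    by (simp add: fun_eq_iff prob_process_eq queue_direction_def)
  also have "\<dots> \<in> borel_measurable N"
  proof -
    have [measurable]: "queue_process A S a (t - 1) \<in> borel_measurable N"
      using assms by (intro borel_measurable_queue_process) auto
    have [measurable]: "(\<lambda>\<omega>. l1norm (queue_process A S a (t - 1) \<omega>)) \<in> borel_measurable N"
      by (rule borel_measurable_l1norm) measurable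
    note [measurable] = assms(3) borel_measurable_gamma_process[OF assms(1,2)]
    show ?thesis by measurable
  qed
  finally show ?thesis .
qed

lemma borel_measurable_point_process:
  "1 \<le> t \<Longrightarrow> t \<le> n \<Longrightarrow> point_process M \<delta> A S a t \<in> borel_measurable N"
proof (induction t rule: dec_induct)
  case base
  show ?case by (simp add: point_process_def[abs_def] softmw_point_1[simplified])
next
  case (step t)
  then have t: "1 \<le> t" "t < n" "t \<le> n" and x: "point_process M \<delta> A S a t \<in> borel_measurable N" by auto
  note p = borel_measurable_prob_process_from_point[OF t(1,3) x]
  have "(\<lambda>\<omega>. axis (a t \<omega>) (queue_process A S a (t - 1) \<omega> $ a t \<omega> * S t \<omega> $ a t \<omega>
      / prob_process M \<delta> A S a t \<omega> $ a t \<omega>)) \<in> borel_measurable N"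
  proof (rule borel_measurable_vecI)
    fix i
    have [measurable]: "(\<lambda>\<omega>. of_bool (i = a t \<omega>) :: real) \<in> borel_measurable N"
        "(\<lambda>\<omega>. queue_process A S a (t - 1) \<omega> $ a t \<omega>) \<in> borel_measurable N"
        "(\<lambda>\<omega>. S t \<omega> $ a t \<omega>) \<in> borel_measurable N"
        "(\<lambda>\<omega>. prob_process M \<delta> A S a t \<omega> $ a t \<omega>) \<in> borel_measurable N"
      using borel_measurable_of_bool_action[OF a[OF t(1,2)]]
        borel_measurable_action_nth[OF borel_measurable_queue_process a[OF t(1,2)], of "t - 1"]
        borel_measurable_action_nth[OF S[OF t(1,2)] a[OF t(1,2)]]
        borel_measurable_action_nth[OF p a[OF t(1,2)]] t by auto
    have "(\<lambda>\<omega>. of_bool (i = a t \<omega>) * (queue_process A S a (t - 1) \<omega> $ a t \<omega> * S t \<omega> $ a t \<omega>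
      / prob_process M \<delta> A S a t \<omega> $ a t \<omega>)) \<in> borel_measurable N" by measurable
    then show "(\<lambda>\<omega>. axis (a t \<omega>) (queue_process A S a (t - 1) \<omega> $ a t \<omega> * S t \<omega> $ a t \<omega>
      / prob_process M \<delta> A S a t \<omega> $ a t \<omega>) $ i) \<in> borel_measurable N"
      by (rule back_subst[of "\<lambda>f. f \<in> borel_measurable N"]) (auto simp: axis_def fun_eq_iff)
  qed
  note [measurable] = this borel_measurable_eta_process[OF t(1,3)]
  have [measurable]: "(\<lambda>\<omega>. log_vec (point_process M \<delta> A S a t \<omega>)) \<in> borel_measurable N"
  proof (rule borel_measurable_vecI)
    fix i
    show "(\<lambda>\<omega>. log_vec (point_process M \<delta> A S a t \<omega>) $ i) \<in> borel_measurable N"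
      unfolding log_vec_def vec_lambda_beta by (intro borel_measurable_ln borel_measurable_nth x)
  qed
  have "(\<lambda>\<omega>. eta_process M \<delta> A S a t \<omega> *\<^sub>R axis (a t \<omega>)
        (queue_process A S a (t - 1) \<omega> $ a t \<omega> * S t \<omega> $ a t \<omega> / prob_process M \<delta> A S a t \<omega> $ a t \<omega>)
     + log_vec (point_process M \<delta> A S a t \<omega>)) \<in> borel_measurable N"
    by measurable
  then show ?case
    unfolding point_process_Suc[OF t(1), abs_def]
    by (rule measurable_compose)
      (intro borel_measurable_entropic_argmin softmw_beta_pos softmw_beta_le t(1))
qed

lemma borel_measurable_prob_process:
  "1 \<le> t \<Longrightarrow> t \<le> n \<Longrightarrow> prob_process M \<delta> A S a t \<in> borel_measurable N"
  using borel_measurable_prob_process_from_point borel_measurable_point_process by blast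

end

lemma integral_vec_nth:
  fixes f :: "'w \<Rightarrow> real ^ 'k::finite"
  assumes "integrable P f"
  shows "(\<integral>\<omega>. f \<omega> \<partial>P) $ i = (\<integral>\<omega>. f \<omega> $ i \<partial>P)"
  using integral_bounded_linear[OF bounded_linear_vec_nth assms] by metis

locale softmw_system =
  fixes P :: "'w measure" and M K \<delta> \<epsilon> C\<^sub>W C\<^sub>V :: real
    and \<A> \<S> :: "nat \<Rightarrow> (real ^ 'k::finite) measure" and \<theta> :: "nat \<Rightarrow> real ^ 'k"
    and A S e :: "nat \<Rightarrow> 'w \<Rightarrow> real ^ 'k" and a :: "nat \<Rightarrow> 'w \<Rightarrow> 'k"
  assumes K_def: "K = real CARD('k)"
    and inst: "problem_instance M \<A> \<S>"
    and stabilizable: "piecewise_stabilizable (\<lambda>t. mean (\<A> t)) (\<lambda>t. mean (\<S> t)) \<theta> C\<^sub>W \<epsilon>"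
    and stationary: "reference_stationary \<theta> \<delta> C\<^sub>V"
    and \<delta>_less: "\<delta> < 1"
    and arrivals: "arrivals_services P \<A> \<S> A S"
    and run: "runs_softmw P M \<delta> A S e a"
begin

sublocale prob_space P
  using arrivals by (simp add: arrivals_services_def)

abbreviation "Q \<equiv> queue_process A S a"

lemma M_pos: "0 < M" using inst by (simp add: problem_instance_def)

lemma A_measurable: "t \<ge> 1 \<Longrightarrow> A t \<in> borel_measurable P"
  and S_measurable: "t \<ge> 1 \<Longrightarrow> S t \<in> borel_measurable P"
  using arrivals by (auto simp: arrivals_services_def)

lemma a_measurable: "t \<ge> 1 \<Longrightarrow> a t \<in> measurable P (count_space UNIV)"
  using run by (simp add: runs_softmw_def Let_def)

text \<open>
  The paths to which the deterministic analysis applies; they have probability 1.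
\<close>
definition good :: "'w \<Rightarrow> bool" where
  "good \<omega> \<longleftrightarrow> \<omega> \<in> space P \<and>
     (\<forall>t\<ge>1. \<forall>i. 0 \<le> A t \<omega> $ i \<and> A t \<omega> $ i \<le> M \<and> 0 \<le> S t \<omega> $ i \<and> S t \<omega> $ i \<le> M)"

lemma AE_good: "AE \<omega> in P. good \<omega>"
proof -
  have box: "AE \<omega> in P. \<forall>i. 0 \<le> X \<omega> $ i \<and> X \<omega> $ i \<le> M"
    if X: "X \<in> borel_measurable P" "AE v in distr P borel X. v \<in> cbox 0 (\<chi> i. M)" for X :: "'w \<Rightarrow> real ^ 'k"
  proof -
    have "AE \<omega> in P. X \<omega> \<in> cbox 0 (\<chi> i. M)"
      using X(2) AE_distr_iff[OF X(1), of "\<lambda>v. v \<in> cbox 0 (\<chi> i. M)"] by simp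
    then show ?thesis by eventually_elim (auto simp: mem_box_cart)
  qed
  have law: "distr P borel (A (Suc t)) = \<A> (Suc t)" "distr P borel (S (Suc t)) = \<S> (Suc t)" for t
    using arrivals by (auto simp: arrivals_services_def)
  have "AE \<omega> in P. \<forall>i. 0 \<le> A (Suc t) \<omega> $ i \<and> A (Suc t) \<omega> $ i \<le> M" for t
  proof (rule box[OF A_measurable])
    show "AE v in distr P borel (A (Suc t)). v \<in> cbox 0 (\<chi> i. M)"
      unfolding law using inst by (simp add: problem_instance_def)
  qed simp
  moreover have "AE \<omega> in P. \<forall>i. 0 \<le> S (Suc t) \<omega> $ i \<and> S (Suc t) \<omega> $ i \<le> M" for t
  proof (rule box[OF S_measurable])
    show "AE v in distr P borel (S (Suc t)). v \<in> cbox 0 (\<chi> i. M)"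
      unfolding law using inst by (simp add: problem_instance_def)
  qed simp
  ultimately have "AE \<omega> in P. \<forall>t. \<forall>i. 0 \<le> A (Suc t) \<omega> $ i \<and> A (Suc t) \<omega> $ i \<le> M"
     "AE \<omega> in P. \<forall>t. \<forall>i. 0 \<le> S (Suc t) \<omega> $ i \<and> S (Suc t) \<omega> $ i \<le> M"
    by (simp_all add: AE_all_countable)
  with AE_space show ?thesis
  proof eventually_elim
    case (elim \<omega>)
    show ?case unfolding good_def
    proof (intro conjI allI impI)
      fix t :: nat and i assume "1 \<le> t"
      then obtain s where "t = Suc s" by (cases t) auto
      then show "0 \<le> A t \<omega> $ i" "A t \<omega> $ i \<le> M" "0 \<le> S t \<omega> $ i" "S t \<omega> $ i \<le> M"
        using elim by auto
    qed (use elim in auto)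
  qed
qed

lemma sample_path_good:
  assumes "good \<omega>"
  shows "sample_path M K (\<lambda>t. A t \<omega>) (\<lambda>t. S t \<omega>)"
  using assms M_pos by unfold_locales (auto simp: good_def K_def)

lemma regret_path_good:
  assumes "good \<omega>"
  shows "regret_path M K (\<lambda>t. A t \<omega>) (\<lambda>t. S t \<omega>) \<delta> \<theta> C\<^sub>V"
proof -
  interpret path: sample_path M K "\<lambda>t. A t \<omega>" "\<lambda>t. S t \<omega>" "\<lambda>t. a t \<omega>"
    by (rule sample_path_good[OF assms])
  show ?thesis
    using stabilizable stationary \<delta>_less
    by unfold_locales (auto simp: piecewise_stabilizable_def reference_stationary_def)
qed

lemma Q_measurable: "Q t \<in> borel_measurable P"
  using A_measurable S_measurable a_measurable
  by (intro borel_measurable_queue_process[of "Suc t"]) auto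

lemma Q_nonneg: "good \<omega> \<Longrightarrow> 0 \<le> Q t \<omega> $ i"
  using sample_path.queue_nonneg[OF sample_path_good] by (simp add: queue_process_def)

lemma Q_le: "good \<omega> \<Longrightarrow> Q t \<omega> $ i \<le> M * real t"
  using sample_path.queue_le[OF sample_path_good] by (simp add: queue_process_def)

lemma integrable_AE_bounded:
  fixes f :: "'w \<Rightarrow> real"
  assumes "f \<in> borel_measurable P" "\<And>\<omega>. good \<omega> \<Longrightarrow> \<bar>f \<omega>\<bar> \<le> B"
  shows "integrable P f"
proof (rule integrable_const_bound)
  show "AE \<omega> in P. norm (f \<omega>) \<le> B" using AE_good by eventually_elim (use assms(2) in auto)
qed (rule assms(1))

section \<open>Conditional law of the decisions\<close>

abbreviation "F t \<equiv> info_before P A S a t"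

lemma info_before_generators:
  "{A s -` B \<inter> space P | s B. 1 \<le> s \<and> B \<in> sets borel} \<union>
      {S s -` B \<inter> space P | s B. 1 \<le> s \<and> B \<in> sets borel} \<union>
      {a s -` {i} \<inter> space P | s i. 1 \<le> s \<and> s < t} \<subseteq> sets P"
  using measurable_sets[OF A_measurable] measurable_sets[OF S_measurable] measurable_sets[OF a_measurable]
  by auto

lemma space_info_before: "space (F t) = space P"
  unfolding info_before_def by (rule space_measure_of) (use info_before_generators sets.space_closed in blast)

lemma sets_info_before: "sets (F t) = sigma_sets (space P)
  ({A s -` B \<inter> space P | s B. 1 \<le> s \<and> B \<in> sets borel} \<union>
      {S s -` B \<inter> space P | s B. 1 \<le> s \<and> B \<in> sets borel} \<union>
      {a s -` {i} \<inter> space P | s i. 1 \<le> s \<and> s < t})"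
  unfolding info_before_def by (rule sets_measure_of) (use info_before_generators sets.space_closed in blast)

lemma subalgebra_info_before: "subalgebra P (F t)"
  unfolding subalgebra_def space_info_before sets_info_before
  using sets.sigma_sets_subset[OF info_before_generators] by simp

sublocale info: finite_measure_subalgebra P "F t" for t
  by unfold_locales (rule subalgebra_info_before)

lemma A_measurable_info: "s \<ge> 1 \<Longrightarrow> A s \<in> borel_measurable (F t)"
  by (rule measurableI) (auto simp: space_info_before sets_info_before intro!: sigma_sets.Basic)

lemma S_measurable_info: "s \<ge> 1 \<Longrightarrow> S s \<in> borel_measurable (F t)"
  by (rule measurableI) (auto simp: space_info_before sets_info_before intro!: sigma_sets.Basic)

lemma a_measurable_info:
  assumes "1 \<le> s" "s < t"
  shows "a s \<in> measurable (F t) (count_space UNIV)"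
  unfolding measurable_count_space_eq2_countable space_info_before sets_info_before
  using assms by (auto intro!: sigma_sets.Basic)

abbreviation "p \<equiv> prob_process M \<delta> A S a"

lemma prob_process_measurable_info: "t \<ge> 1 \<Longrightarrow> p t \<in> borel_measurable (F t)"
  by (rule borel_measurable_prob_process[where n = t])
    (auto intro: A_measurable_info S_measurable_info a_measurable_info)

lemma prob_process_bounds:
  assumes "good \<omega>" "t \<ge> 1"
  shows "0 \<le> prob_process M \<delta> A S b t \<omega> $ i" "prob_process M \<delta> A S b t \<omega> $ i \<le> 1"
proof -
  interpret path: regret_path M K "\<lambda>t. A t \<omega>" "\<lambda>t. S t \<omega>" "\<lambda>t. b t \<omega>" \<delta> \<theta> C\<^sub>V
    by (rule regret_path_good[OF assms(1)])
  have eq: "prob_process M \<delta> A S b t \<omega> = path.p t"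
    by (simp add: path.p_def prob_process_def queue_process_def)
  show "0 \<le> prob_process M \<delta> A S b t \<omega> $ i" unfolding eq using path.p_pos[OF assms(2), of i] by simp
  have "path.e\<^sub>Q t $ i \<le> 1"
  proof (cases "l1norm (queue (\<lambda>t. A t \<omega>) (\<lambda>t. S t \<omega>) (\<lambda>t. b t \<omega>) (t - 1)) = 0")
    case False
    then have "0 < l1norm (queue (\<lambda>t. A t \<omega>) (\<lambda>t. S t \<omega>) (\<lambda>t. b t \<omega>) (t - 1))"
      using path.l1norm_queue_nonneg[of "t - 1"] by simp
    moreover have "queue (\<lambda>t. A t \<omega>) (\<lambda>t. S t \<omega>) (\<lambda>t. b t \<omega>) (t - 1) $ i
       \<le> l1norm (queue (\<lambda>t. A t \<omega>) (\<lambda>t. S t \<omega>) (\<lambda>t. b t \<omega>) (t - 1))"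
      unfolding path.l1norm_queue by (rule member_le_sum) (auto simp: path.queue_nonneg)
    ultimately show ?thesis by (simp add: path.e\<^sub>Q_def divide_inverse[symmetric] field_simps)
  qed (simp add: path.e\<^sub>Q_def)
  moreover have "path.x t $ i \<le> 1" using prob_simplex_le_1[OF path.x_prob[OF assms(2)]] .
  ultimately have "(1 - path.\<gamma> t) * path.x t $ i + path.\<gamma> t * path.e\<^sub>Q t $ i \<le> (1 - path.\<gamma> t) * 1 + path.\<gamma> t * 1"
    using path.gamma_nonneg[OF assms(2)] path.gamma_le_half[OF assms(2)]
    by (intro add_mono mult_left_mono) auto
  then show "prob_process M \<delta> A S b t \<omega> $ i \<le> 1" unfolding eq path.p_eq by simp
qed

text \<open>
  The cofactor \<open>f\<close> may depend on the arrivals and services of all slots, also later ones, since the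
  decision is conditioned on them; this is what makes the induction in \<open>integral_cylinder\<close> work.
\<close>
lemma integral_action:
  assumes t: "t \<ge> 1" and f: "f \<in> borel_measurable (F t)" "\<And>\<omega>. good \<omega> \<Longrightarrow> \<bar>f \<omega>\<bar> \<le> B"
  shows "(\<integral>\<omega>. f \<omega> * of_bool (a t \<omega> = i) \<partial>P) = (\<integral>\<omega>. f \<omega> * p t \<omega> $ i \<partial>P)"
proof -
  let ?I = "indicator {\<omega> \<in> space P. a t \<omega> = i} :: 'w \<Rightarrow> real"
  have fP: "f \<in> borel_measurable P" by (rule measurable_from_subalg[OF subalgebra_info_before f(1)])
  have "{\<omega> \<in> space P. a t \<omega> = i} = a t -` {i} \<inter> space P" by auto
  then have I: "?I \<in> borel_measurable P"
    using measurable_sets[OF a_measurable[OF t], of "{i}"] by simp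
  have "integrable P (\<lambda>\<omega>. f \<omega> * ?I \<omega>)"
  proof (rule integrable_AE_bounded[OF borel_measurable_times[OF fP I]])
    show "\<bar>f \<omega> * ?I \<omega>\<bar> \<le> B" if "good \<omega>" for \<omega>
      using f(2)[OF that] by (auto simp: indicator_def)
  qed
  then have "(\<integral>\<omega>. f \<omega> * ?I \<omega> \<partial>P) = (\<integral>\<omega>. f \<omega> * real_cond_exp P (F t) ?I \<omega> \<partial>P)"
    using info.real_cond_exp_intg(2)[OF _ f(1) I] by simp
  also have "\<dots> = (\<integral>\<omega>. f \<omega> * p t \<omega> $ i \<partial>P)"
  proof (rule integral_cong_AE)
    have "AE \<omega> in P. real_cond_exp P (F t) ?I \<omega> =
         softmw_prob M \<delta> (\<lambda>s. Q s \<omega>) (\<lambda>s. S s \<omega>) (\<lambda>s. e s \<omega>) (\<lambda>s. a s \<omega>) t $ i"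
      using run t unfolding runs_softmw_def Let_def by blast
    with AE_good show "AE \<omega> in P. f \<omega> * real_cond_exp P (F t) ?I \<omega> = f \<omega> * p t \<omega> $ i"
    proof eventually_elim
      case (elim \<omega>)
      interpret path: regret_path M K "\<lambda>t. A t \<omega>" "\<lambda>t. S t \<omega>" "\<lambda>t. a t \<omega>" \<delta> \<theta> C\<^sub>V
        by (rule regret_path_good[OF elim(1)])
      have "softmw_prob M \<delta> (\<lambda>s. Q s \<omega>) (\<lambda>s. S s \<omega>) (\<lambda>s. e s \<omega>) (\<lambda>s. a s \<omega>) t = p t \<omega>"
        using path.softmw_prob_eq_p[of "\<lambda>s. e s \<omega>" t] run elim(1) t
        unfolding runs_softmw_def Let_def good_def path.p_def prob_process_def queue_process_def by blast
      then show ?case using elim(2) by simp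
    qed
    have "(\<lambda>\<omega>. p t \<omega> $ i) \<in> borel_measurable P"
      using measurable_from_subalg[OF subalgebra_info_before prob_process_measurable_info[OF t]]
      by (rule borel_measurable_nth)
    then show "(\<lambda>\<omega>. f \<omega> * p t \<omega> $ i) \<in> borel_measurable P"
      using fP by (intro borel_measurable_times)
  qed (use fP in \<open>intro borel_measurable_times; simp\<close>)
  also have "(\<integral>\<omega>. f \<omega> * ?I \<omega> \<partial>P) = (\<integral>\<omega>. f \<omega> * of_bool (a t \<omega> = i) \<partial>P)"
    by (intro Bochner_Integration.integral_cong) (auto simp: indicator_def)
  finally show ?thesis by simp
qed

section \<open>Independence of the queues from current arrivals and services\<close>

text \<open>
  Without the decisions, this sigma-algebra is independent of slot \<open>t\<close> by assumption.
\<close>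
definition past :: "nat \<Rightarrow> 'w measure" where
  "past t = sigma (space P)
     (\<Union>k\<in>{1..<t} <+> {1..<t}. {case_sum A S k -` B \<inter> space P | B. B \<in> sets borel})"

lemma case_sum_measurable: "k \<in> {1..} <+> {1..} \<Longrightarrow> case_sum A S k \<in> borel_measurable P"
  using A_measurable S_measurable by auto

lemma past_generators:
  "(\<Union>k\<in>{1..<t} <+> {1..<t}. {case_sum A S k -` B \<inter> space P | B. B \<in> sets borel}) \<subseteq> sets P"
  using measurable_sets[OF case_sum_measurable] by fastforce

lemma space_past: "space (past t) = space P"
  unfolding past_def by (rule space_measure_of) (use past_generators sets.space_closed in blast)

lemma sets_past: "sets (past t) = sigma_sets (space P)
     (\<Union>k\<in>{1..<t} <+> {1..<t}. {case_sum A S k -` B \<inter> space P | B. B \<in> sets borel})"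
  unfolding past_def by (rule sets_measure_of) (use past_generators sets.space_closed in blast)

lemma subalgebra_past: "subalgebra P (past t)"
  unfolding subalgebra_def space_past sets_past
  using sets.sigma_sets_subset[OF past_generators] by simp

lemma case_sum_measurable_past: "k \<in> {1..<t} <+> {1..<t} \<Longrightarrow> case_sum A S k \<in> borel_measurable (past t)"
  by (rule measurableI) (auto simp: space_past sets_past intro!: sigma_sets.Basic)

lemma A_measurable_past: "1 \<le> s \<Longrightarrow> s < t \<Longrightarrow> A s \<in> borel_measurable (past t)"
  using case_sum_measurable_past[of "Inl s" t] by (auto simp: Plus_def)

lemma S_measurable_past: "1 \<le> s \<Longrightarrow> s < t \<Longrightarrow> S s \<in> borel_measurable (past t)"
  using case_sum_measurable_past[of "Inr s" t] by (auto simp: Plus_def)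

text \<open>
  An index outside the past is independent of everything generated by the past, by grouping the
  independent family into these two blocks.
\<close>
lemma integral_mult_past:
  assumes f: "f \<in> borel_measurable (past t)" "integrable P f"
    and k: "k \<in> {1..} <+> {1..}" "k \<notin> {1..<t} <+> {1..<t}"
    and X: "integrable P (\<lambda>\<omega>. case_sum A S k \<omega> $ j)"
  shows "(\<integral>\<omega>. f \<omega> * case_sum A S k \<omega> $ j \<partial>P) = (\<integral>\<omega>. f \<omega> \<partial>P) * (\<integral>\<omega>. case_sum A S k \<omega> $ j \<partial>P)"
proof (rule indep_var_lebesgue_integral[OF _ f(2) X])
  define E where "E k = {case_sum A S k -` B \<inter> space P | B. B \<in> sets borel}" for k
  let ?I = "case_bool ({1..<t} <+> {1..<t}) {k}"
  have "indep_sets E ({1..} <+> {1..})"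
    using arrivals by (simp add: arrivals_services_def indep_vars_def2 E_def[abs_def])
  then have "indep_sets E (\<Union>b\<in>UNIV. ?I b)"
    by (rule indep_sets_mono_index[rotated]) (use k in \<open>auto simp: UNIV_bool\<close>)
  moreover have "Int_stable (E k)" for k
    unfolding Int_stable_def E_def
  proof safe
    fix B C :: "(real ^ 'k) set" assume BC: "B \<in> sets borel" "C \<in> sets borel"
    show "\<exists>D. (case_sum A S k -` B \<inter> space P) \<inter> (case_sum A S k -` C \<inter> space P)
       = case_sum A S k -` D \<inter> space P \<and> D \<in> sets borel"
      using BC by (intro exI[of _ "B \<inter> C"]) auto
  qed
  moreover have "disjoint_family_on ?I UNIV"
    using k by (auto simp: disjoint_family_on_def split: bool.splits)
  ultimately have "indep_sets (\<lambda>b. sigma_sets (space P) (\<Union>i\<in>?I b. E i)) UNIV"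
    by (intro indep_sets_collect_sigma)
  moreover have "(\<lambda>b. sigma_sets (space P) (\<Union>i\<in>?I b. E i)) =
      case_bool (sigma_sets (space P) (\<Union>i\<in>{1..<t} <+> {1..<t}. E i)) (sigma_sets (space P) (E k))"
    by (auto simp: fun_eq_iff split: bool.split)
  ultimately have ind: "indep_set (sets (past t)) (sigma_sets (space P) (E k))"
    by (simp add: indep_set_def sets_past E_def)
  show "indep_var borel f borel (\<lambda>\<omega>. case_sum A S k \<omega> $ j)"
    unfolding indep_var_eq
  proof (intro conjI)
    show "f \<in> borel_measurable P" by (rule measurable_from_subalg[OF subalgebra_past f(1)])
    show "(\<lambda>\<omega>. case_sum A S k \<omega> $ j) \<in> borel_measurable P" using X by simp
    have "sigma_sets (space P) {f -` B \<inter> space P | B. B \<in> sets borel} \<subseteq> sets (past t)"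
    proof -
      have "{f -` B \<inter> space P | B. B \<in> sets borel} \<subseteq> sets (past t)"
        using measurable_sets[OF f(1)] unfolding space_past by auto
      then show ?thesis using sets.sigma_sets_subset[of _ "past t"] unfolding space_past by blast
    qed
    moreover have "sigma_sets (space P) {(\<lambda>\<omega>. case_sum A S k \<omega> $ j) -` B \<inter> space P | B. B \<in> sets borel}
        \<subseteq> sigma_sets (space P) (E k)"
    proof (rule sigma_sets_mono, safe)
      fix B :: "real set" assume B: "B \<in> sets borel"
      have "(\<lambda>v. v $ j) \<in> borel_measurable (borel :: (real ^ 'k) measure)"
        by (rule borel_measurable_nth) simp
      from measurable_sets[OF this B] have "(\<lambda>v :: real ^ 'k. v $ j) -` B \<in> sets borel" by simp
      then show "(\<lambda>\<omega>. case_sum A S k \<omega> $ j) -` B \<inter> space P \<in> sigma_sets (space P) (E k)"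
        unfolding E_def by (intro sigma_sets.Basic) (auto intro!: exI[of _ "(\<lambda>v. v $ j) -` B"])
    qed
    ultimately show "indep_set (sigma_sets (space P) {f -` B \<inter> space P | B. B \<in> sets borel})
       (sigma_sets (space P) {(\<lambda>\<omega>. case_sum A S k \<omega> $ j) -` B \<inter> space P | B. B \<in> sets borel})"
      using ind unfolding indep_sets2_eq by (meson subset_iff)
  qed
qed

text \<open>
  The queues before slot \<open>t\<close> also depend on the earlier decisions.  Their conditional law is known given
  all arrivals and services, those of slot \<open>t\<close> included, so it has to be shown that this dependence
  carries no information about slot \<open>t\<close>.  For a fixed word \<open>w\<close> of decisions, the conditional
  probability that the decisions follow \<open>w\<close> is the product of the probabilities that the policy assigns
  along \<open>w\<close>, and each factor is a function of earlier arrivals and services.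
\<close>

abbreviation "p\<^sub>w w \<equiv> prob_process M \<delta> A S (\<lambda>s _. w s)"

lemma word_prob_measurable:
  "1 \<le> s \<Longrightarrow> s \<le> t \<Longrightarrow> (\<lambda>\<omega>. p\<^sub>w w s \<omega> $ i) \<in> borel_measurable (past t)"
  by (intro borel_measurable_nth borel_measurable_prob_process[where n = t])
    (auto intro: A_measurable_past S_measurable_past)

definition cylinder :: "(nat \<Rightarrow> 'k) \<Rightarrow> nat \<Rightarrow> 'w \<Rightarrow> real" where
  "cylinder w n \<omega> = (\<Prod>s\<in>{1..<n}. of_bool (a s \<omega> = w s))"

definition word_weight :: "(nat \<Rightarrow> 'k) \<Rightarrow> nat \<Rightarrow> 'w \<Rightarrow> real" where
  "word_weight w n \<omega> = (\<Prod>s\<in>{1..<n}. p\<^sub>w w s \<omega> $ w s)"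

lemma cylinder_eq: "cylinder w n \<omega> = of_bool (\<forall>s\<in>{1..<n}. a s \<omega> = w s)"
  unfolding cylinder_def by (induction n) (auto simp: atLeastLessThanSuc)

lemma cylinder_measurable: "cylinder w n \<in> borel_measurable (F n)"
proof -
  have "(\<lambda>\<omega>. of_bool (a s \<omega> = w s) :: real) \<in> borel_measurable (F n)" if "s \<in> {1..<n}" for s
    using measurable_compose[OF a_measurable_info[of s n], of "\<lambda>j. of_bool (j = w s)" borel] that by simp
  then show ?thesis unfolding cylinder_def[abs_def] by (intro borel_measurable_prod) auto
qed

lemma past_le_info: "f \<in> borel_measurable (past t) \<Longrightarrow> f \<in> borel_measurable (F n)"
proof (rule measurable_from_subalg)
  have "sets (past t) \<subseteq> sets (F n)"
    unfolding sets_past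
    using measurable_sets[OF A_measurable_info] measurable_sets[OF S_measurable_info]
    by (intro sets.sigma_sets_subset[of _ "F n", unfolded space_info_before]) (fastforce simp: space_info_before)
  then show "subalgebra (F n) (past t)" by (simp add: subalgebra_def space_past space_info_before)
qed

lemma word_weight_measurable: "n \<le> t \<Longrightarrow> word_weight w n \<in> borel_measurable (past t)"
  unfolding word_weight_def[abs_def] by (intro borel_measurable_prod word_prob_measurable) auto

lemma word_weight_bounds:
  assumes "good \<omega>"
  shows "0 \<le> word_weight w n \<omega>" "word_weight w n \<omega> \<le> 1"
  unfolding word_weight_def using prob_process_bounds[OF assms]
  by (auto intro!: prod_nonneg prod_le_1)

lemma abs_mult_le_bound: "\<bar>x\<bar> \<le> B \<Longrightarrow> \<bar>y\<bar> \<le> C \<Longrightarrow> \<bar>x * y\<bar> \<le> B * C" for x y B C :: real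
  unfolding abs_mult by (rule mult_mono) auto

text \<open>
  Peel off the last decision by \<open>integral_action\<close>.  On the event that the earlier decisions follow \<open>w\<close>,
  the probability of this decision is the one computed along \<open>w\<close>, a function of the past that joins the
  factor \<open>f\<close>; hence the induction is over all \<open>f\<close>.
\<close>
lemma integral_cylinder:
  assumes n: "1 \<le> n" "n \<le> t"
    and f: "f \<in> borel_measurable (past t)" "\<And>\<omega>. good \<omega> \<Longrightarrow> \<bar>f \<omega>\<bar> \<le> B"
    and h: "\<And>n. h \<in> borel_measurable (F n)" "\<And>\<omega>. good \<omega> \<Longrightarrow> \<bar>h \<omega>\<bar> \<le> C"
  shows "(\<integral>\<omega>. f \<omega> * h \<omega> * cylinder w n \<omega> \<partial>P) = (\<integral>\<omega>. f \<omega> * word_weight w n \<omega> * h \<omega> \<partial>P)"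
  using n f
proof (induction n arbitrary: f rule: dec_induct)
  case base
  then show ?case by (simp add: cylinder_def word_weight_def)
next
  case (step n)
  then have n: "1 \<le> n" "n \<le> t" "n < t" by auto
  let ?f = "\<lambda>\<omega>. f \<omega> * h \<omega> * cylinder w n \<omega>" and ?f' = "\<lambda>\<omega>. f \<omega> * p\<^sub>w w n \<omega> $ w n"
  have "(\<integral>\<omega>. f \<omega> * h \<omega> * cylinder w (Suc n) \<omega> \<partial>P) = (\<integral>\<omega>. ?f \<omega> * of_bool (a n \<omega> = w n) \<partial>P)"
    using n by (simp add: cylinder_def atLeastLessThanSuc mult_ac)
  also have "\<dots> = (\<integral>\<omega>. ?f \<omega> * p n \<omega> $ w n \<partial>P)"
  proof (rule integral_action[OF n(1)])
    show "?f \<in> borel_measurable (F n)"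
      by (intro borel_measurable_times past_le_info[OF step.prems(2)] h(1) cylinder_measurable)
    show "\<bar>?f \<omega>\<bar> \<le> B * C * 1" if "good \<omega>" for \<omega>
      using step.prems(3)[OF that] h(2)[OF that]
      by (intro abs_mult_le_bound) (auto simp: cylinder_eq)
  qed
  also have "\<dots> = (\<integral>\<omega>. ?f' \<omega> * h \<omega> * cylinder w n \<omega> \<partial>P)"
  proof (rule Bochner_Integration.integral_cong)
    fix \<omega>
    show "?f \<omega> * p n \<omega> $ w n = ?f' \<omega> * h \<omega> * cylinder w n \<omega>"
    proof (cases "\<forall>s\<in>{1..<n}. a s \<omega> = w s")
      case True
      then have "p n \<omega> = p\<^sub>w w n \<omega>" by (intro point_process_cong(3)[OF _ n(1)]) auto
      then show ?thesis by simp
    qed (simp add: cylinder_eq)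
  qed simp
  also have "\<dots> = (\<integral>\<omega>. ?f' \<omega> * word_weight w n \<omega> * h \<omega> \<partial>P)"
  proof (rule step.IH[OF n(2)])
    show "?f' \<in> borel_measurable (past t)"
      using step.prems(2) n by (intro borel_measurable_times word_prob_measurable) auto
    show "\<bar>?f' \<omega>\<bar> \<le> B" if "good \<omega>" for \<omega>
      using abs_mult_le_bound[OF step.prems(3)[OF that], of "p\<^sub>w w n \<omega> $ w n" 1]
        prob_process_bounds[OF that n(1)] by (simp del: abs_mult)
  qed
  also have "\<dots> = (\<integral>\<omega>. f \<omega> * word_weight w (Suc n) \<omega> * h \<omega> \<partial>P)"
    using n by (simp add: word_weight_def atLeastLessThanSuc mult_ac)
  finally show ?case .
qed

lemma case_sum_bounds:
  assumes "good \<omega>" "k \<in> {1..} <+> {1..}"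
  shows "\<bar>case_sum A S k \<omega> $ j\<bar> \<le> M"
  using assms by (auto simp: good_def)

lemma case_sum_measurable_info: "k \<in> {1..} <+> {1..} \<Longrightarrow> (\<lambda>\<omega>. case_sum A S k \<omega> $ j) \<in> borel_measurable (F n)"
  using A_measurable_info S_measurable_info by (intro borel_measurable_nth) auto

lemma integral_cylinder_indep:
  assumes t: "1 \<le> t" and k: "k \<in> {1..} <+> {1..}" "k \<notin> {1..<t} <+> {1..<t}"
    and f: "f \<in> borel_measurable (past t)" "\<And>\<omega>. good \<omega> \<Longrightarrow> \<bar>f \<omega>\<bar> \<le> B"
  shows "(\<integral>\<omega>. f \<omega> * case_sum A S k \<omega> $ j * cylinder w t \<omega> \<partial>P)
     = (\<integral>\<omega>. f \<omega> * cylinder w t \<omega> \<partial>P) * (\<integral>\<omega>. case_sum A S k \<omega> $ j \<partial>P)"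
proof -
  let ?h = "\<lambda>\<omega>. case_sum A S k \<omega> $ j"
  have fw: "(\<lambda>\<omega>. f \<omega> * word_weight w t \<omega>) \<in> borel_measurable (past t)"
    using f(1) word_weight_measurable[of t t w] by (intro borel_measurable_times) auto
  have "\<bar>f \<omega> * word_weight w t \<omega>\<bar> \<le> B * 1" if "good \<omega>" for \<omega>
    using f(2)[OF that] word_weight_bounds[OF that, of w t] by (intro abs_mult_le_bound) auto
  then have int: "integrable P (\<lambda>\<omega>. f \<omega> * word_weight w t \<omega>)"
    using measurable_from_subalg[OF subalgebra_past fw] by (rule integrable_AE_bounded[rotated])
  have inth: "integrable P ?h"
    using case_sum_bounds[OF _ k(1)] borel_measurable_nth[OF case_sum_measurable[OF k(1)]]
    by (intro integrable_AE_bounded) auto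
  have "(\<integral>\<omega>. f \<omega> * ?h \<omega> * cylinder w t \<omega> \<partial>P) = (\<integral>\<omega>. f \<omega> * word_weight w t \<omega> * ?h \<omega> \<partial>P)"
    using f case_sum_measurable_info[OF k(1)] case_sum_bounds[OF _ k(1)]
    by (intro integral_cylinder[OF t order_refl]) auto
  also have "\<dots> = (\<integral>\<omega>. f \<omega> * word_weight w t \<omega> \<partial>P) * (\<integral>\<omega>. ?h \<omega> \<partial>P)"
    by (rule integral_mult_past[OF fw int k inth])
  also have "(\<integral>\<omega>. f \<omega> * word_weight w t \<omega> \<partial>P) = (\<integral>\<omega>. f \<omega> * cylinder w t \<omega> \<partial>P)"
    using integral_cylinder[OF t order_refl f, of "\<lambda>_. 1" 1 w] by simp
  finally show ?thesis .
qed

abbreviation "Q\<^sub>w w \<equiv> queue_process A S (\<lambda>s _. w s)"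

lemma queue_eq_sum_words:
  assumes t: "1 \<le> t"
  shows "Q (t - 1) \<omega> $ i = (\<Sum>w\<in>{1..<t} \<rightarrow>\<^sub>E UNIV. Q\<^sub>w w (t - 1) \<omega> $ i * cylinder w t \<omega>)"
proof -
  let ?w = "restrict (\<lambda>s. a s \<omega>) {1..<t}"
  have fin: "finite ({1..<t} \<rightarrow>\<^sub>E (UNIV :: 'k set))" by (intro finite_PiE) auto
  have "(\<Sum>w\<in>{1..<t} \<rightarrow>\<^sub>E UNIV. Q\<^sub>w w (t - 1) \<omega> $ i * cylinder w t \<omega>)
      = (\<Sum>w\<in>{1..<t} \<rightarrow>\<^sub>E UNIV. if w = ?w then Q\<^sub>w w (t - 1) \<omega> $ i else 0)"
  proof (rule sum.cong)
    fix w assume w: "w \<in> {1..<t} \<rightarrow>\<^sub>E (UNIV :: 'k set)"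
    have "(\<forall>s\<in>{1..<t}. a s \<omega> = w s) \<longleftrightarrow> w = ?w"
      using w by (auto simp: PiE_iff extensional_def fun_eq_iff restrict_def)
    then show "Q\<^sub>w w (t - 1) \<omega> $ i * cylinder w t \<omega> = (if w = ?w then Q\<^sub>w w (t - 1) \<omega> $ i else 0)"
      unfolding cylinder_eq by simp
  qed simp
  also have "\<dots> = Q\<^sub>w ?w (t - 1) \<omega> $ i" using fin by (simp add: sum.delta)
  also have "Q\<^sub>w ?w (t - 1) \<omega> = Q (t - 1) \<omega>"
    using t by (intro point_process_cong(1)) auto
  finally show ?thesis by simp
qed

text \<open>
  Split according to the word of earlier decisions, factor each summand, and reassemble.
\<close>
lemma expectation_queue_mult:
  assumes t: "1 \<le> t" and k: "k \<in> {1..} <+> {1..}" "k \<notin> {1..<t} <+> {1..<t}"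
  shows "(\<integral>\<omega>. Q (t - 1) \<omega> $ i * case_sum A S k \<omega> $ j \<partial>P)
     = (\<integral>\<omega>. Q (t - 1) \<omega> $ i \<partial>P) * (\<integral>\<omega>. case_sum A S k \<omega> $ j \<partial>P)"
proof -
  let ?h = "\<lambda>\<omega>. case_sum A S k \<omega> $ j" and ?W = "{1..<t} \<rightarrow>\<^sub>E (UNIV :: 'k set)"
  have Qw: "(\<lambda>\<omega>. Q\<^sub>w w (t - 1) \<omega> $ i) \<in> borel_measurable (past t)" for w
    using t by (intro borel_measurable_nth borel_measurable_queue_process[where n = t])
      (auto intro: A_measurable_past S_measurable_past)
  have Qw_le: "\<bar>Q\<^sub>w w (t - 1) \<omega> $ i\<bar> \<le> M * real (t - 1)" if "good \<omega>" for w \<omega>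
    using sample_path.queue_nonneg[OF sample_path_good[OF that], of w "t - 1" i]
      sample_path.queue_le[OF sample_path_good[OF that], of w "t - 1" i]
    by (simp add: queue_process_def)
  have meas: "(\<lambda>\<omega>. Q\<^sub>w w (t - 1) \<omega> $ i) \<in> borel_measurable P" "cylinder w t \<in> borel_measurable P"
      "?h \<in> borel_measurable P" for w
    using measurable_from_subalg[OF subalgebra_past Qw]
      measurable_from_subalg[OF subalgebra_info_before cylinder_measurable]
      borel_measurable_nth[OF case_sum_measurable[OF k(1)]] by auto
  have c1: "\<bar>cylinder w t \<omega>\<bar> \<le> 1" for w \<omega> by (simp add: cylinder_eq)
  have int: "integrable P (\<lambda>\<omega>. Q\<^sub>w w (t - 1) \<omega> $ i * cylinder w t \<omega>)"
      "integrable P (\<lambda>\<omega>. Q\<^sub>w w (t - 1) \<omega> $ i * ?h \<omega> * cylinder w t \<omega>)" for w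
  proof -
    show "integrable P (\<lambda>\<omega>. Q\<^sub>w w (t - 1) \<omega> $ i * cylinder w t \<omega>)"
      using meas abs_mult_le_bound[OF Qw_le c1]
      by (intro integrable_AE_bounded borel_measurable_times) blast+
    show "integrable P (\<lambda>\<omega>. Q\<^sub>w w (t - 1) \<omega> $ i * ?h \<omega> * cylinder w t \<omega>)"
      using meas abs_mult_le_bound[OF abs_mult_le_bound[OF Qw_le case_sum_bounds[OF _ k(1)]] c1]
      by (intro integrable_AE_bounded borel_measurable_times) blast+
  qed
  have "(\<integral>\<omega>. Q (t - 1) \<omega> $ i * ?h \<omega> \<partial>P)
      = (\<integral>\<omega>. (\<Sum>w\<in>?W. Q\<^sub>w w (t - 1) \<omega> $ i * ?h \<omega> * cylinder w t \<omega>) \<partial>P)"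
    unfolding queue_eq_sum_words[OF t] by (simp add: sum_distrib_left mult_ac)
  also have "\<dots> = (\<Sum>w\<in>?W. \<integral>\<omega>. Q\<^sub>w w (t - 1) \<omega> $ i * ?h \<omega> * cylinder w t \<omega> \<partial>P)"
    by (intro Bochner_Integration.integral_sum int)
  also have "\<dots> = (\<Sum>w\<in>?W. (\<integral>\<omega>. Q\<^sub>w w (t - 1) \<omega> $ i * cylinder w t \<omega> \<partial>P) * (\<integral>\<omega>. ?h \<omega> \<partial>P))"
    by (intro sum.cong refl integral_cylinder_indep[OF t k Qw Qw_le])
  also have "\<dots> = (\<integral>\<omega>. (\<Sum>w\<in>?W. Q\<^sub>w w (t - 1) \<omega> $ i * cylinder w t \<omega>) \<partial>P) * (\<integral>\<omega>. ?h \<omega> \<partial>P)"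
    unfolding sum_distrib_right[symmetric]
    by (subst Bochner_Integration.integral_sum) (rule int, rule refl)
  also have "\<dots> = (\<integral>\<omega>. Q (t - 1) \<omega> $ i \<partial>P) * (\<integral>\<omega>. ?h \<omega> \<partial>P)"
    unfolding queue_eq_sum_words[OF t] ..
  finally show ?thesis .
qed

end

section \<open>Expected drift\<close>
context softmw_system begin

definition m :: "nat \<Rightarrow> 'k \<Rightarrow> real" where "m t i = (\<integral>\<omega>. Q t \<omega> $ i \<partial>P)"

lemma Q_nth_measurable: "(\<lambda>\<omega>. Q t \<omega> $ i) \<in> borel_measurable P"
  by (rule borel_measurable_nth[OF Q_measurable])

lemma integrable_Q: "integrable P (\<lambda>\<omega>. Q t \<omega> $ i)"
  by (rule integrable_AE_bounded[OF Q_nth_measurable, of _ _ "M * real t"])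
    (simp add: Q_nonneg Q_le)

lemma m_nonneg: "0 \<le> m t i"
  unfolding m_def by (rule integral_nonneg_AE) (use AE_good in eventually_elim, simp add: Q_nonneg)

lemma abs_m_diff: "\<bar>m (Suc t) i - m t i\<bar> \<le> M"
proof -
  have "m (Suc t) i - m t i = (\<integral>\<omega>. Q (Suc t) \<omega> $ i - Q t \<omega> $ i \<partial>P)"
    unfolding m_def by (simp add: integrable_Q)
  also have "\<bar>\<dots>\<bar> \<le> (\<integral>\<omega>. \<bar>Q (Suc t) \<omega> $ i - Q t \<omega> $ i\<bar> \<partial>P)"
    by (rule integral_abs_bound)
  also have "\<dots> \<le> (\<integral>\<omega>. M \<partial>P)"
  proof (rule integral_mono_AE)
    show "AE \<omega> in P. \<bar>Q (Suc t) \<omega> $ i - Q t \<omega> $ i\<bar> \<le> M"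
      using AE_good
    proof eventually_elim
      case (elim \<omega>)
      interpret path: sample_path M K "\<lambda>t. A t \<omega>" "\<lambda>t. S t \<omega>" "\<lambda>t. a t \<omega>"
        by (rule sample_path_good[OF elim])
      show ?case using path.queue_Suc_le[of t i] path.queue_Suc_ge[of t i]
        by (simp add: queue_process_def)
    qed
  qed (use integrable_Q in \<open>intro integrable_abs Bochner_Integration.integrable_diff | simp\<close>)+
  also have "\<dots> = M" by (simp add: prob_space)
  finally show ?thesis .
qed

lemma A_le: "good \<omega> \<Longrightarrow> t \<ge> 1 \<Longrightarrow> \<bar>A t \<omega> $ i\<bar> \<le> M"
  and S_le: "good \<omega> \<Longrightarrow> t \<ge> 1 \<Longrightarrow> \<bar>S t \<omega> $ i\<bar> \<le> M"
  by (auto simp: good_def)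

lemma mean_eq:
  fixes X :: "'w \<Rightarrow> real ^ 'k"
  assumes X: "X \<in> borel_measurable P" "\<And>\<omega> i. good \<omega> \<Longrightarrow> \<bar>X \<omega> $ i\<bar> \<le> M"
  shows "mean (distr P borel X) $ i = (\<integral>\<omega>. X \<omega> $ i \<partial>P)"
proof -
  have int: "integrable P X"
  proof (rule integrable_const_bound[of _ "K * M"])
    show "AE \<omega> in P. norm (X \<omega>) \<le> K * M"
      using AE_good
    proof eventually_elim
      case (elim \<omega>)
      have "norm (X \<omega>) \<le> (\<Sum>i\<in>UNIV. \<bar>X \<omega> $ i\<bar>)" by (rule norm_le_l1_cart)
      also have "\<dots> \<le> (\<Sum>i\<in>(UNIV :: 'k set). M)" using X(2)[OF elim] by (intro sum_mono)
      finally show ?case by (simp add: K_def)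
    qed
  qed (rule X(1))
  have "mean (distr P borel X) = (\<integral>\<omega>. X \<omega> \<partial>P)"
    unfolding mean_def using X(1) by (subst integral_distr) auto
  then show ?thesis using integral_vec_nth[OF int] by simp
qed

lemma mean_arrivals: "t \<ge> 1 \<Longrightarrow> mean (\<A> t) $ i = (\<integral>\<omega>. A t \<omega> $ i \<partial>P)"
  using mean_eq[OF A_measurable A_le, of t i] arrivals by (simp add: arrivals_services_def)

lemma mean_services: "t \<ge> 1 \<Longrightarrow> mean (\<S> t) $ i = (\<integral>\<omega>. S t \<omega> $ i \<partial>P)"
  using mean_eq[OF S_measurable S_le, of t i] arrivals by (simp add: arrivals_services_def)

lemma mean_bounds:
  assumes "t \<ge> 1"
  shows "0 \<le> mean (\<A> t) $ i" "mean (\<A> t) $ i \<le> M" "0 \<le> mean (\<S> t) $ i" "mean (\<S> t) $ i \<le> M"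
proof -
  have int: "integrable P (\<lambda>\<omega>. A t \<omega> $ i)" "integrable P (\<lambda>\<omega>. S t \<omega> $ i)"
    using assms A_le S_le
    by (auto intro!: integrable_AE_bounded borel_measurable_nth A_measurable S_measurable)
  have AE: "AE \<omega> in P. 0 \<le> A t \<omega> $ i" "AE \<omega> in P. A t \<omega> $ i \<le> M"
      "AE \<omega> in P. 0 \<le> S t \<omega> $ i" "AE \<omega> in P. S t \<omega> $ i \<le> M"
    using AE_good by (eventually_elim, use assms in \<open>auto simp: good_def\<close>)+
  have "(\<integral>\<omega>. A t \<omega> $ i \<partial>P) \<le> (\<integral>\<omega>. M \<partial>P)" "(\<integral>\<omega>. S t \<omega> $ i \<partial>P) \<le> (\<integral>\<omega>. M \<partial>P)"
    using integral_mono_AE[OF int(1) _ AE(2)] integral_mono_AE[OF int(2) _ AE(4)] by simp_all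
  then show "0 \<le> mean (\<A> t) $ i" "mean (\<A> t) $ i \<le> M" "0 \<le> mean (\<S> t) $ i" "mean (\<S> t) $ i \<le> M"
    using AE mean_arrivals[OF assms] mean_services[OF assms]
    by (auto intro!: integral_nonneg_AE simp: prob_space)
qed

lemma expectation_arrivals:
  assumes "t \<ge> 1"
  shows "(\<integral>\<omega>. Q (t - 1) \<omega> $ i * A t \<omega> $ i \<partial>P) = m (t - 1) i * mean (\<A> t) $ i"
proof -
  have "Inl t \<in> {1..} <+> {1..}" "Inl t \<notin> {1..<t} <+> {1..<t}" using assms by (auto simp: Plus_def)
  from expectation_queue_mult[OF assms this, of i i] show ?thesis
    unfolding m_def mean_arrivals[OF assms] by simp
qed

lemma expectation_services:
  assumes "t \<ge> 1"
  shows "(\<integral>\<omega>. Q (t - 1) \<omega> $ i * S t \<omega> $ i \<partial>P) = m (t - 1) i * mean (\<S> t) $ i"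
proof -
  have "Inr t \<in> {1..} <+> {1..}" "Inr t \<notin> {1..<t} <+> {1..<t}" using assms by (auto simp: Plus_def)
  from expectation_queue_mult[OF assms this, of i i] show ?thesis
    unfolding m_def mean_services[OF assms] by simp
qed

definition pay :: "nat \<Rightarrow> 'k \<Rightarrow> 'w \<Rightarrow> real" where
  "pay t i \<omega> = softmw_payoff M \<delta> \<theta> (\<lambda>s. Q s \<omega>) (\<lambda>s. S s \<omega>) (\<lambda>s. a s \<omega>) t i"

lemma pay_measurable:
  assumes t: "t \<ge> 1"
  shows "pay t i \<in> borel_measurable (F t)"
proof -
  note meas = A_measurable_info S_measurable_info a_measurable_info
  have [measurable]: "(\<lambda>\<omega>. Q (t - 1) \<omega> $ i) \<in> borel_measurable (F t)"
    using t by (intro borel_measurable_nth borel_measurable_queue_process[where n = t]) (auto intro: meas)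
  have [measurable]: "(\<lambda>\<omega>. S t \<omega> $ i) \<in> borel_measurable (F t)"
    using t by (intro borel_measurable_nth meas)
  have [measurable]: "(\<lambda>\<omega>. point_process M \<delta> A S a t \<omega> $ i) \<in> borel_measurable (F t)"
    using t by (intro borel_measurable_nth borel_measurable_point_process[where n = t]) (auto intro: meas)
  have [measurable]: "(\<lambda>\<omega>. p t \<omega> $ i) \<in> borel_measurable (F t)"
    using t by (intro borel_measurable_nth prob_process_measurable_info)
  have [measurable]: "eta_process M \<delta> A S a t \<in> borel_measurable (F t)"
    using t by (intro borel_measurable_eta_process[where n = t]) (auto intro: meas)
  show ?thesis
    unfolding pay_def[abs_def] softmw_payoff_def Let_def point_process_def[symmetric]
      prob_process_def[symmetric] eta_process_def[symmetric]
    by measurable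
qed

lemma abs_pay_le:
  assumes "good \<omega>" "t \<ge> 1"
  shows "\<bar>pay t i \<omega>\<bar> \<le> M\<^sup>2 * real t * (3 + 2 / (real t powr (-3) / K))"
proof -
  interpret path: regret_path M K "\<lambda>t. A t \<omega>" "\<lambda>t. S t \<omega>" "\<lambda>t. a t \<omega>" \<delta> \<theta> C\<^sub>V
    by (rule regret_path_good[OF assms(1)])
  show ?thesis
    using path.abs_payoff_le[OF assms(2), of i] by (simp add: pay_def queue_process_def path.\<beta>_def)
qed

text \<open>
  The regret bound with \<open>v\<close> replaced by its bound in terms of the total queue length, without the factor
  \<open>1 + X\<^sub>T / T\<close>.
\<close>
definition remainder :: "nat \<Rightarrow> real" where
  "remainder T = M * ((6 + 6 * C\<^sub>V) * ln (K * real T ^ 3) + 2 * (K + 2))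
     * sqrt (86 * M\<^sup>2 * K ^ 6 + sqrt (2 * K * M)) * real T powr (\<bar>1/4 - \<delta>/2\<bar> + 3/4)"

text \<open>
  The upper bound at the served queues and the lower bound for the averages in one inequality; the two
  payoff sums have the same expectation.
\<close>
lemma pathwise_bound:
  assumes g: "good \<omega>" and T: "T \<ge> 1"
  shows "(\<Sum>t=1..T. \<Sum>i\<in>UNIV. pay t i \<omega> * of_bool (a t \<omega> = i))
        + (\<Sum>t=1..T. \<Sum>i\<in>UNIV. \<theta> t $ i * (Q (t - 1) \<omega> $ i * S t \<omega> $ i))
      \<le> (\<Sum>t=1..T. \<Sum>i\<in>UNIV. pay t i \<omega> * p t \<omega> $ i)
        + (\<Sum>t=1..T. \<Sum>i\<in>UNIV. Q (t - 1) \<omega> $ i * A t \<omega> $ i)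
        + (K * M\<^sup>2 / 2 * real T + 2 * M\<^sup>2 + remainder T)
        + remainder T / real T * (\<Sum>t<T. \<Sum>i\<in>UNIV. Q t \<omega> $ i)"
proof -
  interpret path: regret_path M K "\<lambda>t. A t \<omega>" "\<lambda>t. S t \<omega>" "\<lambda>t. a t \<omega>" \<delta> \<theta> C\<^sub>V
    by (rule regret_path_good[OF g])
  have Q_eq: "queue (\<lambda>t. A t \<omega>) (\<lambda>t. S t \<omega>) (\<lambda>t. a t \<omega>) = (\<lambda>t. Q t \<omega>)"
    by (simp add: queue_process_def fun_eq_iff)
  have p_eq: "path.p t = p t \<omega>" for t by (simp add: path.p_def prob_process_def Q_eq)
  let ?V = "real T powr \<bar>path.\<alpha>\<bar> * path.v T"
  let ?c = "sqrt (86 * M\<^sup>2 * K ^ 6 + sqrt (2 * K * M))"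
  let ?X = "\<Sum>t<T. \<Sum>i\<in>UNIV. Q t \<omega> $ i"
  have T0: "0 < real T" using T by simp
  have L: "path.L T = ln (K * real T ^ 3)"
    using T by (simp add: path.L_def path.\<beta>_def powr_minus divide_inverse mult.commute)
  have "path.v T \<le> ?c * real T powr (3/4) * (1 + (\<Sum>s<T. l1norm (Q s \<omega>)) / real T)"
    using path.v_le[OF T] by (simp add: Q_eq)
  also have "(\<Sum>s<T. l1norm (Q s \<omega>)) = ?X"
    using path.l1norm_queue by (simp add: Q_eq)
  finally have "?V \<le> real T powr \<bar>path.\<alpha>\<bar> * (?c * real T powr (3/4) * (1 + ?X / real T))"
    by (intro mult_left_mono) auto
  also have "\<dots> = ?c * real T powr (\<bar>1/4 - \<delta>/2\<bar> + 3/4) * (1 + ?X / real T)"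
    by (simp add: powr_add path.\<alpha>_def)
  finally have V: "?V \<le> ?c * real T powr (\<bar>1/4 - \<delta>/2\<bar> + 3/4) * (1 + ?X / real T)" .
  let ?d = "M * ((6 + 6 * C\<^sub>V) * ln (K * real T ^ 3) + 2 * (K + 2))"
  have d: "0 \<le> ?d"
    using path.L_nonneg[OF T] path.C\<^sub>V_pos path.K_ge_1 M_pos unfolding L by simp
  have "?d * ?V \<le> ?d * (?c * real T powr (\<bar>1/4 - \<delta>/2\<bar> + 3/4) * (1 + ?X / real T))"
    by (rule mult_left_mono[OF V d])
  also have "\<dots> = remainder T + remainder T / real T * ?X"
    by (simp add: remainder_def algebra_simps)
  finally have dV: "?d * ?V \<le> remainder T + remainder T / real T * ?X" .
  have "(\<Sum>t=1..T. pay t (a t \<omega>) \<omega>) \<le> (\<Sum>t=1..T. Q (t - 1) \<omega> \<bullet> A t \<omega>) + K * M\<^sup>2 / 2 * real T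
      + (6 + 6 * C\<^sub>V) * M * path.L T * ?V"
    using path.payoff_action_le[OF T] by (simp add: pay_def Q_eq)
  moreover have "(\<Sum>i\<in>UNIV. pay t i \<omega> * of_bool (a t \<omega> = i)) = pay t (a t \<omega>) \<omega>" for t
    by (simp add: of_bool_def if_distrib cong: if_cong)
  moreover have "(\<Sum>t=1..T. \<Sum>i\<in>UNIV. \<theta> t $ i * (Q (t - 1) \<omega> $ i * S t \<omega> $ i)) - 2 * M\<^sup>2
      - 2 * (K + 2) * M * ?V \<le> (\<Sum>t=1..T. \<Sum>i\<in>UNIV. pay t i \<omega> * p t \<omega> $ i)"
    using path.sum_mean_payoff_ge[of T] by (simp add: pay_def Q_eq p_eq path.g_def mult_ac)
  moreover have "?d * ?V = (6 + 6 * C\<^sub>V) * M * path.L T * ?V + 2 * (K + 2) * M * ?V"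
    unfolding L by (simp add: algebra_simps)
  ultimately show ?thesis using dV by (simp add: inner_vec_def)
qed

lemma expected_drift:
  assumes T: "T \<ge> 1"
  shows "(\<Sum>t=1..T. \<Sum>i\<in>UNIV. m (t - 1) i * (\<theta> t $ i * mean (\<S> t) $ i - mean (\<A> t) $ i))
     \<le> K * M\<^sup>2 / 2 * real T + 2 * M\<^sup>2 + remainder T
        + remainder T / real T * (\<Sum>t<T. \<Sum>i\<in>UNIV. m t i)"
proof -
  have pay_int: "integrable P (\<lambda>\<omega>. pay t i \<omega> * of_bool (a t \<omega> = i))"
      "integrable P (\<lambda>\<omega>. pay t i \<omega> * p t \<omega> $ i)" if t: "t \<ge> 1" for t i
  proof -
    have pm: "pay t i \<in> borel_measurable P"
      by (rule measurable_from_subalg[OF subalgebra_info_before pay_measurable[OF t]])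
    have om: "(\<lambda>\<omega>. of_bool (a t \<omega> = i) :: real) \<in> borel_measurable P"
      using measurable_compose[OF a_measurable[OF t], of "\<lambda>j. of_bool (j = i)" borel] by simp
    have prm: "(\<lambda>\<omega>. p t \<omega> $ i) \<in> borel_measurable P"
      by (rule borel_measurable_nth[OF measurable_from_subalg[OF subalgebra_info_before
            prob_process_measurable_info[OF t]]])
    show "integrable P (\<lambda>\<omega>. pay t i \<omega> * of_bool (a t \<omega> = i))"
    proof (rule integrable_AE_bounded[OF borel_measurable_times[OF pm om]])
      show "\<bar>pay t i \<omega> * of_bool (a t \<omega> = i)\<bar> \<le> M\<^sup>2 * real t * (3 + 2 / (real t powr (-3) / K)) * 1"
        if "good \<omega>" for \<omega>
        by (intro abs_mult_le_bound abs_pay_le[OF that t]) auto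
    qed
    show "integrable P (\<lambda>\<omega>. pay t i \<omega> * p t \<omega> $ i)"
    proof (rule integrable_AE_bounded[OF borel_measurable_times[OF pm prm]])
      show "\<bar>pay t i \<omega> * p t \<omega> $ i\<bar> \<le> M\<^sup>2 * real t * (3 + 2 / (real t powr (-3) / K)) * 1" if "good \<omega>" for \<omega>
        using prob_process_bounds[OF that t, of a i] by (intro abs_mult_le_bound abs_pay_le[OF that t]) auto
    qed
  qed
  have QX_int: "integrable P (\<lambda>\<omega>. Q (t - 1) \<omega> $ i * X \<omega> $ i)"
    if X: "X \<in> borel_measurable P" "\<And>\<omega>. good \<omega> \<Longrightarrow> \<bar>X \<omega> $ i\<bar> \<le> M" for X :: "'w \<Rightarrow> real ^ 'k" and t i
  proof (rule integrable_AE_bounded[OF borel_measurable_times[OF Q_nth_measurable borel_measurable_nth[OF X(1)]]])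
    show "\<bar>Q (t - 1) \<omega> $ i * X \<omega> $ i\<bar> \<le> M * real (t - 1) * M" if "good \<omega>" for \<omega>
      using Q_nonneg[OF that] Q_le[OF that] by (intro abs_mult_le_bound X(2)[OF that]) simp
  qed
  note QA_int = QX_int[OF A_measurable A_le] and QS_int = QX_int[OF S_measurable S_le]
  let ?\<Phi> = "\<lambda>\<omega>. \<Sum>t=1..T. \<Sum>i\<in>UNIV. pay t i \<omega> * of_bool (a t \<omega> = i)"
  let ?\<Psi> = "\<lambda>\<omega>. \<Sum>t=1..T. \<Sum>i\<in>UNIV. pay t i \<omega> * p t \<omega> $ i"
  let ?\<Theta> = "\<lambda>\<omega>. \<Sum>t=1..T. \<Sum>i\<in>UNIV. \<theta> t $ i * (Q (t - 1) \<omega> $ i * S t \<omega> $ i)"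
  let ?A = "\<lambda>\<omega>. \<Sum>t=1..T. \<Sum>i\<in>UNIV. Q (t - 1) \<omega> $ i * A t \<omega> $ i"
  let ?X = "\<lambda>\<omega>. \<Sum>t<T. \<Sum>i\<in>UNIV. Q t \<omega> $ i"
  let ?c = "K * M\<^sup>2 / 2 * real T + 2 * M\<^sup>2 + remainder T" and ?r = "remainder T / real T"
  have int: "integrable P ?\<Phi>" "integrable P ?\<Psi>" "integrable P ?\<Theta>" "integrable P ?A" "integrable P ?X"
    by (intro Bochner_Integration.integrable_sum integrable_mult_right pay_int QA_int QS_int integrable_Q; simp)+
  have "(\<integral>\<omega>. ?\<Phi> \<omega> + ?\<Theta> \<omega> \<partial>P) \<le> (\<integral>\<omega>. ?\<Psi> \<omega> + ?A \<omega> + ?c + ?r * ?X \<omega> \<partial>P)"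
  proof (rule integral_mono_AE)
    show "AE \<omega> in P. ?\<Phi> \<omega> + ?\<Theta> \<omega> \<le> ?\<Psi> \<omega> + ?A \<omega> + ?c + ?r * ?X \<omega>"
      using AE_good by eventually_elim (rule pathwise_bound[OF _ T])
  qed (intro Bochner_Integration.integrable_add integrable_mult_right int integrable_const)+
  also have "(\<integral>\<omega>. ?\<Phi> \<omega> + ?\<Theta> \<omega> \<partial>P) = (\<integral>\<omega>. ?\<Phi> \<omega> \<partial>P) + (\<integral>\<omega>. ?\<Theta> \<omega> \<partial>P)"
    by (rule Bochner_Integration.integral_add[OF int(1,3)])
  also have "(\<integral>\<omega>. ?\<Psi> \<omega> + ?A \<omega> + ?c + ?r * ?X \<omega> \<partial>P)
      = (\<integral>\<omega>. ?\<Psi> \<omega> \<partial>P) + (\<integral>\<omega>. ?A \<omega> \<partial>P) + ?c + ?r * (\<integral>\<omega>. ?X \<omega> \<partial>P)"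
    using int by (simp add: prob_space Bochner_Integration.integral_add Bochner_Integration.integrable_add
        del: Bochner_Integration.integral_sum)
  also have "(\<integral>\<omega>. ?\<Phi> \<omega> \<partial>P) = (\<integral>\<omega>. ?\<Psi> \<omega> \<partial>P)"
  proof -
    have "(\<integral>\<omega>. ?\<Phi> \<omega> \<partial>P) = (\<Sum>t=1..T. \<Sum>i\<in>UNIV. \<integral>\<omega>. pay t i \<omega> * of_bool (a t \<omega> = i) \<partial>P)"
      by (subst Bochner_Integration.integral_sum, (intro Bochner_Integration.integrable_sum pay_int; simp),
          intro sum.cong refl Bochner_Integration.integral_sum pay_int) simp
    also have "\<dots> = (\<Sum>t=1..T. \<Sum>i\<in>UNIV. \<integral>\<omega>. pay t i \<omega> * p t \<omega> $ i \<partial>P)"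
      by (rule sum.cong[OF refl], rule sum.cong[OF refl], rule integral_action[OF _ pay_measurable abs_pay_le])
        auto
    also have "\<dots> = (\<integral>\<omega>. ?\<Psi> \<omega> \<partial>P)"
      by (subst Bochner_Integration.integral_sum, (intro Bochner_Integration.integrable_sum pay_int; simp),
          intro sum.cong refl Bochner_Integration.integral_sum[symmetric] pay_int) simp
    finally show ?thesis .
  qed
  also have "(\<integral>\<omega>. ?\<Theta> \<omega> \<partial>P) = (\<Sum>t=1..T. \<Sum>i\<in>UNIV. m (t - 1) i * (\<theta> t $ i * mean (\<S> t) $ i))"
  proof -
    have "(\<integral>\<omega>. ?\<Theta> \<omega> \<partial>P) = (\<Sum>t=1..T. \<Sum>i\<in>UNIV. \<integral>\<omega>. \<theta> t $ i * (Q (t - 1) \<omega> $ i * S t \<omega> $ i) \<partial>P)"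
      by (subst Bochner_Integration.integral_sum, (intro Bochner_Integration.integrable_sum integrable_mult_right QS_int; simp),
          intro sum.cong refl Bochner_Integration.integral_sum integrable_mult_right QS_int) simp_all
    also have "\<dots> = (\<Sum>t=1..T. \<Sum>i\<in>UNIV. m (t - 1) i * (\<theta> t $ i * mean (\<S> t) $ i))"
      by (intro sum.cong refl) (simp add: expectation_services[simplified])
    finally show ?thesis .
  qed
  also have "(\<integral>\<omega>. ?A \<omega> \<partial>P) = (\<Sum>t=1..T. \<Sum>i\<in>UNIV. m (t - 1) i * mean (\<A> t) $ i)"
  proof -
    have "(\<integral>\<omega>. ?A \<omega> \<partial>P) = (\<Sum>t=1..T. \<Sum>i\<in>UNIV. \<integral>\<omega>. Q (t - 1) \<omega> $ i * A t \<omega> $ i \<partial>P)"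
      by (subst Bochner_Integration.integral_sum, (intro Bochner_Integration.integrable_sum QA_int; simp),
          intro sum.cong refl Bochner_Integration.integral_sum QA_int) simp_all
    also have "\<dots> = (\<Sum>t=1..T. \<Sum>i\<in>UNIV. m (t - 1) i * mean (\<A> t) $ i)"
      by (intro sum.cong refl) (simp add: expectation_arrivals[simplified])
    finally show ?thesis .
  qed
  also have "(\<integral>\<omega>. ?X \<omega> \<partial>P) = (\<Sum>t<T. \<Sum>i\<in>UNIV. m t i)"
    unfolding m_def by (simp add: Bochner_Integration.integral_sum Bochner_Integration.integrable_sum integrable_Q)
  finally show ?thesis by (simp add: right_diff_distrib sum_subtractf)
qed

end

section \<open>From drift to stability\<close>

text \<open>
  The stabilizability condition only speaks about whole intervals, so the time horizon is extended to
  the end of the interval that contains it.  The intervals need not be numbered in temporal order.  Cutting at the end of the interval that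
  contains \<open>T\<close> gives a prefix that is a union of whole intervals, since by disjointness no interval that
  starts before the cut reaches beyond it.
\<close>
lemma interval_partition_prefix:
  assumes W: "interval_partition W" and T: "T \<ge> 1"
  obtains n where "n \<ge> T" "finite {i. Min (W i) < n + 1}" "{1..n} = (\<Union>i\<in>{i. Min (W i) < n + 1}. W i)"
    "\<exists>i. Min (W i) \<le> T \<and> real n \<le> real T + (real (card (W i)) - 1)"
proof -
  from W obtain l r where lr: "\<And>i. l i \<le> r i \<and> W i = {l i..r i}"
    unfolding interval_partition_def by metis
  have disj: "W i \<inter> W j = {}" if "i \<noteq> j" for i j
    using W that by (auto simp: interval_partition_def disjoint_family_on_def)
  have cover: "(\<Union>i. W i) = {1..}" using W by (simp add: interval_partition_def)
  have Min: "Min (W i) = l i" for i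
  proof -
    have "Min {l i..r i} = l i" using lr[of i] by (intro Min_eqI) simp_all
    then show ?thesis using conjunct2[OF lr[of i]] by simp
  qed
  from cover T obtain j where j: "T \<in> W j" by blast
  define n where "n = r j"
  have nj: "l j \<le> T" "T \<le> n" using j lr[of j] by (auto simp: n_def)
  have r_le: "r i \<le> n" if "l i \<le> n" for i
  proof (rule ccontr)
    assume "\<not> r i \<le> n"
    then have "n \<in> W i" using that lr[of i] by auto
    moreover have "n \<in> W j" using lr[of j] by (simp add: n_def)
    ultimately have "i = j" using disj by blast
    then show False using \<open>\<not> r i \<le> n\<close> by (simp add: n_def)
  qed
  have inj: "inj l"
  proof (rule injI)
    fix i i' assume "l i = l i'"
    then have "l i \<in> W i \<inter> W i'" using lr[of i] lr[of i'] by auto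
    then show "i = i'" using disj by blast
  qed
  have I: "{i. Min (W i) < n + 1} = {i. l i \<le> n}" unfolding Min by (rule Collect_cong) linarith
  show ?thesis
  proof (rule that)
    show "T \<le> n" by (rule nj)
    have "finite (l -` {..n})" using inj by (intro finite_vimageI) simp_all
    then show "finite {i. Min (W i) < n + 1}" unfolding I vimage_def by simp
    show "{1..n} = (\<Union>i\<in>{i. Min (W i) < n + 1}. W i)"
      unfolding I
    proof (intro equalityI subsetI)
      fix t assume t: "t \<in> {1..n}"
      then have "t \<in> (\<Union>i. W i)" unfolding cover by simp
      then obtain i where i: "t \<in> W i" by blast
      then have "t \<in> {l i..r i}" using lr by blast
      then have "l i \<le> n" using t by simp
      then show "t \<in> (\<Union>i\<in>{i. l i \<le> n}. W i)" using i by blast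
    next
      fix t assume "t \<in> (\<Union>i\<in>{i. l i \<le> n}. W i)"
      then obtain i where i: "l i \<le> n" "t \<in> W i" by blast
      then have "t \<in> {l i..r i}" using lr by blast
      then have "t \<le> n" using r_le[OF i(1)] by simp
      moreover have "t \<in> {1..}" using cover i(2) by blast
      ultimately show "t \<in> {1..n}" by simp
    qed
    have "card (W j) = n + 1 - l j" using lr[of j] by (simp add: n_def)
    then have "real n \<le> real T + (real (card (W j)) - 1)" using nj by auto
    then show "\<exists>i. Min (W i) \<le> T \<and> real n \<le> real T + (real (card (W i)) - 1)"
      using nj Min by auto
  qed
qed

text \<open>
  Replacing \<open>f (t - 1)\<close> by its value at the beginning of the interval costs \<open>M\<close> per elapsed slot.  The first
  slot costs nothing, so at most \<open>card W - 1\<close> slots pay at most \<open>card W - 1\<close> times \<open>M B\<close> each.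
\<close>
lemma drift_on_interval:
  fixes f c :: "nat \<Rightarrow> real"
  assumes W: "W = {l..r}" "1 \<le> l" "l \<le> r"
    and f: "\<And>t. 0 \<le> f t" "\<And>t. \<bar>f (Suc t) - f t\<bar> \<le> M"
    and c: "\<And>t. t \<in> W \<Longrightarrow> \<bar>c t - \<epsilon>\<bar> \<le> B"
    and avg: "\<epsilon> * real (card W) \<le> (\<Sum>t\<in>W. c t)"
  shows "\<epsilon> * (\<Sum>t\<in>W. f (t - 1)) - M * B * (real (card W) - 1)\<^sup>2 \<le> (\<Sum>t\<in>W. f (t - 1) * c t)"
proof -
  have M: "0 \<le> M" using f(2)[of 0] by linarith
  have B: "0 \<le> B" using c[of l] W by auto
  have lip: "\<bar>f (k + d) - f k\<bar> \<le> M * real d" for k d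
  proof (induction d)
    case (Suc d)
    then show ?case using f(2)[of "k + d"] by (simp add: algebra_simps)
  qed simp
  have card: "real (card W) - 1 = real (r - l)" using W by simp
  have "- (M * B * (real (card W) - 1)\<^sup>2) \<le> (\<Sum>t\<in>W. (f (t - 1) - f (l - 1)) * (c t - \<epsilon>))"
  proof -
    have "(\<Sum>t\<in>W. (f (t - 1) - f (l - 1)) * (c t - \<epsilon>)) = (\<Sum>t\<in>{l<..r}. (f (t - 1) - f (l - 1)) * (c t - \<epsilon>))"
      unfolding W(1) using W(3) by (intro sum.mono_neutral_right) auto
    also have "\<dots> \<ge> (\<Sum>t\<in>{l<..r}. - (M * B * real (r - l)))"
    proof (rule sum_mono)
      fix t assume t: "t \<in> {l<..r}"
      have "\<bar>f (t - 1) - f (l - 1)\<bar> \<le> M * real (t - l)"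
        using lip[of "l - 1" "t - l"] t W(2) by simp
      also have "\<dots> \<le> M * real (r - l)" using t M by (intro mult_left_mono) auto
      finally have "\<bar>f (t - 1) - f (l - 1)\<bar> * \<bar>c t - \<epsilon>\<bar> \<le> M * real (r - l) * B"
        using c[of t] t W(1) by (intro mult_mono) auto
      then show "- (M * B * real (r - l)) \<le> (f (t - 1) - f (l - 1)) * (c t - \<epsilon>)"
        unfolding abs_mult[symmetric] by (simp add: mult_ac abs_le_iff)
    qed
    finally show ?thesis unfolding card by (simp add: power2_eq_square of_nat_diff[OF W(3)] mult_ac)
  qed
  moreover have "(\<Sum>t\<in>W. (f (t - 1) - f (l - 1)) * (c t - \<epsilon>))
     = (\<Sum>t\<in>W. f (t - 1) * c t) - \<epsilon> * (\<Sum>t\<in>W. f (t - 1)) - f (l - 1) * ((\<Sum>t\<in>W. c t) - \<epsilon> * real (card W))"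
    by (simp add: algebra_simps sum.distrib sum_subtractf sum_distrib_left sum_distrib_right)
  moreover have "0 \<le> f (l - 1) * ((\<Sum>t\<in>W. c t) - \<epsilon> * real (card W))"
    using avg f(1) by simp
  ultimately show ?thesis by linarith
qed

context softmw_system begin

text \<open>
  The exponent \<open>|1/4 - \<delta>/2| + 3/4\<close> is below 1 since \<open>0 < \<delta> < 1\<close>, and this gap beats the logarithm.
\<close>
lemma remainder_sublinear: "(\<lambda>T. remainder T / real T) \<longlonglongrightarrow> 0"
proof -
  define s where "s = 1/4 - \<bar>1/4 - \<delta>/2\<bar>"
  have "0 < \<delta>" using stationary by (simp add: reference_stationary_def)
  then have s: "0 < s" using \<delta>_less by (auto simp: s_def abs_if)
  have K: "1 \<le> K" by (simp add: K_def Suc_leI)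
  define c where "c = sqrt (86 * M\<^sup>2 * K ^ 6 + sqrt (2 * K * M))"
  have "(\<lambda>T. M * ((6 + 6 * C\<^sub>V) * (ln K * (1 / real T powr s) + 3 * (ln (real T) / real T powr s))
      + 2 * (K + 2) * (1 / real T powr s)) * c) \<longlonglongrightarrow> M * ((6 + 6 * C\<^sub>V) * (ln K * 0 + 3 * 0) + 2 * (K + 2) * 0) * c"
  proof (intro tendsto_intros lim_ln_over_power[OF s])
    have "(\<lambda>T. real T powr (- s)) \<longlonglongrightarrow> 0"
      using s by (intro tendsto_neg_powr filterlim_real_sequentially) auto
    then show "(\<lambda>T. 1 / real T powr s) \<longlonglongrightarrow> 0" by (simp add: powr_minus divide_inverse)
    then show "(\<lambda>T. 1 / real T powr s) \<longlonglongrightarrow> 0" .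
  qed
  moreover have "\<forall>\<^sub>F T in sequentially. M * ((6 + 6 * C\<^sub>V) * (ln K * (1 / real T powr s)
      + 3 * (ln (real T) / real T powr s)) + 2 * (K + 2) * (1 / real T powr s)) * c = remainder T / real T"
    using eventually_ge_at_top[of 1]
  proof eventually_elim
    case (elim T)
    then have T: "0 < real T" by simp
    have "ln (K * real T ^ 3) = ln K + 3 * ln (real T)"
      using T K by (simp add: ln_mult ln_realpow)
    moreover have "real T powr (\<bar>1/4 - \<delta>/2\<bar> + 3/4) / real T = 1 / real T powr s"
    proof -
      have exponent: "\<bar>1/4 - \<delta>/2\<bar> + 3/4 - 1 = - s" by (simp add: s_def)
      have "real T powr (\<bar>1/4 - \<delta>/2\<bar> + 3/4) / real T = real T powr (\<bar>1/4 - \<delta>/2\<bar> + 3/4 - 1)"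
        using T powr_diff[of "real T" "\<bar>1/4 - \<delta>/2\<bar> + 3/4" 1] by (simp only: powr_one)
      then show ?thesis unfolding exponent powr_minus by (simp only: divide_inverse mult_1)
    qed
    moreover have "remainder T / real T
        = M * ((6 + 6 * C\<^sub>V) * ln (K * real T ^ 3) + 2 * (K + 2)) * c
          * (real T powr (\<bar>1/4 - \<delta>/2\<bar> + 3/4) / real T)"
      unfolding remainder_def c_def by (rule times_divide_eq_right[symmetric])
    ultimately have "remainder T / real T
        = M * ((6 + 6 * C\<^sub>V) * (ln K + 3 * ln (real T)) + 2 * (K + 2)) * c * (1 / real T powr s)"
      by (simp only:)
    then show ?case by (simp only: divide_inverse) (simp add: algebra_simps)
  qed
  ultimately show ?thesis by (simp add: tendsto_cong)
qed

definition total :: "nat \<Rightarrow> real" where "total n = (\<Sum>t<n. \<Sum>i\<in>UNIV. m t i)"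

lemma total_mono: "n \<le> n' \<Longrightarrow> total n \<le> total n'"
  unfolding total_def by (intro sum_mono2) (auto intro!: sum_nonneg m_nonneg)

lemma total_shift: "(\<Sum>t=1..n. \<Sum>i\<in>UNIV. m (t - 1) i) = total n"
  unfolding total_def by (rule sum.reindex_bij_witness[of _ Suc "\<lambda>t. t - 1"]) auto

lemma total_bound_at_block_end:
  assumes T: "T \<ge> 1"
  shows "\<exists>n\<ge>T. real n \<le> real T + sqrt (C\<^sub>W * (real T + 1)) \<and>
    \<epsilon> * total n \<le> (K * M\<^sup>2 / 2 * real n + 2 * M\<^sup>2 + remainder n + remainder n / real n * total n)
      + K * M * (M + \<epsilon>) * (C\<^sub>W * (real n + 1))"
proof -
  have C: "0 \<le> C\<^sub>W" "0 < \<epsilon>" and \<theta>: "\<And>t. t \<ge> 1 \<Longrightarrow> \<theta> t \<in> prob_simplex"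
    using stabilizable by (auto simp: piecewise_stabilizable_def)
  obtain W where W: "interval_partition W"
    and var: "\<And>T. T \<ge> 1 \<Longrightarrow> (\<Sum>i | Min (W i) < T. (real (card (W i)) - 1)\<^sup>2) \<le> C\<^sub>W * real T"
    and avg: "\<And>i j. (1 / real (card (W i))) * (\<Sum>t\<in>W i. \<theta> t $ j * mean (\<S> t) $ j) \<ge>
        \<epsilon> + (1 / real (card (W i))) * (\<Sum>t\<in>W i. mean (\<A> t) $ j)"
    using stabilizable unfolding piecewise_stabilizable_def by blast
  from interval_partition_prefix[OF W T] obtain n j where n: "n \<ge> T"
    and fin: "finite {i. Min (W i) < n + 1}"
    and un: "{1..n} = (\<Union>i\<in>{i. Min (W i) < n + 1}. W i)"
    and j: "Min (W j) \<le> T" "real n \<le> real T + (real (card (W j)) - 1)" by metis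
  let ?I = "{i. Min (W i) < n + 1}"
  have finT: "finite {i. Min (W i) < T + 1}"
    by (rule finite_subset[OF _ fin]) (use n in auto)
  have "(real (card (W j)) - 1)\<^sup>2 \<le> (\<Sum>i | Min (W i) < T + 1. (real (card (W i)) - 1)\<^sup>2)"
    using j(1) by (intro member_le_sum finT) auto
  also have "\<dots> \<le> C\<^sub>W * (real T + 1)" using var[of "T + 1"] by (simp add: add.commute)
  finally have "real (card (W j)) - 1 \<le> sqrt (C\<^sub>W * (real T + 1))" by (rule real_le_rsqrt)
  then have n_le: "real n \<le> real T + sqrt (C\<^sub>W * (real T + 1))" using j(2) by linarith
  let ?c = "\<lambda>i t. \<theta> t $ i * mean (\<S> t) $ i - mean (\<A> t) $ i"
  have block: "\<epsilon> * (\<Sum>t\<in>W k. m (t - 1) i) - M * (M + \<epsilon>) * (real (card (W k)) - 1)\<^sup>2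
      \<le> (\<Sum>t\<in>W k. m (t - 1) i * ?c i t)" for k i
  proof -
    from W obtain l r where lr: "l \<le> r" "W k = {l..r}" unfolding interval_partition_def by metis
    have W1: "W k \<subseteq> {1..}" using W unfolding interval_partition_def by blast
    then have l: "1 \<le> l" using lr by auto
    show ?thesis
    proof (rule drift_on_interval[OF lr(2) l lr(1)])
      fix t assume "t \<in> W k"
      then have t: "t \<ge> 1" using W1 by auto
      have th: "0 \<le> \<theta> t $ i" "\<theta> t $ i \<le> 1"
        using \<theta>[OF t] prob_simplex_le_1[OF \<theta>[OF t]] by (auto simp: prob_simplex_def)
      have "\<theta> t $ i * mean (\<S> t) $ i \<le> 1 * M"
        using th mean_bounds[OF t] by (intro mult_mono) auto
      moreover have "0 \<le> \<theta> t $ i * mean (\<S> t) $ i" using th mean_bounds[OF t] by simp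
      ultimately show "\<bar>?c i t - \<epsilon>\<bar> \<le> M + \<epsilon>"
        using mean_bounds[OF t, of i] C(2) by (auto simp: abs_le_iff)
    next
      have card: "0 < real (card (W k))" using lr by simp
      have "\<epsilon> \<le> (1 / real (card (W k))) * ((\<Sum>t\<in>W k. \<theta> t $ i * mean (\<S> t) $ i) - (\<Sum>t\<in>W k. mean (\<A> t) $ i))"
        using avg[of k i] by (simp add: right_diff_distrib)
      then show "\<epsilon> * real (card (W k)) \<le> (\<Sum>t\<in>W k. ?c i t)"
        using card by (simp add: sum_subtractf field_simps)
    qed (rule m_nonneg abs_m_diff)+
  qed
  have split: "(\<Sum>t=1..n. f t) = (\<Sum>k\<in>?I. \<Sum>t\<in>W k. f t)" for f :: "nat \<Rightarrow> real"
    unfolding un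
  proof (rule sum.UNION_disjoint[OF fin])
    show "\<forall>i\<in>?I. finite (W i)"
    proof
      fix i
      obtain l r where "W i = {l..r}" using W unfolding interval_partition_def by metis
      then show "finite (W i)" by simp
    qed
    show "\<forall>i\<in>?I. \<forall>j\<in>?I. i \<noteq> j \<longrightarrow> W i \<inter> W j = {}"
      using W by (auto simp: interval_partition_def disjoint_family_on_def)
  qed
  have "\<epsilon> * total n = (\<Sum>t=1..n. \<Sum>i\<in>UNIV. \<epsilon> * m (t - 1) i)"
    unfolding total_shift[symmetric] by (simp add: sum_distrib_left)
  also have "\<dots> = (\<Sum>k\<in>?I. \<Sum>i\<in>UNIV. \<epsilon> * (\<Sum>t\<in>W k. m (t - 1) i))"
    unfolding split sum_distrib_left by (intro sum.cong refl sum.swap)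
  also have "\<dots> \<le> (\<Sum>k\<in>?I. \<Sum>i\<in>UNIV. (\<Sum>t\<in>W k. m (t - 1) i * ?c i t)
      + M * (M + \<epsilon>) * (real (card (W k)) - 1)\<^sup>2)"
    using block by (intro sum_mono) (simp add: algebra_simps)
  also have "\<dots> = (\<Sum>k\<in>?I. \<Sum>i\<in>UNIV. \<Sum>t\<in>W k. m (t - 1) i * ?c i t)
      + K * M * (M + \<epsilon>) * (\<Sum>k\<in>?I. (real (card (W k)) - 1)\<^sup>2)"
    by (simp add: sum.distrib sum_distrib_left K_def mult_ac)
  also have "(\<Sum>k\<in>?I. \<Sum>i\<in>UNIV. \<Sum>t\<in>W k. m (t - 1) i * ?c i t)
      = (\<Sum>t=1..n. \<Sum>i\<in>UNIV. m (t - 1) i * ?c i t)"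
    unfolding split by (intro sum.cong refl sum.swap)
  also have "\<dots> \<le> K * M\<^sup>2 / 2 * real n + 2 * M\<^sup>2 + remainder n + remainder n / real n * total n"
    using expected_drift[of n] T n by (simp add: total_def)
  also have "K * M * (M + \<epsilon>) * (\<Sum>k\<in>?I. (real (card (W k)) - 1)\<^sup>2) \<le> K * M * (M + \<epsilon>) * (C\<^sub>W * (real n + 1))"
    using var[of "n + 1"] M_pos C by (intro mult_left_mono) (auto simp: K_def add.commute)
  finally show "\<exists>n\<ge>T. real n \<le> real T + sqrt (C\<^sub>W * (real T + 1)) \<and>
    \<epsilon> * total n \<le> (K * M\<^sup>2 / 2 * real n + 2 * M\<^sup>2 + remainder n + remainder n / real n * total n)
    + K * M * (M + \<epsilon>) * (C\<^sub>W * (real n + 1))"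
    using n n_le by auto
qed

text \<open>
  For large \<open>T\<close> half of \<open>\<epsilon>\<close> suffices to absorb the term of the remainder that multiplies the total queue
  length, and extending the horizon to the end of an interval lengthens it by a factor of at most
  \<open>3/2\<close>.  Together they inflate the leading constant by a factor 3, which is less than the available 4.
\<close>
lemma eventually_average_le:
  "\<forall>\<^sub>F T in sequentially.
     (1 / real T) * total (T + 1) \<le> (2 * (K + 1) * M\<^sup>2 + 4 * C\<^sub>W * (K * M\<^sup>2 + \<epsilon> * K * M)) / \<epsilon>"
proof -
  have C: "0 \<le> C\<^sub>W" "0 < \<epsilon>" using stabilizable by (auto simp: piecewise_stabilizable_def)
  have K: "1 \<le> K" by (simp add: K_def Suc_leI)
  define D where "D = K * M * (M + \<epsilon>) * C\<^sub>W"
  have D: "0 \<le> D" using K M_pos C by (simp add: D_def)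
  have "0 < min (\<epsilon> / 2) (M\<^sup>2 / 3)" using C M_pos by simp
  then have "\<forall>\<^sub>F n in sequentially. remainder n / real n < min (\<epsilon> / 2) (M\<^sup>2 / 3)"
    using order_tendstoD(2)[OF remainder_sublinear] by blast
  then obtain N where N: "\<And>n. n \<ge> N \<Longrightarrow> remainder n / real n < min (\<epsilon> / 2) (M\<^sup>2 / 3)"
    unfolding eventually_sequentially by blast
  obtain N' where N': "32 * C\<^sub>W \<le> real N'" using real_arch_simple by blast
  show ?thesis
    using eventually_ge_at_top[of N'] eventually_ge_at_top[of N] eventually_ge_at_top[of 4]
  proof eventually_elim
    case (elim T)
    have T: "4 \<le> real T" using elim by simp
    obtain n where n: "n \<ge> T + 1" "real n \<le> real (T + 1) + sqrt (C\<^sub>W * (real (T + 1) + 1))"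
      and tot: "\<epsilon> * total n \<le> (K * M\<^sup>2 / 2 * real n + 2 * M\<^sup>2 + remainder n + remainder n / real n * total n)
        + K * M * (M + \<epsilon>) * (C\<^sub>W * (real n + 1))"
      using total_bound_at_block_end[of "T + 1"] by auto
    have n32: "real n \<le> 3 / 2 * real T"
    proof -
      have "C\<^sub>W * (real (T + 1) + 1) \<le> C\<^sub>W * (2 * real T)" using T C by (intro mult_left_mono) auto
      also have "\<dots> = (32 * C\<^sub>W) * (real T / 16)" by simp
      also have "\<dots> \<le> real T * (real T / 16)" using N' elim(1) T by (intro mult_right_mono) linarith+
      also have "\<dots> = (real T / 4)\<^sup>2" by (simp add: power2_eq_square)
      finally have "sqrt (C\<^sub>W * (real (T + 1) + 1)) \<le> real T / 4" using T by (intro real_le_lsqrt) simp_all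
      then show ?thesis using n(2) T by simp
    qed
    define \<rho> where "\<rho> = remainder n / real n"
    have \<rho>: "\<rho> \<le> \<epsilon> / 2" "\<rho> \<le> M\<^sup>2 / 3" and rem: "remainder n = \<rho> * real n"
      using N[of n] n elim T by (auto simp: \<rho>_def)
    have tn: "0 \<le> total n" unfolding total_def by (intro sum_nonneg m_nonneg)
    have "\<rho> * total n \<le> \<epsilon> / 2 * total n" using \<rho> tn by (intro mult_right_mono) auto
    moreover have "\<rho> * real n \<le> M\<^sup>2 / 3 * real n" using \<rho> by (intro mult_right_mono) auto
    moreover have "\<epsilon> * total n
        \<le> K * M\<^sup>2 / 2 * real n + 2 * M\<^sup>2 + remainder n + \<rho> * total n + D * (real n + 1)"
      using tot unfolding \<rho>_def D_def by (simp only: mult.assoc)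
    ultimately have "\<epsilon> * total n
        \<le> K * M\<^sup>2 / 2 * real n + 2 * M\<^sup>2 + M\<^sup>2 / 3 * real n + \<epsilon> / 2 * total n + D * (real n + 1)"
      unfolding rem by linarith
    then have "\<epsilon> / 2 * total n \<le> (K * M\<^sup>2 / 2 + M\<^sup>2 / 3 + D) * real n + (2 * M\<^sup>2 + D)"
      by (simp add: algebra_simps)
    also have "\<dots> \<le> (K * M\<^sup>2 / 2 + M\<^sup>2 / 3 + D) * (3 / 2 * real T) + (2 * M\<^sup>2 + D) * (real T / 4)"
    proof (intro add_mono mult_left_mono n32)
      show "2 * M\<^sup>2 + D \<le> (2 * M\<^sup>2 + D) * (real T / 4)"
        using T D mult_left_mono[of 1 "real T / 4" "2 * M\<^sup>2 + D"] by simp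
    qed (use K D in auto)
    also have "\<dots> = (3 / 4 * (K * M\<^sup>2) + M\<^sup>2 + 7 / 4 * D) * real T" by (simp add: algebra_simps)
    also have "\<dots> \<le> (K * M\<^sup>2 + M\<^sup>2 + 2 * D) * real T"
    proof (rule mult_right_mono)
      have "0 \<le> K * M\<^sup>2" using K by simp
      then show "3 / 4 * (K * M\<^sup>2) + M\<^sup>2 + 7 / 4 * D \<le> K * M\<^sup>2 + M\<^sup>2 + 2 * D" using D by linarith
    qed simp
    finally have "\<epsilon> * total n \<le> (2 * (K + 1) * M\<^sup>2 + 4 * D) * real T"
      by (simp add: algebra_simps)
    moreover have "\<epsilon> * total (T + 1) \<le> \<epsilon> * total n" using total_mono[OF n(1)] C by simp
    moreover have "4 * D = 4 * C\<^sub>W * (K * M\<^sup>2 + \<epsilon> * K * M)"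
      by (simp add: D_def algebra_simps power2_eq_square)
    ultimately have "\<epsilon> * total (T + 1)
        \<le> (2 * (K + 1) * M\<^sup>2 + 4 * C\<^sub>W * (K * M\<^sup>2 + \<epsilon> * K * M)) * real T"
      by simp
    moreover have "(1 / real T) * x \<le> b / \<epsilon>" if "\<epsilon> * x \<le> b * real T" for x b
      using that T C(2) by (simp add: field_simps)
    ultimately show ?case by blast
  qed
qed

lemma integral_sum_queues: "(\<integral>\<omega>. (\<Sum>t=1..T. l1norm (Q t \<omega>)) \<partial>P) = total (T + 1)"
proof -
  have "(\<integral>\<omega>. (\<Sum>t=1..T. l1norm (Q t \<omega>)) \<partial>P) = (\<integral>\<omega>. (\<Sum>t=1..T. \<Sum>i\<in>UNIV. Q t \<omega> $ i) \<partial>P)"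
  proof (rule integral_cong_AE)
    show "AE \<omega> in P. (\<Sum>t=1..T. l1norm (Q t \<omega>)) = (\<Sum>t=1..T. \<Sum>i\<in>UNIV. Q t \<omega> $ i)"
      using AE_good by eventually_elim (simp add: l1norm_def Q_nonneg)
  qed (intro borel_measurable_sum borel_measurable_l1norm Q_measurable Q_nth_measurable)+
  also have "\<dots> = (\<Sum>t=1..T. \<Sum>i\<in>UNIV. m t i)"
    unfolding m_def by (simp add: Bochner_Integration.integral_sum Bochner_Integration.integrable_sum integrable_Q)
  also have "\<dots> = (\<Sum>t\<in>{..<T + 1}. \<Sum>i\<in>UNIV. m t i)"
    by (rule sum.mono_neutral_left) (auto simp: m_def queue_process_0 not_le)
  finally show ?thesis by (simp add: total_def)
qed

text \<open>
  As the bound holds eventually without a correction, the positive part of the excess is a null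
  sequence.
\<close>
lemma average_bound:
  defines "B \<equiv> (2 * (K + 1) * M\<^sup>2 + 4 * C\<^sub>W * (K * M\<^sup>2 + \<epsilon> * K * M)) / \<epsilon>"
  shows "\<exists>r. r \<longlonglongrightarrow> 0 \<and> (\<forall>T\<ge>1. (1 / real T) * (\<integral>\<omega>. (\<Sum>t=1..T. l1norm (Q t \<omega>)) \<partial>P) \<le> B + r T)"
proof (intro exI[of _ "\<lambda>T. max 0 ((1 / real T) * total (T + 1) - B)"] conjI allI impI)
  have "\<forall>\<^sub>F T in sequentially. 0 = max 0 ((1 / real T) * total (T + 1) - B)"
    using eventually_average_le by eventually_elim (simp add: B_def)
  then show "(\<lambda>T. max 0 ((1 / real T) * total (T + 1) - B)) \<longlonglongrightarrow> 0"
    by (rule Lim_transform_eventually[OF tendsto_const])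
qed (simp add: integral_sum_queues[simplified])

lemma stable_queues: "system_stable P Q"
  unfolding system_stable_def
proof (rule bigoI)
  show "\<forall>\<^sub>F T in sequentially. norm ((1 / real T) * (\<Sum>t<T. \<Sum>i\<in>UNIV. \<integral>\<omega>. Q t \<omega> $ i \<partial>P))
    \<le> ((2 * (K + 1) * M\<^sup>2 + 4 * C\<^sub>W * (K * M\<^sup>2 + \<epsilon> * K * M)) / \<epsilon>) * norm (1 :: real)"
    using eventually_average_le
  proof eventually_elim
    case (elim T)
    have "0 \<le> total T" unfolding total_def by (intro sum_nonneg m_nonneg)
    then have "norm ((1 / real T) * total T) = (1 / real T) * total T" by simp
    also have "\<dots> \<le> (1 / real T) * total (T + 1)" by (intro mult_left_mono total_mono) auto
    finally show ?case using elim by (simp add: total_def m_def)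
  qed
qed

end

theorem theorem5p2:
  fixes P :: "'w measure"
    and M \<epsilon> \<delta> C\<^sub>W C\<^sub>V :: real
    and \<A> \<S> :: "nat \<Rightarrow> (real ^ 'k::finite) measure"
    and \<theta> :: "nat \<Rightarrow> real ^ 'k"
    and A S e :: "nat \<Rightarrow> 'w \<Rightarrow> real ^ 'k"
    and a :: "nat \<Rightarrow> 'w \<Rightarrow> 'k"
  defines "Q \<equiv> queue_process A S a"
    and "K \<equiv> real CARD('k)"
  assumes "problem_instance M \<A> \<S>"
    and "piecewise_stabilizable (\<lambda>t. mean (\<A> t)) (\<lambda>t. mean (\<S> t)) \<theta> C\<^sub>W \<epsilon>"
    and "reference_stationary \<theta> \<delta> C\<^sub>V"
    and "\<delta> < 1"
    and "arrivals_services P \<A> \<S> A S"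
    and "runs_softmw P M \<delta> A S e a"
  shows "(\<exists>r :: nat \<Rightarrow> real. r \<longlonglongrightarrow> 0 \<and>
           (\<forall>T\<ge>1. (1 / real T) * (\<integral>\<omega>. (\<Sum>t=1..T. l1norm (Q t \<omega>)) \<partial>P) \<le>
              (2 * (K + 1) * M\<^sup>2 + 4 * C\<^sub>W * (K * M\<^sup>2 + \<epsilon> * K * M)) / \<epsilon> + r T)) \<and>
         system_stable P Q"
proof -
  interpret softmw_system P M K \<delta> \<epsilon> C\<^sub>W C\<^sub>V \<A> \<S> \<theta> A S e a
    using assms(3-) by unfold_locales (simp add: K_def)
  show ?thesis unfolding Q_def using average_bound stable_queues by blast
qed

end
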